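(* Let $R=\mathbb{Q}[z]$. There is an isomorphism of $R$-algebras $\nabla:\mathcal{E}\to R[\mathcal{S}_0]$, where $\mathcal{E}$ is the skein algebra of virtual knots and $R[\mathcal{S}_0]$ is the polynomial algebra over $R$ generated by the set $\mathcal{S}_0$ of homotopy classes of homotopically non-trivial virtual strings.
   Context: A virtual string is an oriented circle $S$ with $2m$ distinct points partitioned into $m$ ordered pairs $(a,b)$ (arrows); $ab$ is the arc from $a$ to $b$ in the positive direction. Homotopy of strings: generated by orientation-preserving homeomorphisms carrying arrows to arrows and the moves (a) add $(a,b)$ with $ab$ free of endpoints; (b) for two disjoint endpoint-free arcs with endpoints $a,a'$ and $b,b'$ (any orders), add $(a,b),(b',a')$; (c) replace $(a^+,b),(b^+,c),(c^+,a)$, with $aa^+,bb^+,cc^+$ disjoint endpoint-free arcs, by $(a,b^+),(b,c^+),(c,a^+)$; and inverses. Homotopically trivial = homotopic to a string without arrows. An arrow diagram is a virtual string with a sign $\pm$ on each arrow. Moves on arrow diagrams: (a) add $(a,b)$ with $ab$ endpoint-free, with either sign; (b) as string move (b), the two new arrows having opposite signs; (c) replace arrows $((a^+,b),+),((b^+,c),+),((c^+,a),-)$ (arcs as in (c)) by $((a,b^+),+),((b,c^+),+),((c,a^+),-)$. A virtual knot is an equivalence class of arrow diagrams under sign-preserving homeomorphisms, these moves and inverses; $[D]$ is the class of $D$; the trivial virtual knot is the class of the diagram with no arrows. $\mathcal{K}$ is the set of virtual knots and $R[\mathcal{K}]$ the commutative polynomial algebra over $R$ on $\mathcal{K}$.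 For an arrow diagram $D$ with core $S$ and an arrow $e=(a,b)$ of sign $+$: $D^-_e$ is $D$ with the sign of $e$ changed to $-$; $D'_e$ is $D$ with all arrows having at least one endpoint on $ba$ removed; $D''_e$ is $D$ with all arrows having at least one endpoint on $ab$ removed. The skein ideal is the ideal of $R[\mathcal{K}]$ generated by the trivial virtual knot and all elements $[D]-[D^-_e]-z[D'_e][D''_e]$; $\mathcal{E}$ is the quotient of $R[\mathcal{K}]$ by the skein ideal. *)

theory Defs
  imports "HOL-Library.Poly_Mapping" "HOL-Computational_Algebra.Polynomial"
begin

text \<open>The oriented circle S is modelled by the real line with one extra (never used) point
  at infinity; positive direction = increasing reals, wrapping around through infinity.
  cbetween a x b: x lies in the interior of the positive arc from a to b.\<close>

definition cbetween :: "real \<Rightarrow> real \<Rightarrow> real \<Rightarrow> bool" where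
  "cbetween a x b \<longleftrightarrow> (a < b \<and> a < x \<and> x < b) \<or> (b < a \<and> (a < x \<or> x < b))"

definition on_arc :: "real \<Rightarrow> real \<Rightarrow> real \<Rightarrow> bool" where
  "on_arc a b x \<longleftrightarrow> x = a \<or> x = b \<or> cbetween a x b"

text \<open>Arrows (a,b) carrying a label l: unit for virtual strings, bool for arrow diagrams
  (True = sign +, False = sign -).\<close>
type_synonym 'l arrows = "(real \<times> real \<times> 'l) set"

definition endpoints :: "'l arrows \<Rightarrow> real set" where
  "endpoints D = (\<Union>(a, b, l)\<in>D. {a, b})"

definition wf_arrows :: "'l arrows \<Rightarrow> bool" where
  "wf_arrows D \<longleftrightarrow> finite D \<and> (\<forall>(a, b, l)\<in>D. a \<noteq> b) \<and>
     (\<forall>e\<in>D. \<forall>e'\<in>D. e \<noteq> e' \<longrightarrow> {fst e, fst (snd e)} \<inter> {fst e', fst (snd e')} = {})"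

definition arc_free :: "'l arrows \<Rightarrow> real set \<Rightarrow> real \<Rightarrow> real \<Rightarrow> bool" where
  "arc_free D Q x y \<longleftrightarrow> (\<forall>p \<in> endpoints D \<union> Q. \<not> cbetween x p y)"

text \<open>Orientation-preserving homeomorphisms of the circle carrying arrows to arrows
  (preserving labels) correspond exactly to cyclic-order preserving bijections of the
  endpoint sets.\<close>
definition homeo_rel :: "'l arrows \<Rightarrow> 'l arrows \<Rightarrow> bool" where
  "homeo_rel D D' \<longleftrightarrow> (\<exists>f. bij_betw f (endpoints D) (endpoints D') \<and>
     (\<forall>x\<in>endpoints D. \<forall>y\<in>endpoints D. \<forall>w\<in>endpoints D.
        cbetween x y w \<longleftrightarrow> cbetween (f x) (f y) (f w)) \<and>
     D' = (\<lambda>(a, b, l). (f a, f b, l)) ` D)"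

definition move_a :: "'l arrows \<Rightarrow> 'l arrows \<Rightarrow> bool" where
  "move_a D D' \<longleftrightarrow> (\<exists>a b l. a \<notin> endpoints D \<and> b \<notin> endpoints D \<and> a \<noteq> b \<and>
     arc_free D {} a b \<and> D' = insert (a, b, l) D)"

definition move_b :: "('l \<Rightarrow> 'l \<Rightarrow> bool) \<Rightarrow> 'l arrows \<Rightarrow> 'l arrows \<Rightarrow> bool" where
  "move_b Pb D D' \<longleftrightarrow> (\<exists>a a' b b' l l'. distinct [a, a', b, b'] \<and>
     {a, a', b, b'} \<inter> endpoints D = {} \<and>
     (arc_free D {b, b'} a a' \<or> arc_free D {b, b'} a' a) \<and>
     (arc_free D {a, a'} b b' \<or> arc_free D {a, a'} b' b) \<and>
     Pb l l' \<and> D' = D \<union> {(a, b, l), (b', a', l')})"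

text \<open>Move (c): replace (a+,b),(b+,c),(c+,a) by (a,b+),(b,c+),(c,a+), the arcs aa+, bb+,
  cc+ being endpoint-free (hence pairwise disjoint); labels l1,l2,l3 (kept in this order)
  must satisfy Pc.\<close>
definition move_c :: "('l \<Rightarrow> 'l \<Rightarrow> 'l \<Rightarrow> bool) \<Rightarrow> 'l arrows \<Rightarrow> 'l arrows \<Rightarrow> bool" where
  "move_c Pc D D' \<longleftrightarrow> (\<exists>E a ap b bp c cp l1 l2 l3.
     distinct [a, ap, b, bp, c, cp] \<and> {a, ap, b, bp, c, cp} \<inter> endpoints E = {} \<and>
     D = E \<union> {(ap, b, l1), (bp, c, l2), (cp, a, l3)} \<and>
     D' = E \<union> {(a, bp, l1), (b, cp, l2), (c, ap, l3)} \<and>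
     arc_free D {} a ap \<and> arc_free D {} b bp \<and> arc_free D {} c cp \<and> Pc l1 l2 l3)"

definition move_step :: "('l \<Rightarrow> 'l \<Rightarrow> bool) \<Rightarrow> ('l \<Rightarrow> 'l \<Rightarrow> 'l \<Rightarrow> bool) \<Rightarrow>
    'l arrows \<Rightarrow> 'l arrows \<Rightarrow> bool" where
  "move_step Pb Pc D D' \<longleftrightarrow> wf_arrows D \<and> wf_arrows D' \<and>
     (homeo_rel D D' \<or> move_a D D' \<or> move_b Pb D D' \<or> move_c Pc D D')"

definition arrows_equiv :: "('l \<Rightarrow> 'l \<Rightarrow> bool) \<Rightarrow> ('l \<Rightarrow> 'l \<Rightarrow> 'l \<Rightarrow> bool) \<Rightarrow>
    'l arrows \<Rightarrow> 'l arrows \<Rightarrow> bool" where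
  "arrows_equiv Pb Pc D D' \<longleftrightarrow> wf_arrows D \<and> wf_arrows D' \<and> equivclp (move_step Pb Pc) D D'"

lemma arrows_equiv_part_equivp: "part_equivp (arrows_equiv Pb Pc)"
proof (rule part_equivpI)
  show "\<exists>x. arrows_equiv Pb Pc x x"
    by (rule exI[of _ "{}"]) (simp add: arrows_equiv_def wf_arrows_def)
  show "symp (arrows_equiv Pb Pc)"
    by (rule sympI) (auto simp: arrows_equiv_def intro: equivclp_sym)
  show "transp (arrows_equiv Pb Pc)"
    by (rule transpI) (auto simp: arrows_equiv_def intro: equivclp_trans)
qed

definition str_b :: "unit \<Rightarrow> unit \<Rightarrow> bool" where "str_b l l' = True"
definition str_c :: "unit \<Rightarrow> unit \<Rightarrow> unit \<Rightarrow> bool" where "str_c l1 l2 l3 = True"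

definition ad_b :: "bool \<Rightarrow> bool \<Rightarrow> bool" where "ad_b l l' \<longleftrightarrow> l' = (\<not> l)"
definition ad_c :: "bool \<Rightarrow> bool \<Rightarrow> bool \<Rightarrow> bool" where "ad_c l1 l2 l3 \<longleftrightarrow> l1 \<and> l2 \<and> \<not> l3"

quotient_type vstring = "unit arrows" / partial: "arrows_equiv str_b str_c"
  by (rule arrows_equiv_part_equivp)

quotient_type vknot = "bool arrows" / partial: "arrows_equiv ad_b ad_c"
  by (rule arrows_equiv_part_equivp)

definition S0 :: "vstring set" where
  "S0 = {s. s \<noteq> abs_vstring {}}"

type_synonym R = "rat poly"

text \<open>R[X] for a type X: polynomials in commuting variables indexed by X, as finitely
  supported maps from monomials (X \<Rightarrow>0 nat) to coefficients.\<close>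
type_synonym 'x RX = "('x \<Rightarrow>\<^sub>0 nat) \<Rightarrow>\<^sub>0 R"

definition pvar :: "'x \<Rightarrow> 'x RX" where
  "pvar x = Poly_Mapping.single (Poly_Mapping.single x 1) 1"

definition pconst :: "R \<Rightarrow> 'x RX" where
  "pconst c = Poly_Mapping.single 0 c"

definition RS0 :: "vstring RX set" where
  "RS0 = {p. \<forall>m \<in> Poly_Mapping.keys p. Poly_Mapping.keys m \<subseteq> S0}"

definition zvar :: R where "zvar = [:0, 1:]"

definition neg_arrow :: "real \<times> real \<times> bool \<Rightarrow> bool arrows \<Rightarrow> bool arrows" where
  "neg_arrow e D = insert (fst e, fst (snd e), False) (D - {e})"

text \<open>D'_e: remove all arrows with an endpoint on the arc ba; D''_e: on the arc ab.\<close>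
definition remove_arc :: "real \<Rightarrow> real \<Rightarrow> bool arrows \<Rightarrow> bool arrows" where
  "remove_arc x y D = {e \<in> D. \<not> on_arc x y (fst e) \<and> \<not> on_arc x y (fst (snd e))}"

definition skein_gens :: "vknot RX set" where
  "skein_gens = insert (pvar (abs_vknot {}))
     {pvar (abs_vknot D) - pvar (abs_vknot (neg_arrow e D))
        - pconst zvar * pvar (abs_vknot (remove_arc (fst (snd e)) (fst e) D))
                      * pvar (abs_vknot (remove_arc (fst e) (fst (snd e)) D))
      | D e. wf_arrows D \<and> e \<in> D \<and> snd (snd e) = True}"

inductive_set ideal_gen :: "'a::comm_ring_1 set \<Rightarrow> 'a set" for G where
  zero: "0 \<in> ideal_gen G"
| gen: "g \<in> G \<Longrightarrow> g \<in> ideal_gen G"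
| add: "x \<in> ideal_gen G \<Longrightarrow> y \<in> ideal_gen G \<Longrightarrow> x + y \<in> ideal_gen G"
| mult: "x \<in> ideal_gen G \<Longrightarrow> r * x \<in> ideal_gen G"

definition skein_ideal :: "vknot RX set" where
  "skein_ideal = ideal_gen skein_gens"

definition R_alg_hom :: "('x RX \<Rightarrow> 'y RX) \<Rightarrow> bool" where
  "R_alg_hom f \<longleftrightarrow> (\<forall>p q. f (p + q) = f p + f q) \<and> (\<forall>p q. f (p * q) = f p * f q) \<and>
     f 1 = 1 \<and> (\<forall>c p. f (pconst c * p) = pconst c * f p)"

end

theory Submission
  imports Defs
begin

text \<open>
  For an arrow diagram \<open>D\<close> sum over all sets \<open>F\<close> of pairwise noncrossing arrows of \<open>D\<close>. Cutting
  the circle along \<open>F\<close> gives \<open>|F| + 1\<close> circles, which are the vertices of a tree with edge set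
  \<open>F\<close>, and every circle carries the string of the arrows of \<open>D\<close> that survive on it. The term of
  \<open>F\<close> is the product of these strings times \<open>z ^ |F|\<close>, times the product of the signs of \<open>F\<close>,
  times the probability that a random linear order of the circles is increasing from left to
  right across every positive arrow of \<open>F\<close> and decreasing across every negative one. Changing
  the sign of \<open>e\<close> trades one order constraint for the opposite one; the two probabilities add up
  to the one without constraint at \<open>e\<close>, which factors. This is the skein relation. Invariance
  under moves (a) and (b) is cancellation in pairs or because a circle carries the trivial
  string, and under move (c) it comes down to \<open>P(X, Y < Z) = P(X < Y < Z) + P(Y < X < Z)\<close>.

  The term of \<open>F = {}\<close> is the underlying string of \<open>D\<close> and the other terms have fewer arrows.
  Hence the map is onto, and its inverse \<open>psi\<close> is determined recursively, in the skein algebra,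
  by the requirement that the state sum of \<open>D\<close> with values in \<open>psi\<close> be the class of \<open>D\<close>. The
  skein relation shows that \<open>psi\<close> does not depend on the signs, and the analysis of the moves,
  applied to the terms with \<open>F \<noteq> {}\<close>, shows by induction on the number of arrows that \<open>psi\<close> is a
  homotopy invariant of strings.
\<close>

subsection \<open>Linear extensions\<close>

text \<open>The state sum is developed for an arbitrary ring map \<open>\<kappa>\<close> on
  coefficients and an arbitrary valuation \<open>I\<close> of pieces, since it is used twice: with
  \<open>str_var\<close> it defines the homomorphism, with \<open>psi\<close> it computes in the
  skein algebra. In the second use the invariance of \<open>I\<close> is not given but has to be
  proved together with that of the sum. This is why \<open>invariant_below\<close> assumes
  invariance only for diagrams with fewer than \<open>M\<close> arrows and why the analysis concerns
  \<open>proper_sum\<close>, whose terms see only such pieces of a diagram with at most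
  \<open>M\<close> arrows. A second obstacle is that the moves of diagrams restrict signs and the
  moves of strings do not. Hence \<open>psi_flip\<close> precedes \<open>psi_invariant\<close>: once
  signs are irrelevant, each string move can be realized with admissible signs. Rational
  coefficients enter through the probabilities: \<open>linprob\<close> divides by a factorial, and
  with this normalization disjoint order problems multiply.\<close>

definition linexts :: "'v set \<Rightarrow> ('v \<times> 'v) set \<Rightarrow> 'v list set" where
  "linexts V C = {xs. distinct xs \<and> set xs = V \<and> sorted_wrt (\<lambda>x y. (y, x) \<notin> C) xs}"

text \<open>A pair \<open>(u, v)\<close> in \<open>C\<close> puts \<open>u\<close> before
  \<open>v\<close> in the lists of \<open>linexts\<close>; contradictory constraints between
  distinct elements of \<open>V\<close> give probability 0.\<close>

definition linprob :: "'v set \<Rightarrow> ('v \<times> 'v) set \<Rightarrow> rat" where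
  "linprob V C = of_nat (card (linexts V C)) / fact (card V)"

lemma finite_linexts:
  assumes "finite V" shows "finite (linexts V C)"
proof (rule finite_subset)
  show "linexts V C \<subseteq> {xs. set xs \<subseteq> V \<and> length xs \<le> card V}"
    by (auto simp: linexts_def distinct_card)
qed (use assms in \<open>simp add: finite_lists_length_le\<close>)

lemma linexts_map:
  assumes "inj_on f V" "C \<subseteq> V \<times> V"
  shows "linexts (f ` V) (map_prod f f ` C) = map f ` linexts V C"
proof -
  have *: "((f y, f x) \<in> map_prod f f ` C) = ((y, x) \<in> C)" if "x \<in> V" "y \<in> V" for x y
  proof
    assume "(f y, f x) \<in> map_prod f f ` C"
    then obtain p q where pq: "(p, q) \<in> C" "f y = f p" "f x = f q" by auto
    then have "y = p" "x = q" using assms that by (auto dest: inj_onD)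
    then show "(y, x) \<in> C" using pq by simp
  qed (auto intro: rev_image_eqI)
  have "map f xs \<in> linexts (f ` V) (map_prod f f ` C)" if xs: "xs \<in> linexts V C" for xs
  proof -
    have s: "set xs = V" "sorted_wrt (\<lambda>x y. (y, x) \<notin> C) xs" using xs by (simp_all add:
        linexts_def)
    have "sorted_wrt (\<lambda>x y. (f y, f x) \<notin> map_prod f f ` C) xs"
      by (rule sorted_wrt_mono_rel[OF _ s(2)]) (metis * s(1))
    then show ?thesis using xs assms by (simp add: linexts_def distinct_map sorted_wrt_map)
  qed
  moreover have "ys \<in> map f ` linexts V C" if "ys \<in> linexts (f ` V) (map_prod f f ` C)" for ys
  proof -
    let ?xs = "map (inv_into V f) ys"
    have ys: "distinct ys" "set ys = f ` V" "sorted_wrt (\<lambda>x y. (y, x) \<notin> map_prod f f ` C) ys"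
      using that by (auto simp: linexts_def)
    have eq: "map f ?xs = ys"
      unfolding map_map using ys(2) by (intro map_idI) (simp add: f_inv_into_f)
    have "set ?xs = V" using ys assms by simp
    moreover have "distinct ?xs"
      by (rule distinct_map[of f, THEN iffD1, THEN conjunct1], simp only: eq ys(1))
    moreover have "sorted_wrt (\<lambda>x y. (y, x) \<notin> C) ?xs"
    proof -
      have "sorted_wrt (\<lambda>x y. (f y, f x) \<notin> map_prod f f ` C) ?xs"
        by (rule sorted_wrt_map[THEN iffD1], simp only: eq ys(3))
      then show ?thesis
        by (rule sorted_wrt_mono_rel[rotated]) (auto intro: rev_image_eqI)
    qed
    ultimately show ?thesis using eq by (intro image_eqI[of _ _ ?xs]) (auto simp: linexts_def)
  qed
  ultimately show ?thesis by blast
qed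

lemma linprob_map:
  assumes "inj_on f V" "C \<subseteq> V \<times> V"
  shows "linprob (f ` V) (map_prod f f ` C) = linprob V C"
proof -
  have "inj_on (map f) (linexts V C)"
    using assms(1) by (auto simp: linexts_def intro!: inj_on_mapI inj_on_subset[OF assms(1)])
  then show ?thesis
    using assms by (simp add: linprob_def linexts_map card_image)
qed

lemma linexts_rev: "linexts V (C\<inverse>) = rev ` linexts V C"
proof -
  have "xs \<in> linexts V (C\<inverse>) \<longleftrightarrow> rev xs \<in> linexts V C" for xs
    by (simp add: linexts_def sorted_wrt_rev)
  then have "linexts V (C\<inverse>) = rev -` linexts V C" by blast
  also have "\<dots> = rev ` linexts V C"
  proof (intro equalityI subsetI)
    fix xs assume "xs \<in> rev -` linexts V C"
    then have "rev (rev xs) \<in> rev ` linexts V C" by (intro imageI) simp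
    then show "xs \<in> rev ` linexts V C" by simp
  qed auto
  finally show ?thesis .
qed

text \<open>Reading an order backwards is a bijection. It accounts for the exchange of left and
  right when all arrows are reversed.\<close>

lemma linprob_converse: "linprob V (C\<inverse>) = linprob V C"
  by (simp add: linprob_def linexts_rev card_image)

text \<open>\<open>u\<close> before \<open>v\<close> and \<open>v\<close> before \<open>w\<close>
  already force \<open>u\<close> before \<open>w\<close>. In move (c) this lets the outer constraint
  of a chain of three circles be dropped.\<close>

lemma linprob_trans:
  assumes "(u, v) \<in> C" "(v, w) \<in> C" "u \<in> V" "v \<in> V" "w \<in> V" "u \<noteq> v" "v \<noteq> w"
  shows "linprob V (insert (u, w) C) = linprob V C"
proof (cases "u = w")
  case True
  \<comment> \<open>For \<open>u = w\<close> the two given constraints contradict each other, so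
    neither side has a linear extension.\<close>
  have "xs \<notin> linexts V C" for xs
  proof
    assume "xs \<in> linexts V C"
    then have xs: "distinct xs" "set xs = V" "sorted_wrt (\<lambda>x y. (y, x) \<notin> C) xs"
      by (auto simp: linexts_def)
    obtain i j where "i < length xs" "xs ! i = u" "j < length xs" "xs ! j = v"
      using assms xs by (metis in_set_conv_nth)
    then show False using xs assms True
      by (metis linorder_neqE_nat sorted_wrt_nth_less)
  qed
  moreover have "linexts V (insert (u,w) C) \<subseteq> linexts V C"
    by (auto simp: linexts_def elim: sorted_wrt_mono_rel[rotated])
  ultimately have "linexts V C = {}" "linexts V (insert (u,w) C) = {}" by blast+
  then show ?thesis by (simp add: linprob_def)
next
  case False
  have "linexts V (insert (u, w) C) = linexts V C"
  proof
    show "linexts V (insert (u,w) C) \<subseteq> linexts V C"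
      by (auto simp: linexts_def elim: sorted_wrt_mono_rel[rotated])
    show "linexts V C \<subseteq> linexts V (insert (u,w) C)"
    proof
      fix xs assume "xs \<in> linexts V C"
      then have xs: "distinct xs" "set xs = V" "sorted_wrt (\<lambda>x y. (y, x) \<notin> C) xs"
        by (auto simp: linexts_def)
      have "(xs ! j, xs ! i) \<noteq> (u, w)" if "i < j" "j < length xs" for i j
      proof
        assume eq: "(xs ! j, xs ! i) = (u, w)"
        obtain k where k: "k < length xs" "xs ! k = v"
          using assms xs by (metis in_set_conv_nth)
        have "\<not> k < j" using sorted_wrt_nth_less[OF xs(3), of k j] that k eq assms by auto
        moreover have "\<not> i < k" using sorted_wrt_nth_less[OF xs(3), of i k] that k eq assms by auto
        ultimately show False using that by simp
      qed
      then show "xs \<in> linexts V (insert (u,w) C)"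
        using xs by (auto simp: linexts_def sorted_wrt_iff_nth_less)
    qed
  qed
  then show ?thesis by (simp add: linprob_def)
qed

text \<open>In every order exactly one of \<open>u\<close> and \<open>v\<close> comes first. Applied
  to the two sides of an arrow this gives the skein relation, applied to two sides of a triangle it
  gives move (c).\<close>

lemma linprob_split:
  assumes "finite V" "u \<in> V" "v \<in> V" "u \<noteq> v"
  shows "linprob V (insert (u, v) C) + linprob V (insert (v, u) C) = linprob V C"
proof -
  have sub: "linexts V (insert p C) \<subseteq> linexts V C" for p
    by (auto simp: linexts_def elim: sorted_wrt_mono_rel[rotated])
  have "linexts V C \<subseteq> linexts V (insert (u,v) C) \<union> linexts V (insert (v,u) C)"
  proof
    fix xs assume "xs \<in> linexts V C"
    then have xs: "distinct xs" "set xs = V" "sorted_wrt (\<lambda>x y. (y, x) \<notin> C) xs"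
      by (auto simp: linexts_def)
    obtain i j where ij: "i < length xs" "xs ! i = u" "j < length xs" "xs ! j = v"
      using assms xs by (metis in_set_conv_nth)
    have "xs \<in> linexts V (insert (if i < j then (u,v) else (v,u)) C)"
      using xs ij assms by (auto simp: linexts_def sorted_wrt_iff_nth_less nth_eq_iff_index_eq)
    then show "xs \<in> linexts V (insert (u,v) C) \<union> linexts V (insert (v,u) C)"
      by (auto split: if_splits)
  qed
  moreover have "linexts V (insert (u,v) C) \<inter> linexts V (insert (v,u) C) = {}"
  proof (rule equals0I)
    fix xs assume "xs \<in> linexts V (insert (u,v) C) \<inter> linexts V (insert (v,u) C)"
    then have xs: "distinct xs" "set xs = V" "sorted_wrt (\<lambda>x y. (y, x) \<notin> insert (u,v) C) xs"
      "sorted_wrt (\<lambda>x y. (y, x) \<notin> insert (v,u) C) xs"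
      by (auto simp: linexts_def)
    obtain i j where ij: "i < length xs" "xs ! i = u" "j < length xs" "xs ! j = v"
      using assms xs by (metis in_set_conv_nth)
    then show False using assms sorted_wrt_nth_less[OF xs(3), of j i] sorted_wrt_nth_less[OF xs(4), of i j]
      by (metis insertI1 linorder_neqE_nat)
  qed
  ultimately have "card (linexts V C) = card (linexts V (insert (u,v) C)) + card (linexts V (insert (v,u) C))"
    using sub[of "(u,v)"] sub[of "(v,u)"] finite_linexts[OF assms(1)]
    by (subst card_Un_disjoint[symmetric]) (auto intro!: arg_cong[where f=card])
  then show ?thesis by (simp add: linprob_def add_divide_distrib)
qed

text \<open>Constraints inside \<open>V1\<close> and inside \<open>V2\<close> never compare the two
  parts, so an order of the union is an arbitrary interleaving of admissible orders of the
  parts.\<close>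

lemma linexts_Un:
  assumes "V1 \<inter> V2 = {}" "C1 \<subseteq> V1 \<times> V1" "C2 \<subseteq> V2 \<times> V2"
  shows "linexts (V1 \<union> V2) (C1 \<union> C2) = (\<Union>(xs, ys)\<in>linexts V1 C1 \<times>
      linexts V2 C2. shuffles xs ys)"
proof (intro equalityI subsetI)
  fix zs assume "zs \<in> linexts (V1 \<union> V2) (C1 \<union> C2)"
  then have zs: "distinct zs" "set zs = V1 \<union> V2" "sorted_wrt (\<lambda>x y. (y, x) \<notin> C1
      \<union> C2) zs"
    by (auto simp: linexts_def)
  have "filter (\<lambda>x. x \<in> V1) zs \<in> linexts V1 C1"
    using zs assms sorted_wrt_mono_rel[OF _ sorted_wrt_filter[OF zs(3)], of "\<lambda>x. x \<in> V1"
        "\<lambda>x y. (y, x) \<notin> C1"]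
    by (auto simp: linexts_def)
  moreover have "filter (\<lambda>x. x \<notin> V1) zs \<in> linexts V2 C2"
    using zs assms sorted_wrt_mono_rel[OF _ sorted_wrt_filter[OF zs(3)], of "\<lambda>x. x \<notin> V1"
        "\<lambda>x y. (y, x) \<notin> C2"]
    by (auto simp: linexts_def)
  ultimately show "zs \<in> (\<Union>(xs, ys)\<in>linexts V1 C1 \<times> linexts V2 C2. shuffles xs ys)"
    using partition_in_shuffles[of zs "\<lambda>x. x \<in> V1"] by blast
next
  fix zs assume "zs \<in> (\<Union>(xs, ys)\<in>linexts V1 C1 \<times> linexts V2 C2. shuffles xs ys)"
  then obtain xs ys where zs: "zs \<in> shuffles xs ys" and xy: "xs \<in> linexts V1 C1" "ys \<in>
      linexts V2 C2" by auto
  then have xs: "distinct xs" "set xs = V1" "sorted_wrt (\<lambda>x y. (y, x) \<notin> C1) xs"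
    and ys: "distinct ys" "set ys = V2" "sorted_wrt (\<lambda>x y. (y, x) \<notin> C2) ys" by (auto
        simp: linexts_def)
  have d: "distinct zs" "set zs = V1 \<union> V2"
    using distinct_disjoint_shuffles[OF xs(1) ys(1) _ zs] set_shuffles[OF zs] assms xs ys by auto
  have f: "filter (\<lambda>x. x \<in> V1) zs = xs" "filter (\<lambda>x. x \<in> V2) zs = ys"
    using filter_shuffles_disjoint1[OF _ zs] filter_shuffles_disjoint2[OF _ zs] assms xs ys by auto
  have "sorted_wrt (\<lambda>x y. (y, x) \<notin> C) us"
    if "sorted_wrt (\<lambda>x y. (y, x) \<notin> C) (filter (\<lambda>x. x \<in> V) us)" "C \<subseteq>
        V \<times> V" for us :: "'a list" and C V
    using that by (induction us) (auto split: if_splits)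
  from this[of C1 V1 zs] this[of C2 V2 zs] have "sorted_wrt (\<lambda>x y. (y, x) \<notin> C1) zs"
      "sorted_wrt (\<lambda>x y. (y, x) \<notin> C2) zs"
    using xs ys f assms by auto
  then show "zs \<in> linexts (V1 \<union> V2) (C1 \<union> C2)"
    using d by (auto simp: linexts_def sorted_wrt_iff_nth_less)
qed

text \<open>Independence of the two parts: every pair of admissible lists has
  \<open>(card V1 + card V2) choose card V1\<close> shuffles, and this binomial is absorbed by the
  factorials in \<open>linprob\<close>.\<close>

lemma linprob_Un:
  assumes "finite V1" "finite V2" "V1 \<inter> V2 = {}" "C1 \<subseteq> V1 \<times> V1" "C2 \<subseteq>
      V2 \<times> V2"
  shows "linprob (V1 \<union> V2) (C1 \<union> C2) = linprob V1 C1 * linprob V2 C2"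
proof -
  have len: "length xs = card V" if "xs \<in> linexts V C" for xs V C
    using that by (metis (mono_tags, lifting) distinct_card linexts_def mem_Collect_eq)
  have uniq: "xs = filter (\<lambda>x. x \<in> V1) zs \<and> ys = filter (\<lambda>x. x \<in> V2) zs"
    if "xs \<in> linexts V1 C1" "ys \<in> linexts V2 C2" "zs \<in> shuffles xs ys" for xs ys zs
    using that filter_shuffles_disjoint1[of xs ys zs] filter_shuffles_disjoint2[of xs ys zs] assms(3)
    by (auto simp: linexts_def)
  have "card (linexts (V1 \<union> V2) (C1 \<union> C2)) = (\<Sum>(xs, ys)\<in>linexts V1 C1 \<times>
      linexts V2 C2. card (shuffles xs ys))"
    unfolding linexts_Un[OF assms(3-5)]
  proof (subst card_UN_disjoint)
    show "\<forall>i\<in>linexts V1 C1 \<times> linexts V2 C2. \<forall>j\<in>linexts V1 C1 \<times>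
        linexts V2 C2. i \<noteq> j \<longrightarrow>
        (case i of (xs, ys) \<Rightarrow> shuffles xs ys) \<inter> (case j of (xs, ys) \<Rightarrow>
            shuffles xs ys) = {}"
    proof (intro ballI impI equals0I)
      fix i j zs assume ij: "i \<in> linexts V1 C1 \<times> linexts V2 C2" "j \<in> linexts V1 C1
          \<times> linexts V2 C2" "i \<noteq> j"
        and zs: "zs \<in> (case i of (xs, ys) \<Rightarrow> shuffles xs ys) \<inter> (case j of (xs, ys)
            \<Rightarrow> shuffles xs ys)"
      obtain xs ys xs' ys' where e: "i = (xs, ys)" "j = (xs', ys')" by (metis surj_pair)
      show False using uniq[of xs ys zs] uniq[of xs' ys' zs] ij zs by (simp add: e)
    qed
  next
    show "(\<Sum>i\<in>linexts V1 C1 \<times> linexts V2 C2. card (case i of (xs, ys) \<Rightarrow>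
        shuffles xs ys)) =
      (\<Sum>(xs, ys)\<in>linexts V1 C1 \<times> linexts V2 C2. card (shuffles xs ys))"
      by (rule sum.cong) (simp_all add: split_beta)
  qed (auto simp: finite_linexts assms)
  also have "\<dots> = (\<Sum>p\<in>linexts V1 C1 \<times> linexts V2 C2. (card V1 + card V2) choose card V1)"
  proof (rule sum.cong[OF refl])
    fix p assume "p \<in> linexts V1 C1 \<times> linexts V2 C2"
    then obtain xs ys where p: "p = (xs, ys)" "xs \<in> linexts V1 C1" "ys \<in> linexts V2 C2" by auto
    then have "set xs \<inter> set ys = {}" using assms(3) by (simp add: linexts_def)
    then show "(case p of (xs, ys) \<Rightarrow> card (shuffles xs ys)) = (card V1 + card V2) choose card V1"
      using len[OF p(2)] len[OF p(3)] by (simp add: p(1) card_disjoint_shuffles)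
  qed
  also have "\<dots> = card (linexts V1 C1) * card (linexts V2 C2) * ((card V1 + card V2) choose card V1)"
    by (simp add: card_cartesian_product)
  finally have "(of_nat (card (linexts (V1 \<union> V2) (C1 \<union> C2))) :: rat) =
     of_nat (card (linexts V1 C1)) * of_nat (card (linexts V2 C2)) * (fact (card V1 + card V2) / (fact
         (card V1) * fact (card V2)))"
    by (simp add: binomial_fact)
  then show ?thesis
    using assms by (simp add: linprob_def card_Un_disjoint)
qed

lemma linprob_single: "C \<inter> {(v, v)} = {} \<Longrightarrow> linprob {v} C = 1"
proof -
  have "linexts {v} C = {[v]}"
  proof -
    have "xs = [v]" if "distinct xs" "set xs = {v}" for xs
      using that by (cases xs rule: remdups_adj.cases) auto
    then show ?thesis by (auto simp: linexts_def)
  qed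
  then show ?thesis by (simp add: linprob_def)
qed

subsection \<open>Evaluation of polynomials\<close>

definition ring_homo :: "('a::comm_ring_1 \<Rightarrow> 'b::comm_ring_1) \<Rightarrow> bool" where
  "ring_homo h \<longleftrightarrow> (\<forall>x y. h (x + y) = h x + h y) \<and> (\<forall>x y. h (x *
      y) = h x * h y) \<and> h 1 = 1"

lemma ring_homoD:
  assumes "ring_homo h"
  shows "h (x + y) = h x + h y" "h (x * y) = h x * h y" "h 1 = 1" "h 0 = 0" "h (- x) = - h x" "h (x - y)
      = h x - h y"
proof -
  show a: "h (x + y) = h x + h y" for x y using assms by (simp add: ring_homo_def)
  show "h (x * y) = h x * h y" "h 1 = 1" using assms by (simp_all add: ring_homo_def)
  show z: "h 0 = 0" using a[of 0 0] by simp
  show m: "h (- x) = - h x" for x using a[of x "- x"] z by (simp add: eq_neg_iff_add_eq_0 add.commute)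
  show "h (x - y) = h x - h y" using a[of x "- y"] m[of y] by simp
qed

lemma ring_homo_sum: "ring_homo h \<Longrightarrow> h (sum f A) = (\<Sum>x\<in>A. h (f x))"
  by (induction A rule: infinite_finite_induct) (simp_all add: ring_homoD[of h])

lemma ring_homo_prod: "ring_homo h \<Longrightarrow> h (prod f A) = (\<Prod>x\<in>A. h (f x))"
  by (induction A rule: infinite_finite_induct) (simp_all add: ring_homoD[of h])

lemma ring_homo_power: "ring_homo h \<Longrightarrow> h (x ^ n) = h x ^ n"
  by (induction n) (simp_all add: ring_homoD[of h])

definition mono_eval :: "('x \<Rightarrow> 'a::comm_ring_1) \<Rightarrow> ('x \<Rightarrow>\<^sub>0 nat)
    \<Rightarrow> 'a" where
  "mono_eval \<phi> m = (\<Prod>x\<in>Poly_Mapping.keys m. \<phi> x ^ Poly_Mapping.lookup m x)"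

text \<open>The map given by the universal property of the polynomial algebra. Coefficients pass
  through \<open>\<kappa>\<close> because the target is once \<open>vstring RX\<close> and once the
  quotient \<open>skein\<close>.\<close>

definition rx_eval :: "(R \<Rightarrow> 'a::comm_ring_1) \<Rightarrow> ('x \<Rightarrow> 'a)
    \<Rightarrow> 'x RX \<Rightarrow> 'a" where
  "rx_eval \<kappa> \<phi> p = (\<Sum>m\<in>Poly_Mapping.keys p. \<kappa> (Poly_Mapping.lookup p m) *
      mono_eval \<phi> m)"

lemma mono_eval_superset:
  assumes "finite A" "Poly_Mapping.keys m \<subseteq> A"
  shows "mono_eval \<phi> m = (\<Prod>x\<in>A. \<phi> x ^ Poly_Mapping.lookup m x)"
  unfolding mono_eval_def using assms
  by (intro prod.mono_neutral_left) (auto simp: in_keys_iff)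

lemma mono_eval_add: "mono_eval \<phi> (m + n) = mono_eval \<phi> m * mono_eval \<phi> n"
proof -
  let ?A = "Poly_Mapping.keys m \<union> Poly_Mapping.keys n"
  have "mono_eval \<phi> (m + n) = (\<Prod>x\<in>?A. \<phi> x ^ Poly_Mapping.lookup (m + n) x)"
    by (rule mono_eval_superset) (simp_all add: Poly_Mapping.keys_add)
  also have "\<dots> = mono_eval \<phi> m * mono_eval \<phi> n"
    by (simp add: mono_eval_superset[of ?A m] mono_eval_superset[of ?A n] lookup_add power_add prod.distrib)
  finally show ?thesis .
qed

lemma rx_eval_superset:
  assumes "ring_homo \<kappa>" "finite A" "Poly_Mapping.keys p \<subseteq> A"
  shows "rx_eval \<kappa> \<phi> p = (\<Sum>m\<in>A. \<kappa> (Poly_Mapping.lookup p m) * mono_eval \<phi> m)"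
  unfolding rx_eval_def using assms
  by (intro sum.mono_neutral_left) (auto simp: in_keys_iff ring_homoD[of \<kappa>])

lemma rx_eval_add:
  assumes "ring_homo \<kappa>"
  shows "rx_eval \<kappa> \<phi> (p + q) = rx_eval \<kappa> \<phi> p + rx_eval \<kappa> \<phi> q"
proof -
  let ?A = "Poly_Mapping.keys p \<union> Poly_Mapping.keys q"
  have "rx_eval \<kappa> \<phi> (p + q) = (\<Sum>m\<in>?A. \<kappa> (Poly_Mapping.lookup (p + q) m) *
      mono_eval \<phi> m)"
    by (rule rx_eval_superset) (simp_all add: Poly_Mapping.keys_add assms)
  also have "\<dots> = rx_eval \<kappa> \<phi> p + rx_eval \<kappa> \<phi> q"
    by (simp add: rx_eval_superset[of \<kappa> ?A p] rx_eval_superset[of \<kappa> ?A q] lookup_add assms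
        ring_homoD(1)[OF assms] distrib_right sum.distrib)
  finally show ?thesis .
qed

lemma rx_eval_single:
  assumes "ring_homo \<kappa>"
  shows "rx_eval \<kappa> \<phi> (Poly_Mapping.single m c) = \<kappa> c * mono_eval \<phi> m"
  by (subst rx_eval_superset[of _ "{m}"]) (simp_all add: assms)

lemma poly_mapping_as_sum:
  fixes p :: "'a \<Rightarrow>\<^sub>0 'b::comm_monoid_add"
  shows "p = (\<Sum>m\<in>Poly_Mapping.keys p. Poly_Mapping.single m (Poly_Mapping.lookup p m))"
proof (rule poly_mapping_eqI)
  fix k
  have "(\<Sum>m\<in>Poly_Mapping.keys p. Poly_Mapping.lookup (Poly_Mapping.single m
      (Poly_Mapping.lookup p m)) k)
    = (\<Sum>m\<in>Poly_Mapping.keys p. if m = k then Poly_Mapping.lookup p m else 0)"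
    by (rule sum.cong) (auto simp: lookup_single when_def)
  also have "\<dots> = Poly_Mapping.lookup p k"
    by (simp add: sum.delta in_keys_iff)
  finally show "Poly_Mapping.lookup p k = Poly_Mapping.lookup (\<Sum>m\<in>Poly_Mapping.keys p.
      Poly_Mapping.single m (Poly_Mapping.lookup p m)) k"
    by (simp add: lookup_sum)
qed

lemma rx_eval_zero: "rx_eval \<kappa> \<phi> 0 = 0"
  by (simp add: rx_eval_def)

lemma rx_eval_sum: "ring_homo \<kappa> \<Longrightarrow> rx_eval \<kappa> \<phi> (sum f A) =
    (\<Sum>x\<in>A. rx_eval \<kappa> \<phi> (f x))"
  by (induction A rule: infinite_finite_induct) (simp_all add: rx_eval_add rx_eval_zero)

lemma rx_eval_mult:
  assumes "ring_homo \<kappa>"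
  shows "rx_eval \<kappa> \<phi> (p * q) = rx_eval \<kappa> \<phi> p * rx_eval \<kappa> \<phi> q"
proof -
  let ?s = "\<lambda>p m. Poly_Mapping.single m (Poly_Mapping.lookup p m)"
  have "p * q = (\<Sum>m\<in>Poly_Mapping.keys p. \<Sum>n\<in>Poly_Mapping.keys q. ?s p m * ?s q n)"
    by (subst poly_mapping_as_sum[of p], subst poly_mapping_as_sum[of q]) (rule sum_product)
  then have "rx_eval \<kappa> \<phi> (p * q) = (\<Sum>m\<in>Poly_Mapping.keys p.
      \<Sum>n\<in>Poly_Mapping.keys q. rx_eval \<kappa> \<phi> (?s p m * ?s q n))"
    by (simp only: rx_eval_sum[OF assms])
  also have "\<dots> = (\<Sum>m\<in>Poly_Mapping.keys p. \<Sum>n\<in>Poly_Mapping.keys q.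
      (\<kappa> (Poly_Mapping.lookup p m) * mono_eval \<phi> m) * (\<kappa> (Poly_Mapping.lookup q n) *
          mono_eval \<phi> n))"
    by (simp add: mult_single rx_eval_single assms mono_eval_add ring_homoD(2)[OF assms] mult_ac)
  also have "\<dots> = rx_eval \<kappa> \<phi> p * rx_eval \<kappa> \<phi> q"
    unfolding rx_eval_def by (rule sum_product[symmetric])
  finally show ?thesis .
qed

lemma mono_eval_zero [simp]: "mono_eval \<phi> 0 = 1"
  by (simp add: mono_eval_def)

lemma rx_eval_pconst: "ring_homo \<kappa> \<Longrightarrow> rx_eval \<kappa> \<phi> (pconst c) = \<kappa> c"
  by (simp add: pconst_def rx_eval_single)

lemma rx_eval_pvar: "ring_homo \<kappa> \<Longrightarrow> rx_eval \<kappa> \<phi> (pvar x) = \<phi> x"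
  by (simp add: pvar_def rx_eval_single mono_eval_def ring_homoD[of \<kappa>])

lemma rx_eval_ring_homo:
  assumes "ring_homo \<kappa>" shows "ring_homo (rx_eval \<kappa> \<phi>)"
  using rx_eval_pconst[OF assms, of \<phi> 1]
  by (simp add: ring_homo_def rx_eval_add rx_eval_mult assms pconst_def ring_homoD[OF assms])

lemma pconst_ring_homo: "ring_homo pconst"
  by (simp add: ring_homo_def pconst_def single_add mult_single)

lemma single_as_product:
  "Poly_Mapping.single m c = pconst c * mono_eval pvar m"
proof -
  have pow: "pvar x ^ n = Poly_Mapping.single (Poly_Mapping.single x n) 1" for x :: 'a and n
    by (induction n) (simp_all add: pvar_def mult_single single_add[symmetric] single_one)
  have "(\<Prod>x\<in>A. Poly_Mapping.single (f x) (1::R)) = Poly_Mapping.single (\<Sum>x\<in>A. f x) 1"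
    for A and f :: "'a \<Rightarrow> 'a \<Rightarrow>\<^sub>0 nat"
    by (induction A rule: infinite_finite_induct) (simp_all add: mult_single)
  then have "mono_eval pvar m = Poly_Mapping.single m 1"
    unfolding mono_eval_def pow using poly_mapping_as_sum[of m] by simp
  then show ?thesis by (simp add: pconst_def mult_single)
qed

lemma rx_as_sum: "p = (\<Sum>m\<in>Poly_Mapping.keys p. pconst (Poly_Mapping.lookup p m) * mono_eval pvar m)"
  by (subst poly_mapping_as_sum) (simp only: single_as_product)

lemma ring_homo_mono_eval: "ring_homo h \<Longrightarrow> h (mono_eval \<phi> m) = mono_eval (h \<circ>
    \<phi>) m"
  by (simp add: mono_eval_def ring_homo_prod[of h] ring_homo_power[of h])

text \<open>The uniqueness half of the universal property: every polynomial is a sum of constants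
  times products of variables.\<close>

lemma rx_homo_eqI:
  assumes "ring_homo g" "ring_homo h" "\<And>c. g (pconst c) = h (pconst c)" "\<And>x. g (pvar x) = h
      (pvar x)"
  shows "g p = h p"
proof -
  have "g \<circ> pvar = h \<circ> pvar" using assms(4) by auto
  then show ?thesis
    by (subst (1 2) rx_as_sum)
      (simp add: ring_homo_sum[OF assms(1)] ring_homo_sum[OF assms(2)] ring_homoD(2)[OF assms(1)]
        ring_homoD(2)[OF assms(2)] assms(3) ring_homo_mono_eval[OF assms(1)] ring_homo_mono_eval[OF assms(2)])
qed

subsection \<open>Regions of noncrossing chords and the state sum\<close>

abbreviation src :: "real \<times> real \<times> 'l \<Rightarrow> real" where "src \<equiv> fst"
abbreviation tgt :: "real \<times> real \<times> 'l \<Rightarrow> real" where "tgt e \<equiv> fst (snd e)"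
abbreviation lab :: "real \<times> real \<times> 'l \<Rightarrow> 'l" where "lab e \<equiv> snd (snd e)"

text \<open>The left of an arrow is by convention the open positive arc from its tail to its head;
  the picture of chords in a disc enters only through this predicate.\<close>

definition side :: "real \<times> real \<times> 'l \<Rightarrow> real \<Rightarrow> bool" where
  "side e x = cbetween (src e) x (tgt e)"

lemma cbetween_same [simp]: "\<not> cbetween a a b" "\<not> cbetween a b b" "\<not> cbetween a x a"
  by (auto simp: cbetween_def)

lemma side_ends [simp]: "\<not> side e (src e)" "\<not> side e (tgt e)"
  by (simp_all add: side_def)

lemma cbetween_arc_free_same:
  assumes "\<not> cbetween x s y" "\<not> cbetween x t y" "s \<notin> {x, y}" "t \<notin> {x, y}"
  shows "cbetween s x t \<longleftrightarrow> cbetween s y t"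
  using assms unfolding cbetween_def by simp argo

text \<open>Linking of two pairs of points on a circle is symmetric. As with the other facts on
  \<open>cbetween\<close>, unfolding to the order of the reals leaves a finite check.\<close>

lemma cbetween_cross_sym:
  assumes "distinct [a, b, c, d]"
  shows "(cbetween a c b \<longleftrightarrow> cbetween a d b) \<longleftrightarrow> (cbetween c a d
      \<longleftrightarrow> cbetween c b d)"
  using assms unfolding cbetween_def distinct.simps list.set insert_iff empty_iff by argo

text \<open>A chord \<open>cd\<close> not crossing \<open>ab\<close> lies on one side of it, and all
  points of the other side are then on the same side of \<open>cd\<close> as \<open>a\<close>. One
  of \<open>x\<close> and \<open>y\<close> lies on that other side, and the two agree with respect
  to \<open>cd\<close>.\<close>

lemma cbetween_separate:
  assumes "distinct [a, b, c, d]" "cbetween c a d \<longleftrightarrow> cbetween c b d"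
    "cbetween a x b" "\<not> cbetween a y b" "cbetween c x d \<longleftrightarrow> cbetween c y d"
  shows "cbetween c x d \<longleftrightarrow> cbetween c a d"
  using assms unfolding cbetween_def distinct.simps list.set insert_iff empty_iff by argo

lemma cbetween_total: "distinct [a, b, x] \<Longrightarrow> cbetween b x a \<longleftrightarrow> \<not>
    cbetween a x b"
  by (auto simp: cbetween_def)

lemma endpoints_iff: "x \<in> endpoints D \<longleftrightarrow> (\<exists>e\<in>D. x = src e \<or> x = tgt e)"
  unfolding endpoints_def by (simp add: split_beta)

lemma endpointsI: "e \<in> D \<Longrightarrow> src e \<in> endpoints D" "e \<in> D \<Longrightarrow> tgt
    e \<in> endpoints D"
  by (auto simp: endpoints_iff)

lemma endpoints_mono: "D \<subseteq> D' \<Longrightarrow> endpoints D \<subseteq> endpoints D'"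
  unfolding endpoints_def by blast

lemma endpoints_Un [simp]: "endpoints (D \<union> D') = endpoints D \<union> endpoints D'"
  by (auto simp: endpoints_def)

lemma endpoints_insert [simp]: "endpoints (insert (a, b, l) D) = {a, b} \<union> endpoints D"
  by (auto simp: endpoints_def)

lemma endpoints_empty [simp]: "endpoints {} = {}"
  by (simp add: endpoints_def)

lemma wf_finite: "wf_arrows D \<Longrightarrow> finite D"
  by (simp add: wf_arrows_def)

lemma finite_endpoints: "finite D \<Longrightarrow> finite (endpoints D)"
  by (auto simp: endpoints_def)

lemma wf_src_neq_tgt: "wf_arrows D \<Longrightarrow> e \<in> D \<Longrightarrow> src e \<noteq> tgt e"
  by (auto simp: wf_arrows_def)

lemma wf_distinct:
  assumes "wf_arrows D" "e \<in> D" "e' \<in> D" "e \<noteq> e'"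
  shows "src e \<noteq> src e'" "src e \<noteq> tgt e'" "tgt e \<noteq> src e'" "tgt e \<noteq> tgt e'"
  using assms unfolding wf_arrows_def by blast+

lemma wf_subset: "wf_arrows D \<Longrightarrow> F \<subseteq> D \<Longrightarrow> wf_arrows F"
  unfolding wf_arrows_def by (blast intro: finite_subset)

lemma wf_insert:
  assumes "wf_arrows D" "a \<noteq> b" "a \<notin> endpoints D" "b \<notin> endpoints D"
  shows "wf_arrows (insert (a, b, l) D)"
proof -
  have "{fst e, tgt e} \<inter> {a, b} = {}" if "e \<in> D" for e
    using assms endpointsI[OF that] by auto
  then show ?thesis using assms by (fastforce simp: wf_arrows_def)
qed

section \<open>Crossing and noncrossing chords\<close>

definition crossing :: "real \<times> real \<times> 'l \<Rightarrow> real \<times> real \<times> 'l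
    \<Rightarrow> bool" where
  "crossing e e' \<longleftrightarrow> side e (src e') \<noteq> side e (tgt e')"

lemma crossing_sym:
  assumes "wf_arrows D" "e \<in> D" "e' \<in> D"
  shows "crossing e e' \<longleftrightarrow> crossing e' e"
proof (cases "e = e'")
  case False
  then show ?thesis
    using wf_distinct[OF assms False] wf_src_neq_tgt[OF assms(1)] assms
      cbetween_cross_sym[of "src e" "tgt e" "src e'" "tgt e'"]
    by (auto simp: crossing_def side_def)
qed simp

definition noncrossing :: "(real \<times> real \<times> 'l) set \<Rightarrow> bool" where
  "noncrossing F \<longleftrightarrow> (\<forall>e\<in>F. \<forall>e'\<in>F. \<not> crossing e e')"

lemma not_crossing_self [simp]: "\<not> crossing e e"
  by (simp add: crossing_def)

lemma noncrossing_subset: "noncrossing F \<Longrightarrow> G \<subseteq> F \<Longrightarrow> noncrossing G"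
  by (auto simp: noncrossing_def)

lemma noncrossing_empty [simp]: "noncrossing {}"
  by (simp add: noncrossing_def)

lemma noncrossing_insert:
  assumes "wf_arrows (insert e F)"
  shows "noncrossing (insert e F) \<longleftrightarrow> noncrossing F \<and> (\<forall>f\<in>F. \<not>
      crossing f e)"
  using crossing_sym[OF assms] by (auto simp: noncrossing_def)

text \<open>The regions cut out of the circle by a noncrossing set \<open>F\<close> of chords are
    encoded by the
  set of chords having the region on their left. With this convention an endpoint of a chord
  belongs to the region on the right of that chord.\<close>

definition region :: "(real \<times> real \<times> 'l) set \<Rightarrow> real \<Rightarrow> (real
    \<times> real \<times> 'l) set" where
  "region F x = {e \<in> F. side e x}"

definition regions :: "(real \<times> real \<times> 'l) set \<Rightarrow> (real \<times> real \<times>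
    'l) set set" where
  "regions F = range (region F)"

definition rgt :: "(real \<times> real \<times> 'l) set \<Rightarrow> real \<times> real \<times> 'l
    \<Rightarrow> (real \<times> real \<times> 'l) set" where
  "rgt F e = region F (src e)"

text \<open>Entering the left of \<open>e\<close> from its tail crosses no other chord, so the
  region there differs from \<open>rgt F e\<close> by \<open>e\<close> alone. This avoids choosing a
  point on the left.\<close>

definition lft :: "(real \<times> real \<times> 'l) set \<Rightarrow> real \<times> real \<times> 'l
    \<Rightarrow> (real \<times> real \<times> 'l) set" where
  "lft F e = insert e (region F (src e))"

definition constraint :: "(real \<times> real \<times> bool) set \<Rightarrow> real \<times> real
    \<times> bool \<Rightarrow> _" where
  "constraint F e = (if lab e then (lft F e, rgt F e) else (rgt F e, lft F e))"

definition constraints :: "(real \<times> real \<times> bool) set \<Rightarrow> _" where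
  "constraints F = constraint F ` F"

text \<open>Collapsing the removed arcs of the circle needs no operation: moves and homeomorphisms
  look only at the cyclic order of endpoints, so the string carried by the region \<open>v\<close>
  is this subset of arrows on the original circle. An arrow crossing \<open>F\<close> has its ends
  in two regions and belongs to no piece.\<close>

definition piece :: "(real \<times> real \<times> 'l) set \<Rightarrow> (real \<times> real \<times> 'l)
    set \<Rightarrow> (real \<times> real \<times> 'l) set \<Rightarrow> (real \<times> real \<times>
    'l) set" where
  "piece D F v = {d \<in> D - F. region F (src d) = v \<and> region F (tgt d) = v}"

lemma region_subset: "region F x \<subseteq> F" by (auto simp: region_def)

lemma region_tgt: "noncrossing F \<Longrightarrow> e \<in> F \<Longrightarrow> region F (tgt e) = region
    F (src e)"
  by (auto simp: region_def noncrossing_def crossing_def)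

lemma region_Un: "region (F \<union> G) x = region F x \<union> region G x"
  by (auto simp: region_def)

lemma region_insert: "region (insert e F) x = (if side e x then insert e (region F x) else region F x)"
  by (auto simp: region_def)

lemma region_empty [simp]: "region {} x = {}" by (simp add: region_def)

lemma regions_empty [simp]: "regions {} = {{}}" by (auto simp: regions_def)

lemma finite_regions: "finite F \<Longrightarrow> finite (regions F)"
  by (rule finite_subset[of _ "Pow F"]) (auto simp: regions_def region_def)

lemma regions_subset: "v \<in> regions F \<Longrightarrow> v \<subseteq> F" by (auto simp: regions_def
    region_def)

lemma region_in_regions [simp]: "region F x \<in> regions F" by (simp add: regions_def)

lemma rgt_in_regions [simp]: "rgt F e \<in> regions F" by (simp add: rgt_def)

lemma not_in_rgt [simp]: "e \<notin> rgt F e" by (simp add: rgt_def region_def)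

lemma in_lft [simp]: "e \<in> lft F e" by (simp add: lft_def)

lemma lft_neq_rgt [simp]: "lft F e \<noteq> rgt F e" "rgt F e \<noteq> lft F e"
  using in_lft not_in_rgt by metis+

section \<open>Every region borders an arrow\<close>

lemma point_just_after:
  assumes "finite P"
  obtains x where "p < x" "\<And>q. q \<in> P \<Longrightarrow> \<not> (p < q \<and> q \<le> (x::real))"
proof (cases "{q \<in> P. p < q} = {}")
  case True
  then show ?thesis using that[of "p + 1"] by auto
next
  case False
  let ?m = "Min {q \<in> P. p < q}"
  have m: "?m \<in> {q \<in> P. p < q}" using False assms by (intro Min_in) auto
  have "?m \<le> q" if "q \<in> P" "p < q" for q using that assms by (intro Min_le) auto
  then have "\<not> (p < q \<and> q \<le> (p + ?m) / 2)" if "q \<in> P" for q using m that by force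
  then show ?thesis using m by (intro that[of "(p + ?m) / 2"]) auto
qed

lemma cbetween_just_after:
  assumes "p < x" "\<not> (p < t \<and> t \<le> x)" "t \<noteq> p"
  shows "cbetween p x t" and "\<not> (p < s \<and> s \<le> x) \<Longrightarrow> s \<noteq> p
      \<Longrightarrow> cbetween s x t \<longleftrightarrow> cbetween s p t"
  using assms unfolding cbetween_def by argo+

text \<open>A sample point just past the tail works: it is left of \<open>e\<close>, and no endpoint
  is passed on the way, so all other chords see it as they see the tail.\<close>

lemma lft_in_regions:
  assumes "wf_arrows F" "e \<in> F"
  shows "lft F e \<in> regions F"
proof -
  obtain x where x: "src e < x" "\<And>q. q \<in> endpoints F \<Longrightarrow> \<not> (src e < q \<and>
      q \<le> x)"
    using point_just_after[OF finite_endpoints[OF wf_finite[OF assms(1)]]] by metis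
  have "side f x \<longleftrightarrow> f = e \<or> side f (src e)" if "f \<in> F" for f
    using x(1) x(2)[OF endpointsI(1)[OF that]] x(2)[OF endpointsI(2)[OF that]]
      wf_distinct[OF assms(1) that assms(2)] wf_src_neq_tgt[OF assms(1) that]
    by (cases "f = e") (auto simp: side_def cbetween_just_after)
  then have "region F x = lft F e" using assms(2) by (auto simp: region_def lft_def)
  then show ?thesis by (metis region_in_regions)
qed

text \<open>The positive direction wraps around through infinity: with no element of
  \<open>P\<close> above \<open>x\<close>, the next one is the minimum of \<open>P\<close>.\<close>

lemma next_endpoint:
  assumes "finite P" "P \<noteq> {}" "x \<notin> P"
  obtains p where "p \<in> P" "\<And>q. q \<in> P \<Longrightarrow> \<not> cbetween x q (p::real)"
proof (cases "{q \<in> P. x < q} = {}")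
  case True
  have "\<not> cbetween x q (Min P)" if "q \<in> P" for q
    using True Min_in[OF assms(1,2)] Min_le[OF assms(1) that] that by (auto simp: cbetween_def)
  then show ?thesis using that[of "Min P"] Min_in[OF assms(1,2)] by blast
next
  case False
  let ?m = "Min {q \<in> P. x < q}"
  have m: "?m \<in> {q \<in> P. x < q}" using False assms by (intro Min_in) auto
  have "?m \<le> q" if "q \<in> P" "x < q" for q using that assms by (intro Min_le) auto
  then have "\<not> cbetween x q ?m" if "q \<in> P" for q
    using m that by (force simp: cbetween_def)
  then show ?thesis using m that[of ?m] by blast
qed

text \<open>Walk from \<open>x\<close> to the next endpoint \<open>p\<close> of \<open>F\<close>.
  Only the chord ending at \<open>p\<close> can distinguish \<open>x\<close> from \<open>p\<close>,
  so \<open>x\<close> lies in one of the two regions beside that chord.\<close>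

lemma region_cases:
  assumes "wf_arrows F" "noncrossing F" "F \<noteq> {}"
  obtains e where "e \<in> F" "region F x = lft F e \<or> region F x = rgt F e"
proof (cases "x \<in> endpoints F")
  case True
  then obtain e where "e \<in> F" "x = src e \<or> x = tgt e" by (auto simp: endpoints_iff)
  then show ?thesis using that[of e] region_tgt[OF assms(2), of e] by (auto simp: rgt_def)
next
  case False
  have "endpoints F \<noteq> {}" using assms(3) endpointsI(1) by (metis all_not_in_conv)
  then obtain p where p: "p \<in> endpoints F" "\<And>q. q \<in> endpoints F \<Longrightarrow> \<not>
      cbetween x q p"
    using next_endpoint[OF finite_endpoints[OF wf_finite[OF assms(1)]] _ False] by metis
  then obtain e where e: "e \<in> F" "p = src e \<or> p = tgt e" by (auto simp: endpoints_iff)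
  have "side f x \<longleftrightarrow> side f (src e)" if "f \<in> F" "f \<noteq> e" for f
  proof -
    have "side f x \<longleftrightarrow> side f p"
      unfolding side_def
      using wf_distinct[OF assms(1) that(1) e(1) that(2)] e(2) False endpointsI[OF that(1)]
        p(2)[OF endpointsI(1)[OF that(1)]] p(2)[OF endpointsI(2)[OF that(1)]]
      by (intro cbetween_arc_free_same) auto
    also have "\<dots> \<longleftrightarrow> side f (src e)"
      using e assms(2) that by (auto simp: noncrossing_def crossing_def)
    finally show ?thesis .
  qed
  then have x: "\<forall>f\<in>F - {e}. side f x \<longleftrightarrow> side f (src e)" by blast
  have "region F x = lft F e \<or> region F x = rgt F e"
    using e(1) x side_ends(1)[of e] unfolding region_def lft_def rgt_def by (cases "side e x") blast+
  then show ?thesis using that e(1) by blast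
qed

lemma regions_eq:
  assumes "wf_arrows F" "noncrossing F" "F \<noteq> {}"
  shows "regions F = lft F ` F \<union> rgt F ` F"
proof
  show "regions F \<subseteq> lft F ` F \<union> rgt F ` F"
  proof
    fix v assume "v \<in> regions F"
    then obtain x where x: "v = region F x" by (auto simp: regions_def)
    obtain e where "e \<in> F" "region F x = lft F e \<or> region F x = rgt F e"
      using region_cases[OF assms, of x] by metis
    then show "v \<in> lft F ` F \<union> rgt F ` F" unfolding x by (elim disjE) simp_all
  qed
qed (use lft_in_regions[OF assms(1)] in auto)

lemma constraints_subset: "wf_arrows F \<Longrightarrow> constraints F \<subseteq> regions F \<times>
    regions F"
  unfolding constraints_def constraint_def using lft_in_regions[of F] by (intro image_subsetI) simp

text \<open>As every region borders an arrow, the vertices of the tree can be read off its edges. To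
  match the regions of two states it therefore suffices to match their constraints.\<close>

lemma regions_constraints:
  assumes "wf_arrows F" "noncrossing F" "F \<noteq> {}"
  shows "regions F = fst ` constraints F \<union> snd ` constraints F"
proof -
  have "{fst (constraint F e), snd (constraint F e)} = {lft F e, rgt F e}" for e
    by (auto simp: constraint_def)
  then have "(\<Union>e\<in>F. {fst (constraint F e), snd (constraint F e)}) = (\<Union>e\<in>F. {lft F
      e, rgt F e})" by simp
  moreover have "(\<Union>e\<in>F. {f e, g e}) = f ` F \<union> g ` F" for f g :: "_ \<Rightarrow> (real
      \<times> real \<times> bool) set" by blast
  ultimately show ?thesis unfolding regions_eq[OF assms] constraints_def image_image by simp
qed

text \<open>Two circles distinguished by \<open>e\<close> alone are the two ends of the edge
  \<open>e\<close> of the tree. Any other chord sees \<open>x\<close> and \<open>y\<close> as it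
  sees the tail of \<open>e\<close>, because it does not cross \<open>e\<close>.\<close>

lemma regions_separated:
  assumes "wf_arrows F" "noncrossing F" "e \<in> F" "side e x" "\<not> side e y"
    "\<And>f. f \<in> F \<Longrightarrow> f \<noteq> e \<Longrightarrow> side f x \<longleftrightarrow>
        side f y"
  shows "region F x = lft F e" "region F y = rgt F e"
proof -
  have "side f x \<longleftrightarrow> side f (src e)" if "f \<in> F" "f \<noteq> e" for f
    unfolding side_def
    using wf_distinct[OF assms(1) assms(3) that(1)] that(2) wf_src_neq_tgt[OF assms(1)] that(1) assms(2-6)
    by (intro cbetween_separate[of "src e" "tgt e" _ _ x y]) (simp_all add: side_def noncrossing_def
        crossing_def)
  then have x: "\<forall>f\<in>F - {e}. side f x \<longleftrightarrow> side f (src e)" and y: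
      "\<forall>f\<in>F - {e}. side f y \<longleftrightarrow> side f (src e)"
    using assms(6) by blast+
  show "region F x = lft F e"
    using assms(3,4) x unfolding region_def lft_def by blast
  show "region F y = rgt F e"
    using assms(3,5) y side_ends(1)[of e] unfolding region_def rgt_def by blast
qed

section \<open>Terms and sums over states\<close>

definition signs :: "(real \<times> real \<times> bool) set \<Rightarrow> rat" where
  "signs F = (\<Prod>e\<in>F. if lab e then 1 else - 1)"

definition state_coeff :: "(real \<times> real \<times> bool) set \<Rightarrow> R" where
  "state_coeff F = zvar ^ card F * [: linprob (regions F) (constraints F) * signs F :]"

definition sterm :: "(R \<Rightarrow> 'a::comm_ring_1) \<Rightarrow> (bool arrows \<Rightarrow> 'a)
    \<Rightarrow> bool arrows \<Rightarrow> bool arrows \<Rightarrow> 'a" where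
  "sterm \<kappa> I D F = \<kappa> (state_coeff F) * (\<Prod>v\<in>regions F. I (piece D F v))"

definition states :: "'l arrows \<Rightarrow> 'l arrows set" where
  "states D = {F. F \<subseteq> D \<and> noncrossing F}"

definition state_sum :: "(R \<Rightarrow> 'a::comm_ring_1) \<Rightarrow> (bool arrows \<Rightarrow> 'a)
    \<Rightarrow> bool arrows \<Rightarrow> 'a" where
  "state_sum \<kappa> I D = (\<Sum>F\<in>states D. sterm \<kappa> I D F)"

text \<open>Its terms evaluate \<open>I\<close> only on pieces with fewer arrows than
  \<open>D\<close>, so an induction on the number of arrows can use it before \<open>I D\<close>
  itself is under control.\<close>

definition proper_sum :: "(R \<Rightarrow> 'a::comm_ring_1) \<Rightarrow> (bool arrows \<Rightarrow> 'a)
    \<Rightarrow> bool arrows \<Rightarrow> 'a" where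
  "proper_sum \<kappa> I D = (\<Sum>F\<in>states D - {{}}. sterm \<kappa> I D F)"

lemma finite_states: "finite D \<Longrightarrow> finite (states D)"
  by (auto simp: states_def)

lemma piece_empty: "piece D {} {} = D"
  by (auto simp: piece_def)

lemma piece_subset: "piece D F v \<subseteq> D - F"
  by (auto simp: piece_def)

lemma sterm_empty: "ring_homo \<kappa> \<Longrightarrow> sterm \<kappa> I D {} = I D"
proof -
  assume "ring_homo \<kappa>"
  moreover have "state_coeff {} = 1"
    by (simp add: state_coeff_def constraints_def linprob_single signs_def)
  ultimately show ?thesis by (simp add: sterm_def piece_empty ring_homoD(3))
qed

lemma state_sum_eq: "ring_homo \<kappa> \<Longrightarrow> finite D \<Longrightarrow> state_sum \<kappa>
    I D = I D + proper_sum \<kappa> I D"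
  unfolding state_sum_def proper_sum_def
  by (subst sum.remove[of "states D" "{}"]) (simp_all add: finite_states sterm_empty, simp add: states_def)

text \<open>Two states whose trees agree up to a renaming \<open>h\<close> of edges and
  \<open>g\<close> of vertices. The factor \<open>signs F'\<close> stays unevaluated: in move (b)
  the trees agree, order constraints included, while the sign products are opposite.\<close>

lemma sterm_iso:
  assumes "wf_arrows F" "noncrossing F" "F \<noteq> {}" "wf_arrows F'" "noncrossing F'"
    and h: "bij_betw h F F'"
    and g: "\<And>e. e \<in> F \<Longrightarrow> constraint F' (h e) = map_prod g g (constraint F e)"
        "inj_on g (regions F)"
    and pc: "\<And>v. v \<in> regions F \<Longrightarrow> I (piece D' F' (g v)) = I' (piece D F v)"
  shows "regions F' = g ` regions F" "linprob (regions F') (constraints F') = linprob (regions F)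
      (constraints F)"
    "sterm \<kappa> I D' F' = \<kappa> (zvar ^ card F * [: linprob (regions F) (constraints F) * signs
        F' :]) * (\<Prod>v\<in>regions F. I' (piece D F v))"
proof -
  have F': "F' \<noteq> {}" using h assms(3) by (auto simp: bij_betw_def)
  have c: "constraints F' = map_prod g g ` constraints F"
    unfolding constraints_def image_image bij_betw_imp_surj_on[OF h, symmetric]
    using g(1) bij_betw_imp_surj_on[OF h] by (simp cong: image_cong)
  show v: "regions F' = g ` regions F"
    unfolding regions_constraints[OF assms(1-3)] regions_constraints[OF assms(4,5) F'] c
    by (simp add: image_image image_Un)
  show l: "linprob (regions F') (constraints F') = linprob (regions F) (constraints F)"
    unfolding v c by (rule linprob_map[OF g(2) constraints_subset[OF assms(1)]])
  show "sterm \<kappa> I D' F' = \<kappa> (zvar ^ card F * [: linprob (regions F) (constraints F) *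
      signs F' :]) * (\<Prod>v\<in>regions F. I' (piece D F v))"
    unfolding sterm_def state_coeff_def l bij_betw_same_card[OF h, symmetric] unfolding v
    by (simp add: prod.reindex[OF g(2)] pc)
qed

subsection \<open>Homeomorphisms, kinks and move (b)\<close>

text \<open>Extension by zero to all sets of arrows, so that sums over states become sums over power
  sets and can be split according to the arrows that a move adds.\<close>

definition pterm :: "(R \<Rightarrow> 'a::comm_ring_1) \<Rightarrow> (bool arrows \<Rightarrow> 'a)
    \<Rightarrow> bool arrows \<Rightarrow> bool arrows \<Rightarrow> 'a" where
  "pterm \<kappa> I D F = (if noncrossing F \<and> F \<noteq> {} then sterm \<kappa> I D F else 0)"

lemma proper_sum_Pow: "finite D \<Longrightarrow> proper_sum \<kappa> I D = (\<Sum>F\<in>Pow D. pterm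
    \<kappa> I D F)"
  unfolding proper_sum_def
  by (rule sum.mono_neutral_cong_left) (auto simp: states_def pterm_def)

lemma sum_Pow_insert:
  assumes "finite D" "e \<notin> D"
  shows "(\<Sum>F\<in>Pow (insert e D). \<chi> F) = (\<Sum>F\<in>Pow D. \<chi> F + \<chi> (insert e F))"
proof -
  have "(\<Sum>F\<in>Pow (insert e D). \<chi> F) = (\<Sum>F\<in>Pow D. \<chi> F) + (\<Sum>F\<in>insert e
      ` Pow D. \<chi> F)"
    unfolding Pow_insert using assms by (intro sum.union_disjoint) auto
  also have "(\<Sum>F\<in>insert e ` Pow D. \<chi> F) = (\<Sum>F\<in>Pow D. \<chi> (insert e F))"
    using assms(2) by (subst sum.reindex) (auto simp: inj_on_def)
  finally show ?thesis by (simp add: sum.distrib)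
qed

lemma sterm_zero_piece:
  assumes "finite F" "v \<in> regions F" "piece D F v = {}" "I {} = 0"
  shows "sterm \<kappa> I D F = 0"
  unfolding sterm_def using assms by (simp add: prod_zero[OF finite_regions] bexI[of _ v])

lemma sterm_cong:
  assumes "\<And>v. v \<in> regions F \<Longrightarrow> I (piece D F v) = I (piece D' F v)"
  shows "sterm \<kappa> I D F = sterm \<kappa> I D' F"
  unfolding sterm_def using assms by (simp cong: prod.cong)

lemma piece_insert:
  "e \<notin> F \<Longrightarrow> piece (insert e D) F v = (if region F (src e) = v \<and> region F (tgt
      e) = v then insert e (piece D F v) else piece D F v)"
  unfolding piece_def by (simp add: insert_Diff_if Collect_conj_eq) blast

lemma signs_insert: "finite F \<Longrightarrow> e \<notin> F \<Longrightarrow> signs (insert e F) = (if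
    lab e then 1 else - 1) * signs F"
  by (simp add: signs_def)

lemma move_bI:
  assumes "distinct [a, a', b, b']" "{a, a', b, b'} \<inter> endpoints D = {}" "Pb l l'"
    "arc_free D {b, b'} a a' \<or> arc_free D {b, b'} a' a" "arc_free D {a, a'} b b' \<or> arc_free D
        {a, a'} b' b"
  shows "move_b Pb D (D \<union> {(a, b, l), (b', a', l')})"
  using assms unfolding move_b_def by blast

lemma move_cI:
  assumes "distinct [a, ap, b, bp, c, cp]" "{a, ap, b, bp, c, cp} \<inter> endpoints E = {}" "Pc l1 l2 l3"
    "D = E \<union> {(ap, b, l1), (bp, c, l2), (cp, a, l3)}" "arc_free D {} a ap" "arc_free D {} b bp"
        "arc_free D {} c cp"
  shows "move_c Pc D (E \<union> {(a, bp, l1), (b, cp, l2), (c, ap, l3)})"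
  unfolding move_c_def
  by (rule exI[of _ E], rule exI[of _ a], rule exI[of _ ap], rule exI[of _ b], rule exI[of _ bp], rule
      exI[of _ c],
      rule exI[of _ cp], rule exI[of _ l1], rule exI[of _ l2], rule exI[of _ l3]) (intro conjI assms refl)

text \<open>Pieces depend on regions only at the endpoints of arrows. The set \<open>V\<close> may
  omit a region without endpoints, such as the middle of the triangle in move (c), where
  \<open>g\<close> is injective only after this omission.\<close>

lemma piece_transfer:
  assumes "\<And>p. p \<in> endpoints E \<Longrightarrow> region F' p = g (region F p)" "E - F' = E - F"
    and "\<And>p. p \<in> endpoints E \<Longrightarrow> region F p \<in> V" "inj_on g V" "v \<in> V"
  shows "piece E F' (g v) = piece E F v"
proof -
  have "region F' p = g v \<longleftrightarrow> region F p = v" if "p \<in> endpoints E" for p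
    using assms(1,3)[OF that] inj_onD[OF assms(4), of "region F p" v] assms(5) by metis
  then have "region F' (src d) = g v \<longleftrightarrow> region F (src d) = v" "region F' (tgt d) = g
      v \<longleftrightarrow> region F (tgt d) = v"
    if "d \<in> E" for d using endpointsI[OF that] by blast+
  then show ?thesis unfolding piece_def assms(2) by (simp cong: conj_cong)
qed

lemma arc_free_region:
  assumes "arc_free D Q x y \<or> arc_free D Q y x" "F \<subseteq> D" "x \<notin> endpoints D" "y
      \<notin> endpoints D"
  shows "region F x = region F y"
proof -
  have "side f x = side f y" if "f \<in> F" for f
  proof -
    have f: "src f \<in> endpoints D" "tgt f \<in> endpoints D"
      using that assms(2) endpointsI[of f D] by auto
    then have n: "src f \<notin> {x, y}" "tgt f \<notin> {x, y}" using assms by auto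
    show ?thesis using assms(1)
    proof
      assume "arc_free D Q x y"
      then show ?thesis unfolding side_def
        using f n by (intro cbetween_arc_free_same) (auto simp: arc_free_def)
    next
      assume "arc_free D Q y x"
      then show ?thesis unfolding side_def
        using f n by (intro cbetween_arc_free_same[symmetric]) (auto simp: arc_free_def)
    qed
  qed
  then show ?thesis by (auto simp: region_def)
qed

text \<open>Passing to a piece of a nonempty state loses at least one arrow, so assumptions below
  \<open>M\<close> arrows yield conclusions on \<open>proper_sum\<close> up to \<open>M\<close>
  arrows. The moves carry no sign conditions, since \<open>I\<close> stands for an invariant of
  strings, and \<open>kink\<close> covers both kinds of free arc.\<close>

locale invariant_below =
  fixes \<kappa> :: "R \<Rightarrow> 'a::comm_ring_1" and I :: "bool arrows \<Rightarrow> 'a" and M :: nat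
  assumes \<kappa>: "ring_homo \<kappa>" and I0: "I {} = 0"
    and homeo: "\<And>P Q. wf_arrows P \<Longrightarrow> wf_arrows Q \<Longrightarrow> homeo_rel P Q
        \<Longrightarrow> card P < M \<Longrightarrow> card Q < M \<Longrightarrow> I P = I Q"
    and kink: "\<And>P a b l. wf_arrows (insert (a, b, l) P) \<Longrightarrow> a \<notin> endpoints P
        \<Longrightarrow> b \<notin> endpoints P \<Longrightarrow>
      arc_free P {} a b \<or> arc_free P {} b a \<Longrightarrow> card (insert (a, b, l) P) < M
          \<Longrightarrow> I (insert (a, b, l) P) = I P"
    and moveb: "\<And>P Q. wf_arrows P \<Longrightarrow> wf_arrows Q \<Longrightarrow> move_b
        (\<lambda>_ _. True) P Q \<Longrightarrow> card P < M \<Longrightarrow> card Q < M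
        \<Longrightarrow> I P = I Q"
    and movec: "\<And>P Q. wf_arrows P \<Longrightarrow> wf_arrows Q \<Longrightarrow> move_c
        (\<lambda>_ _ _. True) P Q \<Longrightarrow> card P < M \<Longrightarrow> card Q < M
        \<Longrightarrow> I P = I Q"
begin

abbreviation "pt \<equiv> pterm \<kappa> I"
abbreviation "ps \<equiv> proper_sum \<kappa> I"

lemma card_piece:
  assumes "wf_arrows D" "card D \<le> M" "F \<subseteq> D" "F \<noteq> {}" "P \<subseteq> D - F"
  shows "card P < M" "wf_arrows P"
proof -
  have "card P < card D" using assms wf_finite[OF assms(1)] by (intro psubset_card_mono) auto
  then show "card P < M" using assms(2) by simp
  show "wf_arrows P" using assms by (intro wf_subset[OF assms(1)]) auto
qed

text \<open>The map is known at endpoints only, and a region may contain no endpoint of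
  \<open>D\<close>. So regions are not followed point by point: \<open>sterm_iso\<close> recovers
  them from the constraints, which are computed at the tails of arrows.\<close>

lemma proper_sum_homeo:
  assumes "wf_arrows D" "wf_arrows D'" "homeo_rel D D'" "card D \<le> M"
  shows "ps D' = ps D"
proof -
  obtain f where f: "bij_betw f (endpoints D) (endpoints D')"
    and cb: "\<forall>x\<in>endpoints D. \<forall>y\<in>endpoints D. \<forall>w\<in>endpoints D.
        cbetween x y w \<longleftrightarrow> cbetween (f x) (f y) (f w)"
    and D': "D' = (\<lambda>(a, b, l). (f a, f b, l)) ` D"
    using assms(3) unfolding homeo_rel_def by blast
  define \<phi> :: "real \<times> real \<times> bool \<Rightarrow> _" where "\<phi> = (\<lambda>(a, b,
      l). (f a, f b, l))"
  have \<phi>s: "src (\<phi> e) = f (src e)" "tgt (\<phi> e) = f (tgt e)" "lab (\<phi> e) = lab e" for e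
    by (simp_all add: \<phi>_def split_beta)
  have finj: "inj_on f (endpoints D)" using f by (simp add: bij_betw_def)
  have inj: "inj_on \<phi> D"
  proof (rule inj_onI)
    fix e e' assume e: "e \<in> D" "e' \<in> D" "\<phi> e = \<phi> e'"
    then have "f (src e) = f (src e')" "f (tgt e) = f (tgt e')" "lab e = lab e'" using \<phi>s by metis+
    moreover have "src e = src e'" "tgt e = tgt e'"
      using calculation finj endpointsI[OF e(1)] endpointsI[OF e(2)] by (auto dest: inj_onD)
    ultimately show "e = e'" by (simp add: prod_eq_iff)
  qed
  have D'': "D' = \<phi> ` D" using D' by (simp add: \<phi>_def)
  have sd: "side (\<phi> e) (f x) = side e x" if "e \<in> D" "x \<in> endpoints D" for e x
    unfolding side_def \<phi>s using cb endpointsI[OF that(1)] that(2) by blast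
  have pr: "region (\<phi> ` F) (f x) = \<phi> ` region F x" if "F \<subseteq> D" "x \<in> endpoints D"
      for F x
    unfolding region_def using sd that by blast
  have cr: "crossing (\<phi> e) (\<phi> e') = crossing e e'" if "e \<in> D" "e' \<in> D" for e e'
    unfolding crossing_def \<phi>s using sd endpointsI that by metis
  have nc: "noncrossing (\<phi> ` F) = noncrossing F" if "F \<subseteq> D" for F
    unfolding noncrossing_def using cr that by blast
  have st: "pt D' (\<phi> ` F) = pt D F" if F: "F \<subseteq> D" for F
  proof (cases "noncrossing F \<and> F \<noteq> {}")
    case True
    have injF: "inj_on \<phi> F" using inj F by (rule inj_on_subset)
    have F': "\<phi> ` F \<subseteq> D'" using F D'' by blast
    have pie: "piece D' (\<phi> ` F) (\<phi> ` v) = \<phi> ` piece D F v" if v: "v \<subseteq> F" for v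
    proof -
      have "region (\<phi> ` F) (f x) = \<phi> ` v \<longleftrightarrow> region F x = v" if "x \<in>
          endpoints D" for x
        unfolding pr[OF F that] using inj_on_image_eq_iff[OF injF region_subset v] by blast
      then have "region (\<phi> ` F) (src (\<phi> d)) = \<phi> ` v \<longleftrightarrow> region F (src d) = v"
        "region (\<phi> ` F) (tgt (\<phi> d)) = \<phi> ` v \<longleftrightarrow> region F (tgt d) = v"
            if "d \<in> D" for d
        unfolding \<phi>s using endpointsI[OF that] by blast+
      moreover have "D' - \<phi> ` F = \<phi> ` (D - F)"
        using inj_on_image_set_diff[OF inj _ F, of D] D'' by simp
      ultimately show ?thesis unfolding piece_def by (simp add: Compr_image_eq cong: conj_cong)
    qed
    have "I (piece D' (\<phi> ` F) (\<phi> ` v)) = I (piece D F v)" if v: "v \<in> regions F" for v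
    proof -
      let ?P = "piece D F v"
      have P: "?P \<subseteq> D - F" by (rule piece_subset)
      then have PD: "endpoints ?P \<subseteq> endpoints D" by (intro endpoints_mono) blast
      have P': "\<phi> ` ?P \<subseteq> D' - \<phi> ` F" using pie[OF regions_subset[OF v]] piece_subset
          by metis
      have "endpoints (\<phi> ` ?P) = f ` endpoints ?P"
        unfolding endpoints_def \<phi>_def by (auto simp: split_beta)
      then have "bij_betw f (endpoints ?P) (endpoints (\<phi> ` ?P))"
        using inj_on_subset[OF finj PD] by (simp add: bij_betw_def)
      then have h: "homeo_rel ?P (\<phi> ` ?P)"
        unfolding homeo_rel_def using cb PD by (intro exI[of _ f]) (auto simp: \<phi>_def)
      have c: "card ?P < M" "wf_arrows ?P" using card_piece[OF assms(1,4) F _ P] True by auto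
      have "card D' \<le> M" using assms(4) unfolding D'' card_image[OF inj] .
      then have c': "card (\<phi> ` ?P) < M" "wf_arrows (\<phi> ` ?P)"
        using card_piece[OF assms(2) _ F' _ P'] True by auto
      show ?thesis unfolding pie[OF regions_subset[OF v]] using homeo[OF c(2) c'(2) h c(1) c'(1)] by simp
    qed
    moreover have "constraint (\<phi> ` F) (\<phi> e) = map_prod (image \<phi>) (image \<phi>)
        (constraint F e)" if "e \<in> F" for e
      unfolding constraint_def lft_def rgt_def \<phi>s using pr[OF F, of "src e"] endpointsI(1)[of e D]
          that F by auto
    moreover have "inj_on (image \<phi>) (regions F)"
      by (rule inj_on_subset[OF inj_on_image_Pow[OF injF]]) (auto dest: regions_subset)
    ultimately have "sterm \<kappa> I D' (\<phi> ` F) = \<kappa> (zvar ^ card F * [: linprob (regions F)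
        (constraints F) * signs (\<phi> ` F) :])
        * (\<Prod>v\<in>regions F. I (piece D F v))"
      using True wf_subset[OF assms(1) F] wf_subset[OF assms(2) F'] nc[OF F]
      by (intro sterm_iso[where h = \<phi> and g = "image \<phi>"] inj_on_imp_bij_betw[OF injF]) auto
    also have "signs (\<phi> ` F) = signs F"
      unfolding signs_def by (simp add: prod.reindex[OF injF] \<phi>s)
    finally show ?thesis using True nc[OF F] by (simp add: pterm_def sterm_def state_coeff_def)
  qed (use nc[OF F] in \<open>auto simp: pterm_def\<close>)
  have "Pow D' = image \<phi> ` Pow D" unfolding D'' by (simp add: image_Pow_surj)
  then have "ps D' = (\<Sum>F\<in>image \<phi> ` Pow D. pt D' F)"
    using proper_sum_Pow[OF wf_finite[OF assms(2)]] by metis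
  also have "\<dots> = (\<Sum>F\<in>Pow D. pt D' (\<phi> ` F))"
    by (subst sum.reindex[OF inj_on_image_Pow[OF inj]]) simp
  also have "\<dots> = ps D"
    unfolding proper_sum_Pow[OF wf_finite[OF assms(1)]] using st by (intro sum.cong) auto
  finally show ?thesis .
qed

lemma proper_sum_kink:
  assumes "wf_arrows (insert (a, b, l) D)" "a \<notin> endpoints D" "b \<notin> endpoints D"
    "arc_free D {} a b \<or> arc_free D {} b a" "card (insert (a, b, l) D) \<le> M"
  shows "ps (insert (a, b, l) D) = ps D"
proof -
  let ?e = "(a, b, l)" and ?D = "insert (a, b, l) D"
  have eD: "?e \<notin> D" using assms(2) endpointsI(1)[of ?e D] by auto
  have fin: "finite D" using wf_finite[OF assms(1)] by simp
  have wfD: "wf_arrows D" using wf_subset[OF assms(1)] by blast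
  have ab: "a \<noteq> b" using wf_src_neq_tgt[OF assms(1), of ?e] by simp
  \<comment> \<open>The side of the kink with the free arc is a circle without arrows, worth
    \<open>I {} = 0\<close>. It is the left side if the arc from \<open>a\<close> to
    \<open>b\<close> is free and the right side otherwise.\<close>
  have 1: "pt ?D (insert ?e F) = 0" if "F \<subseteq> D" for F
  proof (cases "noncrossing (insert ?e F)")
    case True
    let ?F = "insert ?e F"
    have wfF: "wf_arrows ?F" using wf_subset[OF assms(1)] that by blast
    have "\<exists>v\<in>regions ?F. piece ?D ?F v = {}" using assms(4)
    proof
      assume af: "arc_free D {} a b"
      have "d \<notin> piece ?D ?F (lft ?F ?e)" for d
      proof
        assume d: "d \<in> piece ?D ?F (lft ?F ?e)"
        then have "src d \<in> endpoints D" "?e \<in> region ?F (src d)" using endpointsI(1)[of d D]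
          unfolding piece_def by auto
        then show False using af by (auto simp: arc_free_def region_def side_def)
      qed
      then show ?thesis using lft_in_regions[OF wfF, of ?e] by blast
    next
      assume af: "arc_free D {} b a"
      have "d \<notin> piece ?D ?F (rgt ?F ?e)" for d
      proof
        assume d: "d \<in> piece ?D ?F (rgt ?F ?e)"
        then have s: "src d \<in> endpoints D" "?e \<notin> region ?F (src d)" using endpointsI(1)[of d
            D] not_in_rgt
          unfolding piece_def by auto
        then have "\<not> cbetween a (src d) b" "src d \<noteq> a" "src d \<noteq> b" using assms(2,3)
          by (auto simp: region_def side_def)
        then show False using af s ab cbetween_total[of a b "src d"] by (auto simp: arc_free_def)
      qed
      then show ?thesis using rgt_in_regions by blast
    qed
    then show ?thesis using wf_finite[OF wfF] sterm_zero_piece[of ?F _ ?D I] I0 by (auto simp: pterm_def)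
  qed (simp add: pterm_def)
  \<comment> \<open>If the kink arrow is not cut, the pieces stay the same, except that the one at
    \<open>a\<close> gains a kink. That piece is smaller than the diagram, so \<open>kink\<close>
    applies to it.\<close>
  have 2: "pt ?D F = pt D F" if F: "F \<subseteq> D" for F
  proof (cases "noncrossing F \<and> F \<noteq> {}")
    case True
    have pab: "region F a = region F b" using arc_free_region[OF assms(4) F assms(2,3)] .
    have "I (piece ?D F v) = I (piece D F v)" for v
    proof (cases "region F a = v")
      case True': True
      let ?P = "piece D F v"
      have "?e \<notin> F" using F eD by blast
      then have e: "piece ?D F v = insert ?e ?P" using True' pab by (simp add: piece_insert)
      have "insert ?e ?P \<subseteq> ?D - F" using e piece_subset by metis
      note c = card_piece[OF assms(1,5) _ _ this]
      have P: "endpoints ?P \<subseteq> endpoints D" by (intro endpoints_mono) (auto simp: piece_def)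
      then have "arc_free ?P {} a b \<or> arc_free ?P {} b a"
        using assms(4) unfolding arc_free_def by blast
      then show ?thesis unfolding e using c True F P assms(2,3) by (intro kink) auto
    next
      case False
      have "?e \<notin> F" using F eD by blast
      then show ?thesis using False by (simp add: piece_insert)
    qed
    then show ?thesis using sterm_cong[of F I ?D D] by (simp add: pterm_def)
  qed (auto simp: pterm_def)
  show ?thesis
    unfolding proper_sum_Pow[OF wf_finite[OF assms(1)]] proper_sum_Pow[OF fin] sum_Pow_insert[OF fin eD]
    by (rule sum.cong) (simp_all add: 1 2)
qed


text \<open>Once the circle is cut along \<open>e1\<close>, the antiparallel \<open>e2\<close> is a
  kink: all endpoints of a piece lie on one side of \<open>e1\<close>, hence by \<open>opp\<close>
  on one side of \<open>e2\<close>, and the arc on the other side is free.\<close>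

lemma piece_parallel:
  fixes a b a' b' :: real and l l' :: bool
  defines "e1 \<equiv> (a, b, l)" and "e2 \<equiv> (b', a', l')"
  assumes wf: "wf_arrows (insert e1 (insert e2 D))" and cd: "card (insert e1 (insert e2 D)) \<le> M"
    and F: "F \<subseteq> D" and new: "{a, a', b, b'} \<inter> endpoints D = {}" "distinct [a, a', b, b']"
    and opp: "\<And>p. p \<in> endpoints D \<Longrightarrow> side e2 p \<longleftrightarrow> \<not> side e1 p"
  shows "I (piece (insert e1 (insert e2 D)) (insert e1 F) v) = I (piece D (insert e1 F) v)"
proof -
  let ?F = "insert e1 F" and ?P = "piece D (insert e1 F) v" and ?D = "insert e1 (insert e2 D)"
  have nD: "e1 \<notin> D" "e2 \<notin> D" "e1 \<noteq> e2"
    using new endpointsI(1)[of e1 D] endpointsI(1)[of e2 D] by (auto simp: e1_def e2_def)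
  have e2: "e2 \<notin> ?F" using nD F by auto
  have "piece ?D ?F v = piece (insert e2 D) ?F v"
    unfolding piece_def by blast
  moreover have "I (piece (insert e2 D) ?F v) = I ?P"
  proof (cases "region ?F b' = v \<and> region ?F a' = v")
    case True
    then have eq: "piece (insert e2 D) ?F v = insert e2 ?P"
      using piece_insert[OF e2, of D v] by (simp add: e2_def)
    have P: "?P \<subseteq> D" by (auto simp: piece_def)
    have sub: "insert e2 ?P \<subseteq> ?D - ?F" using eq piece_subset[of "insert e2 D" ?F v] by blast
    have pP: "side e1 p \<longleftrightarrow> e1 \<in> v" if "p \<in> endpoints ?P" for p
    proof -
      obtain d where d: "d \<in> ?P" "p = src d \<or> p = tgt d" using \<open>p \<in> endpoints
          ?P\<close> unfolding endpoints_iff by blast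
      then have "region ?F p = v" unfolding piece_def by blast
      then show ?thesis unfolding region_def by blast
    qed
    have pD: "p \<in> endpoints D" if "p \<in> endpoints ?P" for p using endpoints_mono[OF P] that by blast
    have "arc_free ?P {} b' a' \<or> arc_free ?P {} a' b'"
    proof (cases "e1 \<in> v")
      case True
      then have "\<not> cbetween b' p a'" if "p \<in> endpoints ?P" for p
        using pP[OF that] opp[OF pD[OF that]] by (simp add: e2_def side_def)
      then show ?thesis by (simp add: arc_free_def)
    next
      case False
      then have "cbetween b' p a'" if "p \<in> endpoints ?P" for p
        using pP[OF that] opp[OF pD[OF that]] by (simp add: e2_def side_def)
      moreover have "p \<noteq> a'" "p \<noteq> b'" if "p \<in> endpoints ?P" for p using pD[OF that]
          new by auto
      ultimately have "\<not> cbetween a' p b'" if "p \<in> endpoints ?P" for p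
        using cbetween_total[of a' b' p] that new(2) by auto
      then show ?thesis by (simp add: arc_free_def)
    qed
    then show ?thesis unfolding eq unfolding e2_def
      using card_piece[OF wf cd _ _ sub] F pD new(1)
      by (intro kink) (auto simp: e2_def)
  next
    case False
    then have "piece (insert e2 D) ?F v = ?P"
      unfolding piece_insert[OF e2, of D v] by (auto simp: e2_def)
    then show ?thesis by simp
  qed
  ultimately show ?thesis by simp
qed

text \<open>With \<open>a, a'\<close> adjacent and \<open>b, b'\<close> adjacent, the arrows from
  \<open>a\<close> to \<open>b\<close> and from \<open>b'\<close> to \<open>a'\<close> are
  antiparallel, so the left of one is the right of the other for any further endpoint.\<close>

lemma cbetween_parallel:
  assumes "distinct [a, a', b, b', p]"
    "(\<not> cbetween a p a' \<and> \<not> cbetween a b a' \<and> \<not> cbetween a b' a') \<or> (\<not>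
        cbetween a' p a \<and> \<not> cbetween a' b a \<and> \<not> cbetween a' b' a)"
    "(\<not> cbetween b p b' \<and> \<not> cbetween b a b' \<and> \<not> cbetween b a' b') \<or> (\<not>
        cbetween b' p b \<and> \<not> cbetween b' a b \<and> \<not> cbetween b' a' b)"
  shows "cbetween b' p a' \<longleftrightarrow> \<not> cbetween a p b"
  using assms unfolding cbetween_def distinct.simps list.set insert_iff empty_iff by argo

text \<open>Sort the states by which of the two new arrows they contain. With none, a piece changes
  at most by move (b); with both, the strip between the arrows is a circle without arrows; states
  with exactly one cancel in pairs.\<close>

lemma proper_sum_moveb:
  assumes "wf_arrows D" "wf_arrows D'" "move_b ad_b D D'" "card D' \<le> M"
  shows "ps D' = ps D"
proof -
  obtain a a' b b' l l' where dist: "distinct [a, a', b, b']" and new: "{a, a', b, b'} \<inter>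
      endpoints D = {}"
    and fa: "arc_free D {b, b'} a a' \<or> arc_free D {b, b'} a' a"
    and fb: "arc_free D {a, a'} b b' \<or> arc_free D {a, a'} b' b"
    and l: "l' = (\<not> l)" and D': "D' = D \<union> {(a, b, l), (b', a', l')}"
    using assms(3) unfolding move_b_def ad_b_def by blast
  define e1 where "e1 = (a, b, l)"
  define e2 where "e2 = (b', a', l')"
  have D'': "D' = insert e1 (insert e2 D)" unfolding D' e1_def e2_def by blast
  have e1s: "src e1 = a" "tgt e1 = b" "lab e1 = l" and e2s: "src e2 = b'" "tgt e2 = a'" "lab e2 = l'"
    by (simp_all add: e1_def e2_def)
  have nD: "e1 \<notin> D" "e2 \<notin> D" "e1 \<noteq> e2"
    using new dist endpointsI(1)[of e1 D] endpointsI(1)[of e2 D] by (auto simp: e1_def e2_def)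
  have fin: "finite D" using wf_finite[OF assms(1)] .
  have opp: "side e2 p \<longleftrightarrow> \<not> side e1 p" if "p \<in> endpoints D" for p
    unfolding side_def e1s e2s using that dist new fa fb
    by (intro cbetween_parallel) (auto simp: arc_free_def)
  have pa: "region F a = region F a'" and pb: "region F b = region F b'" if "F \<subseteq> D" for F
    using arc_free_region[OF fa that] arc_free_region[OF fb that] new by auto
  have nc: "noncrossing (insert e1 F) \<longleftrightarrow> noncrossing F \<and> region F a = region F b"
    "noncrossing (insert e2 F) \<longleftrightarrow> noncrossing F \<and> region F a = region F b" if F:
        "F \<subseteq> D" for F
  proof -
    have w: "wf_arrows (insert e1 F)" "wf_arrows (insert e2 F)"
      by (rule wf_subset[OF assms(2)], use F in \<open>simp add: D'' subset_insertI2\<close>)+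
    have "(\<forall>f\<in>F. side f x = side f y) \<longleftrightarrow> region F x = region F y" for x y
      unfolding region_def by blast
    then show "noncrossing (insert e1 F) \<longleftrightarrow> noncrossing F \<and> region F a = region F b"
    "noncrossing (insert e2 F) \<longleftrightarrow> noncrossing F \<and> region F a = region F b"
      unfolding noncrossing_insert[OF w(1)] noncrossing_insert[OF w(2)] crossing_def e1s e2s
      using pa[OF F] pb[OF F] by auto
  qed
  have 0: "pt D' F = pt D F" if F: "F \<subseteq> D" for F
  proof (cases "noncrossing F \<and> F \<noteq> {}")
    case True
    have "I (piece D' F v) = I (piece D F v)" for v
    proof -
      let ?P = "piece D F v"
      have n: "e1 \<notin> F" "e2 \<notin> F" using F nD by auto
      show ?thesis
      proof (cases "region F a = v \<and> region F b = v")
        case t: True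
        then have e: "piece D' F v = ?P \<union> {(a, b, l), (b', a', l')}"
          unfolding D'' using n pa[OF F] pb[OF F] by (simp add: piece_insert e1s e2s) (simp add: e1_def
              e2_def)
        have P: "?P \<subseteq> D" "?P \<subseteq> D' - F" unfolding piece_def D'' by blast+
        have P': "?P \<union> {(a, b, l), (b', a', l')} \<subseteq> D' - F" using e piece_subset by metis
        have FD': "F \<subseteq> D'" using F D'' by blast
        note c = card_piece[OF assms(2,4) FD' _ P(2)] card_piece[OF assms(2,4) FD' _ P']
        have "move_b (\<lambda>_ _. True) ?P (?P \<union> {(a, b, l), (b', a', l')})"
          by (rule move_bI) (use dist new fa fb endpoints_mono[OF P(1)] in \<open>auto simp:
              arc_free_def\<close>)
        then show ?thesis unfolding e using c True by (intro moveb[symmetric]) auto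
      next
        case False
        then show ?thesis unfolding D'' using n pa[OF F] pb[OF F] by (auto simp: piece_insert e1s e2s)
      qed
    qed
    then show ?thesis using sterm_cong[of F I D' D] by (simp add: pterm_def)
  qed (auto simp: pterm_def)
  have 12: "pt D' (insert e1 (insert e2 F)) = 0" if F: "F \<subseteq> D" for F
  proof (cases "noncrossing (insert e1 (insert e2 F))")
    case True
    let ?F = "insert e1 (insert e2 F)"
    have "?F \<subseteq> D'" using F unfolding D'' by (intro insert_mono)
    then have wfF: "wf_arrows ?F" by (rule wf_subset[OF assms(2)])
    \<comment> \<open>The strip between the two arrows lies to the left of both or to the right of
      both. Every endpoint of \<open>D\<close> is to the left of exactly one of them, so the strip
      contains none.\<close>
    obtain v where v: "v \<in> regions ?F" "e1 \<in> v \<longleftrightarrow> e2 \<in> v"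
    proof (cases "side e2 a")
      case True
      then have "e1 \<in> lft ?F e1" "e2 \<in> lft ?F e1" by (auto simp: lft_def region_def e1s)
      then show ?thesis using that lft_in_regions[OF wfF, of e1] by blast
    next
      case False
      then have "e1 \<notin> rgt ?F e1" "e2 \<notin> rgt ?F e1" by (auto simp: rgt_def region_def e1s)
          (simp add: side_def e1s)
      then show ?thesis using that rgt_in_regions[of ?F e1] by blast
    qed
    have "d \<notin> piece D' ?F v" for d
    proof
      assume d: "d \<in> piece D' ?F v"
      then have p: "src d \<in> endpoints D" using endpointsI(1)[of d D] unfolding piece_def D'' by blast
      have "region ?F (src d) = v" using d unfolding piece_def by blast
      then have "e1 \<in> v \<longleftrightarrow> side e1 (src d)" "e2 \<in> v \<longleftrightarrow>
          side e2 (src d)" unfolding region_def by blast+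
      then show False using opp[OF p] v(2) by blast
    qed
    then have "piece D' ?F v = {}" by blast
    then show ?thesis using sterm_zero_piece[OF wf_finite[OF wfF] v(1), of D' I \<kappa>] I0 by (simp
        add: pterm_def)
  qed (simp add: pterm_def)
  have 1: "pt D' (insert e1 F) + pt D' (insert e2 F) = 0" if F: "F \<subseteq> D" for F
  proof (cases "noncrossing F \<and> region F a = region F b")
    case True
    let ?F1 = "insert e1 F" and ?F2 = "insert e2 F"
    \<comment> \<open>The left of \<open>e1\<close> is the right of \<open>e2\<close>, so membership
      of \<open>e1\<close> is traded for non-membership of \<open>e2\<close>. Sign and direction are
      both opposite, which leaves the order constraint unchanged and only the sign product
      reversed.\<close>
    define g where "g v = (if e1 \<in> v then v - {e1} else insert e2 v)" for v
    define h where "h e = (if e = e1 then e2 else e)" for e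
    have n: "e1 \<notin> F" "e2 \<notin> F" using F nD by auto
    have ncs: "noncrossing ?F1" "noncrossing ?F2" using nc[OF F] True by auto
    have wfs: "wf_arrows ?F1" "wf_arrows ?F2"
      by (rule wf_subset[OF assms(2)], use F in \<open>simp add: D'' subset_insertI2\<close>)+
    have gp: "region ?F2 p = g (region ?F1 p)" if "p \<in> endpoints D" for p
      using opp[OF that] n by (auto simp: region_insert g_def region_def)
    have hF: "bij_betw h ?F1 ?F2"
      by (rule bij_betw_byWitness[where f' = "\<lambda>e. if e = e2 then e1 else e"]) (use n nD in
          \<open>auto simp: h_def\<close>)
    have gi: "inj_on g (regions ?F1)"
    proof (rule inj_onI)
      fix v w assume vw: "v \<in> regions ?F1" "w \<in> regions ?F1" "g v = g w"
      then have "e2 \<notin> v" "e2 \<notin> w" using n nD regions_subset by blast+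
      then show "v = w" using vw(3) unfolding g_def by (auto split: if_splits)
    qed
    have cp: "constraint ?F2 (h e) = map_prod g g (constraint ?F1 e)" if e: "e \<in> ?F1" for e
    proof (cases "e = e1")
      case t: True
      have "region ?F1 a = region F a" "region ?F2 b' = region F a"
        using True pb[OF F] by (simp_all add: region_insert side_def e1s e2s)
      then have "g (rgt ?F1 e1) = lft ?F2 e2" "g (lft ?F1 e1) = rgt ?F2 e2"
        using n by (auto simp: g_def rgt_def lft_def e1s e2s dest: region_subset[THEN subsetD])
      then show ?thesis using l by (simp add: t h_def constraint_def e1s e2s)
    next
      case f: False
      then have eF: "e \<in> F" "e \<noteq> e2" using e n by auto
      have "src e \<in> endpoints D" using eF F endpointsI(1) by blast
      then have "g (rgt ?F1 e) = rgt ?F2 e" "g (lft ?F1 e) = lft ?F2 e"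
        using gp f by (auto simp: rgt_def lft_def g_def)
      then show ?thesis using f by (simp add: h_def constraint_def)
    qed
    have pc: "I (piece D' ?F2 (g v)) = I (piece D' ?F1 v)" if v: "v \<in> regions ?F1" for v
    proof -
      have eq: "piece D ?F2 (g v) = piece D ?F1 v"
        by (rule piece_transfer[OF gp _ region_in_regions gi v]) (use nD in auto)
      have w: "wf_arrows (insert e1 (insert e2 D))" "card (insert e1 (insert e2 D)) \<le> M"
        using assms D'' by auto
      have sw: "insert e1 (insert e2 D) = insert e2 (insert e1 D)" by blast
      have "I (piece D' ?F1 v) = I (piece D ?F1 v)"
        unfolding D'' unfolding e1_def e2_def
        by (rule piece_parallel[OF w[unfolded e1_def e2_def] F new dist opp[unfolded e1_def e2_def]])
      moreover have "I (piece D' ?F2 (g v)) = I (piece D ?F2 (g v))"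
        unfolding D'' sw unfolding e1_def e2_def
        by (rule piece_parallel[OF w[unfolded sw, unfolded e1_def e2_def] F])
          (use new dist opp in \<open>auto simp: e1_def e2_def\<close>)
      ultimately show ?thesis using eq by simp
    qed
    have s: "signs ?F2 = - signs ?F1"
      using wf_finite[OF wfs(1)] n l by (simp add: signs_insert e1s e2s)
    have "sterm \<kappa> I D' ?F2 = \<kappa> (zvar ^ card ?F1 * [: linprob (regions ?F1) (constraints
        ?F1) * signs ?F2 :])
        * (\<Prod>v\<in>regions ?F1. I (piece D' ?F1 v))"
      by (rule sterm_iso(3)[where g = g, OF wfs(1) ncs(1) _ wfs(2) ncs(2) hF cp gi])
        (auto intro: pc)
    also have "\<dots> = - sterm \<kappa> I D' ?F1"
    proof -
      have "zvar ^ card ?F1 * [: linprob (regions ?F1) (constraints ?F1) * signs ?F2 :] = - state_coeff ?F1"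
        by (simp add: s state_coeff_def)
      then show ?thesis by (simp add: sterm_def ring_homoD(5)[OF \<kappa>])
    qed
    finally show ?thesis using ncs by (simp add: pterm_def)
  next
    case False
    then show ?thesis using nc[OF F] by (auto simp: pterm_def)
  qed
  have "ps D' = (\<Sum>F\<in>Pow D. pt D' F + pt D' (insert e2 F) + (pt D' (insert e1 F) + pt D' (insert
      e1 (insert e2 F))))"
    unfolding proper_sum_Pow[OF wf_finite[OF assms(2)]] unfolding D''
    using fin nD by (simp add: sum_Pow_insert sum.distrib)
  also have "\<dots> = (\<Sum>F\<in>Pow D. pt D F)"
  proof (rule sum.cong[OF refl])
    fix F assume "F \<in> Pow D"
    then have F: "F \<subseteq> D" by simp
    show "pt D' F + pt D' (insert e2 F) + (pt D' (insert e1 F) + pt D' (insert e1 (insert e2 F))) = pt D F"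
      using 0[OF F] 12[OF F] 1[OF F] by (simp add: algebra_simps)
  qed
  also have "\<dots> = ps D" using proper_sum_Pow[OF fin] by metis
  finally show ?thesis .
qed

end

subsection \<open>Move (c)\<close>

lemma cbetween_shift:
  assumes "\<And>s. s \<in> S \<Longrightarrow> s \<noteq> p \<Longrightarrow> s \<noteq> q" "q \<noteq> p"
    "(\<forall>s\<in>S. \<not> cbetween p s q) \<or> (\<forall>s\<in>S. \<not> cbetween q s p)" "x \<in>
        S" "y \<in> S" "w \<in> S"
  shows "cbetween x y w \<longleftrightarrow> cbetween (if x = p then q else x) (if y = p then q else y)
      (if w = p then q else w)"
proof -
  have n: "(\<not> cbetween p x q \<and> \<not> cbetween p y q \<and> \<not> cbetween p w q) \<or>
      (\<not> cbetween q x p \<and> \<not> cbetween q y p \<and> \<not> cbetween q w p)"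
    using assms(3-6) by blast
  have d: "x = p \<or> x \<noteq> q" "y = p \<or> y \<noteq> q" "w = p \<or> w \<noteq> q" using
      assms(1)[of x] assms(1)[of y] assms(1)[of w] assms(4-6) by blast+
  show ?thesis
    using n d assms(2) unfolding cbetween_def
    by (cases "x = p"; cases "y = p"; cases "w = p"; simp only: if_True if_False simp_thms; argo)
qed

text \<open>Sliding an endpoint across a free arc does not change the cyclic order. Pieces that
  contain a single arrow of the triangle are matched by two such slides.\<close>

lemma homeo_shift:
  assumes "q \<notin> endpoints D" "p \<noteq> q"
    "(\<forall>s\<in>endpoints D. \<not> cbetween p s q) \<or> (\<forall>s\<in>endpoints D. \<not>
        cbetween q s p)"
  defines "f \<equiv> \<lambda>x. if x = p then q else x"
  shows "homeo_rel D ((\<lambda>(a, b, l). (f a, f b, l)) ` D)"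
  unfolding homeo_rel_def
proof (rule exI[of _ f], intro conjI)
  have "endpoints ((\<lambda>(a, b, l). (f a, f b, l)) ` D) = f ` endpoints D"
    unfolding endpoints_def by (auto simp: split_beta)
  moreover have "inj_on f (endpoints D)" using assms(1) by (auto simp: f_def inj_on_def)
  ultimately show "bij_betw f (endpoints D) (endpoints ((\<lambda>(a, b, l). (f a, f b, l)) ` D))"
    by (simp add: bij_betw_def)
  show "\<forall>x\<in>endpoints D. \<forall>y\<in>endpoints D. \<forall>w\<in>endpoints D. cbetween x y
      w = cbetween (f x) (f y) (f w)"
    unfolding f_def using assms by (intro ballI cbetween_shift[of "endpoints D"]) auto
qed simp

lemma homeo_shift_src:
  assumes "x \<notin> endpoints P" "x' \<notin> endpoints P" "y \<noteq> x" "y \<noteq> x'" "x \<noteq> x'"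
    "arc_free P {y} x x' \<or> arc_free P {y} x' x"
  shows "homeo_rel (insert (x, y, l) P) (insert (x', y, l) P)"
proof -
  define f where "f = (\<lambda>z. if z = x then x' else z)"
  have "(f (fst d), f (fst (snd d)), snd (snd d)) = d" if "d \<in> P" for d
    using endpointsI[OF that] assms(1) by (auto simp: f_def prod_eq_iff)
  then have "(\<lambda>(a, b, l). (f a, f b, l)) ` P = P" by (simp add: split_beta cong: image_cong)
  then have "(\<lambda>(a, b, l). (f a, f b, l)) ` insert (x, y, l) P = insert (x', y, l) P"
    using assms by (simp add: f_def)
  then show ?thesis
    using homeo_shift[of x' "insert (x, y, l) P" x] assms(2-6) unfolding f_def by (auto simp: arc_free_def)
qed

lemma homeo_shift_tgt:
  assumes "x \<notin> endpoints P" "x' \<notin> endpoints P" "y \<noteq> x" "y \<noteq> x'" "x \<noteq> x'"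
    "arc_free P {y} x x' \<or> arc_free P {y} x' x"
  shows "homeo_rel (insert (y, x, l) P) (insert (y, x', l) P)"
proof -
  define f where "f = (\<lambda>z. if z = x then x' else z)"
  have "(f (fst d), f (fst (snd d)), snd (snd d)) = d" if "d \<in> P" for d
    using endpointsI[OF that] assms(1) by (auto simp: f_def prod_eq_iff)
  then have "(\<lambda>(a, b, l). (f a, f b, l)) ` P = P" by (simp add: split_beta cong: image_cong)
  then have "(\<lambda>(a, b, l). (f a, f b, l)) ` insert (y, x, l) P = insert (y, x', l) P"
    using assms by (simp add: f_def)
  then show ?thesis
    using homeo_shift[of x' "insert (y, x, l) P" x] assms(2-6) unfolding f_def by (auto simp: arc_free_def)
qed

text \<open>The triangle of move (c) for the cyclic order \<open>a, a\<^sup>+, b, b\<^sup>+, c,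
    c\<^sup>+\<close>.\<close>

definition tri :: "'l arrows \<Rightarrow> real \<Rightarrow> real \<Rightarrow> real \<Rightarrow> real
    \<Rightarrow> real \<Rightarrow> real \<Rightarrow> bool" where
  "tri E a ap b bp c cp \<longleftrightarrow> distinct [a, ap, b, bp, c, cp] \<and> {a, ap, b, bp, c,
      cp} \<inter> endpoints E = {} \<and>
     (\<forall>p\<in>endpoints E. \<not> cbetween a p ap \<and> \<not> cbetween b p bp \<and> \<not>
         cbetween c p cp) \<and>
     cbetween a ap b \<and> cbetween a b bp \<and> cbetween a bp c \<and> cbetween a c cp"

lemma tri_rotate_order:
  assumes "distinct [a, ap, b, bp, c, cp]" "cbetween a ap b" "cbetween a b bp" "cbetween a bp c"
      "cbetween a c cp"
  shows "cbetween b bp c \<and> cbetween b c cp \<and> cbetween b cp a \<and> cbetween b a ap"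
  using assms unfolding cbetween_def distinct.simps list.set insert_iff empty_iff by argo

lemma tri_rotate: "tri E a ap b bp c cp \<Longrightarrow> tri E b bp c cp a ap"
  unfolding tri_def using tri_rotate_order[of a ap b bp c cp] by auto

lemma tri_order_sides:
  assumes "distinct [a, ap, b, bp, c, cp]" "cbetween a ap b" "cbetween a b bp" "cbetween a bp c"
      "cbetween a c cp"
  shows "\<not> cbetween ap a b" "\<not> cbetween ap bp b" "\<not> cbetween ap c b" "\<not> cbetween ap cp b"
    "cbetween a ap bp" "cbetween a b bp" "\<not> cbetween a c bp" "\<not> cbetween a cp bp"
    "\<not> cbetween a b ap" "\<not> cbetween a bp ap" "\<not> cbetween a c ap" "\<not> cbetween a cp ap"
  using assms unfolding cbetween_def distinct.simps list.set insert_iff empty_iff by argo+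

text \<open>Outside the three short arcs the circle consists of the left sides of the three arrows
  before the move, and each of these agrees there with the left side of the corresponding arrow
  after it.\<close>

lemma tri_order_point:
  assumes "distinct [a, ap, b, bp, c, cp]" "cbetween a ap b" "cbetween a b bp" "cbetween a bp c"
      "cbetween a c cp"
    "\<not> cbetween a p ap" "\<not> cbetween b p bp" "\<not> cbetween c p cp" "p \<noteq> a" "p
        \<noteq> ap" "p \<noteq> b" "p \<noteq> bp" "p \<noteq> c" "p \<noteq> cp"
  shows "cbetween a p bp \<longleftrightarrow> cbetween ap p b"
    "cbetween ap p b \<or> cbetween bp p c \<or> cbetween cp p a" "\<not> (cbetween ap p b \<and>
        cbetween bp p c)"
  using assms unfolding cbetween_def distinct.simps list.set insert_iff empty_iff by argo+


lemma region_eq_iff: "region F x = region F y \<longleftrightarrow> (\<forall>f\<in>F. side f x = side f y)"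
  unfolding region_def by blast

text \<open>Before the move \<open>e1\<close>, \<open>e2\<close>, \<open>e3\<close> do not cross one
  another and the region to the right of all three, the middle, contains no endpoint of
  \<open>E\<close>; after it \<open>f1\<close>, \<open>f2\<close>, \<open>f3\<close> cross pairwise.
  The signs are left free so that the locale is invariant under rotating the triangle.\<close>

locale triangle = invariant_below \<kappa> I M for \<kappa> :: "R \<Rightarrow> 'a::comm_ring_1" and I M +
  fixes E :: "bool arrows" and a ap b bp c cp :: real and l1 l2 l3 :: bool
    and e1 e2 e3 f1 f2 f3 :: "real \<times> real \<times> bool" and D D' :: "bool arrows"
  assumes tri: "tri E a ap b bp c cp"
    and ed: "e1 = (ap, b, l1)" "e2 = (bp, c, l2)" "e3 = (cp, a, l3)"
    and fd: "f1 = (a, bp, l1)" "f2 = (b, cp, l2)" "f3 = (c, ap, l3)"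
    and D: "D = E \<union> {e1, e2, e3}" and D': "D' = E \<union> {f1, f2, f3}"
    and wfD: "wf_arrows D" and wfD': "wf_arrows D'" and cD: "card D \<le> M"
begin

lemma tri_dist: "distinct [a, ap, b, bp, c, cp]" using tri by (simp add: tri_def)

lemma tri_new: "a \<notin> endpoints E" "ap \<notin> endpoints E" "b \<notin> endpoints E" "bp \<notin>
    endpoints E"
  "c \<notin> endpoints E" "cp \<notin> endpoints E" using tri by (auto simp: tri_def)

lemma tri_notin: "e1 \<notin> E" "e2 \<notin> E" "e3 \<notin> E" "f1 \<notin> E" "f2 \<notin> E" "f3
    \<notin> E"
  using tri_new endpointsI(1)[of e1 E] endpointsI(1)[of e2 E] endpointsI(1)[of e3 E]
    endpointsI(1)[of f1 E] endpointsI(1)[of f2 E] endpointsI(1)[of f3 E] by (auto simp: ed fd)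

lemma tri_neq: "e1 \<noteq> e2" "e1 \<noteq> e3" "e2 \<noteq> e3" "f1 \<noteq> f2" "f1 \<noteq> f3" "f2
    \<noteq> f3"
  using tri_dist by (auto simp: ed fd)

lemma tri_ends: "src e1 = ap" "tgt e1 = b" "lab e1 = l1" "src e2 = bp" "tgt e2 = c" "lab e2 = l2"
  "src e3 = cp" "tgt e3 = a" "lab e3 = l3" "src f1 = a" "tgt f1 = bp" "lab f1 = l1" "src f2 = b" "tgt f2
      = cp" "lab f2 = l2"
  "src f3 = c" "tgt f3 = ap" "lab f3 = l3"
  by (simp_all add: ed fd)

lemma tri_finE: "finite E" using wf_finite[OF wfD] by (simp add: D)

lemma tri_card: "card D' = card D"
proof -
  have "D = insert e1 (insert e2 (insert e3 E))" "D' = insert f1 (insert f2 (insert f3 E))" unfolding D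
      D' by blast+
  then show ?thesis using tri_neq tri_notin tri_finE by simp
qed

lemma tri_sides:
  "\<not> side e1 a" "\<not> side e1 ap" "\<not> side e1 b" "\<not> side e1 bp" "\<not> side e1 c"
      "\<not> side e1 cp"
  "\<not> side e2 a" "\<not> side e2 ap" "\<not> side e2 b" "\<not> side e2 bp" "\<not> side e2 c"
      "\<not> side e2 cp"
  "\<not> side e3 a" "\<not> side e3 ap" "\<not> side e3 b" "\<not> side e3 bp" "\<not> side e3 c"
      "\<not> side e3 cp"
  "side f1 ap" "side f1 b" "\<not> side f1 a" "\<not> side f1 bp" "\<not> side f1 c" "\<not> side f1 cp"
  "side f2 bp" "side f2 c" "\<not> side f2 b" "\<not> side f2 cp" "\<not> side f2 a" "\<not> side f2 ap"
  "side f3 cp" "side f3 a" "\<not> side f3 c" "\<not> side f3 ap" "\<not> side f3 b" "\<not> side f3 bp"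
proof -
  have 1: "tri E a ap b bp c cp" by (rule tri)
  have 2: "tri E b bp c cp a ap" by (rule tri_rotate[OF 1])
  have 3: "tri E c cp a ap b bp" by (rule tri_rotate[OF 2])
  note o = tri_order_sides
  show "\<not> side e1 a" "\<not> side e1 ap" "\<not> side e1 b" "\<not> side e1 bp" "\<not> side e1 c"
      "\<not> side e1 cp"
    "side f1 ap" "side f1 b" "\<not> side f1 a" "\<not> side f1 bp" "\<not> side f1 c" "\<not> side f1 cp"
    using o[of a ap b bp c cp] 1 unfolding tri_def side_def tri_ends by simp_all
  show "\<not> side e2 a" "\<not> side e2 ap" "\<not> side e2 b" "\<not> side e2 bp" "\<not> side e2 c"
      "\<not> side e2 cp"
    "side f2 bp" "side f2 c" "\<not> side f2 b" "\<not> side f2 cp" "\<not> side f2 a" "\<not> side f2 ap"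
    using o[of b bp c cp a ap] 2 unfolding tri_def side_def tri_ends by simp_all
  show "\<not> side e3 a" "\<not> side e3 ap" "\<not> side e3 b" "\<not> side e3 bp" "\<not> side e3 c"
      "\<not> side e3 cp"
    "side f3 cp" "side f3 a" "\<not> side f3 c" "\<not> side f3 ap" "\<not> side f3 b" "\<not> side f3 bp"
    using o[of c cp a ap b bp] 3 unfolding tri_def side_def tri_ends by simp_all
qed

lemma tri_point:
  assumes "p \<in> endpoints E"
  shows "side f1 p \<longleftrightarrow> side e1 p" "side f2 p \<longleftrightarrow> side e2 p" "side f3
      p \<longleftrightarrow> side e3 p"
    "side e1 p \<or> side e2 p \<or> side e3 p" "\<not> (side e1 p \<and> side e2 p)" "\<not> (side e2 p
        \<and> side e3 p)" "\<not> (side e3 p \<and> side e1 p)"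
proof -
  have 1: "tri E a ap b bp c cp" by (rule tri)
  have 2: "tri E b bp c cp a ap" by (rule tri_rotate[OF 1])
  have 3: "tri E c cp a ap b bp" by (rule tri_rotate[OF 2])
  have n: "p \<noteq> a" "p \<noteq> ap" "p \<noteq> b" "p \<noteq> bp" "p \<noteq> c" "p \<noteq> cp"
      using tri_new assms by auto
  show "side f1 p \<longleftrightarrow> side e1 p" "side e1 p \<or> side e2 p \<or> side e3 p" "\<not>
      (side e1 p \<and> side e2 p)"
    using tri_order_point[of a ap b bp c cp p] 1 n assms unfolding tri_def side_def tri_ends by simp_all
  show "side f2 p \<longleftrightarrow> side e2 p" "\<not> (side e2 p \<and> side e3 p)"
    using tri_order_point[of b bp c cp a ap p] 2 n assms unfolding tri_def side_def tri_ends by simp_all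
  show "side f3 p \<longleftrightarrow> side e3 p" "\<not> (side e3 p \<and> side e1 p)"
    using tri_order_point[of c cp a ap b bp p] 3 n assms unfolding tri_def side_def tri_ends by simp_all
qed

lemma tri_free:
  "arc_free E {b, bp, c, cp} a ap" "arc_free E {c, cp, a, ap} b bp" "arc_free E {a, ap, b, bp} c cp"
proof -
  have 1: "tri E a ap b bp c cp" by (rule tri)
  have 2: "tri E b bp c cp a ap" by (rule tri_rotate[OF 1])
  have 3: "tri E c cp a ap b bp" by (rule tri_rotate[OF 2])
  show "arc_free E {b, bp, c, cp} a ap"
    using tri_order_sides[of a ap b bp c cp] 1 unfolding tri_def arc_free_def by auto
  show "arc_free E {c, cp, a, ap} b bp"
    using tri_order_sides[of b bp c cp a ap] 2 unfolding tri_def arc_free_def by auto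
  show "arc_free E {a, ap, b, bp} c cp"
    using tri_order_sides[of c cp a ap b bp] 3 unfolding tri_def arc_free_def by auto
qed

lemma tri_region:
  assumes "F \<subseteq> E"
  shows "region F ap = region F a" "region F bp = region F b" "region F cp = region F c"
  using arc_free_region[OF disjI1[OF tri_free(1)] assms] arc_free_region[OF disjI1[OF tri_free(2)] assms]
   arc_free_region[OF disjI1[OF tri_free(3)] assms] tri_new by simp_all

lemma tri_wf:
  assumes "F \<subseteq> E" "T \<subseteq> {e1, e2, e3}" "T' \<subseteq> {f1, f2, f3}"
  shows "wf_arrows (F \<union> T)" "wf_arrows (F \<union> T')"
proof -
  have "F \<union> T \<subseteq> D" "F \<union> T' \<subseteq> D'" using assms unfolding D D' by blast+
  then show "wf_arrows (F \<union> T)" "wf_arrows (F \<union> T')" using wf_subset wfD wfD' by blast+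
qed

text \<open>Slide the tail from \<open>ap\<close> to \<open>a\<close>, then the head from
  \<open>b\<close> to \<open>bp\<close>. The nonempty state \<open>F\<close>, disjoint from
  \<open>P\<close>, keeps the intermediate diagrams below \<open>M\<close> arrows.\<close>

lemma tri_shift:
  assumes "P \<subseteq> E" "F \<subseteq> E" "F \<noteq> {}" "P \<inter> F = {}"
  shows "I (insert e1 P) = I (insert f1 P)"
proof -
  have fP: "arc_free P {b, bp, c, cp} a ap" "arc_free P {c, cp, a, ap} b bp"
    using tri_free(1,2) endpoints_mono[OF assms(1)] unfolding arc_free_def by blast+
  have nP: "a \<notin> endpoints P" "ap \<notin> endpoints P" "b \<notin> endpoints P" "bp \<notin>
      endpoints P"
    using tri_new endpoints_mono[OF assms(1)] by blast+
  have wP: "wf_arrows P" using tri_wf(1)[OF assms(1), of "{}" "{}"] by simp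
  have w: "wf_arrows (insert (x, y, l1) P)" if "x \<noteq> y" "x \<in> {a, ap}" "y \<in> {b, bp}" for x y
    using that nP wP by (intro wf_insert) auto
  have sub: "insert e1 P \<subseteq> D - F" using assms tri_notin unfolding D by blast
  have FD: "F \<subseteq> D" using assms D by blast
  have cc: "card (insert e1 P) < M" using card_piece[OF wfD cD FD assms(3) sub] by simp
  have n: "e1 \<notin> P" "(a, b, l1) \<notin> P" "f1 \<notin> P"
    using assms(1) tri_notin endpointsI(1)[of "(a, b, l1)" P] nP by auto
  have cards: "card (insert (a, b, l1) P) < M" "card (insert f1 P) < M"
    using cc n wf_finite[OF wP] by simp_all
  have "I (insert (ap, b, l1) P) = I (insert (a, b, l1) P)"
  proof (rule homeo)
    show "homeo_rel (insert (ap, b, l1) P) (insert (a, b, l1) P)"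
      using fP(1) nP tri_dist by (intro homeo_shift_src) (auto simp: arc_free_def)
  qed (use w cc cards tri_dist ed in auto)
  also have "\<dots> = I (insert (a, bp, l1) P)"
  proof (rule homeo)
    show "homeo_rel (insert (a, b, l1) P) (insert (a, bp, l1) P)"
      using fP(2) nP tri_dist by (intro homeo_shift_tgt) (auto simp: arc_free_def)
  qed (use w cards tri_dist fd in auto)
  finally show ?thesis by (simp add: ed fd)
qed

text \<open>After cutting along \<open>e1\<close>, the points \<open>a\<close> and \<open>bp\<close>
  are adjacent on the circle to its right: if \<open>e2\<close> and \<open>e3\<close> survive there,
  they form a pair removable by move (b). After cutting along \<open>f1\<close>, the arrows
  \<open>f2\<close> and \<open>f3\<close>, which cross it, belong to no piece. Up to move (b) both
  sides are left with the same arrows of \<open>E\<close>.\<close>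

lemma triangle_cut_one:
  assumes F: "F \<subseteq> E"
  shows "pt D (insert e1 F) = pt D' (insert f1 F)"
proof -
  let ?G = "insert e1 F" and ?G' = "insert f1 F"
  have wfs: "wf_arrows ?G" "wf_arrows ?G'" using tri_wf[OF F, of "{e1}" "{f1}"] by simp_all
  note pr = tri_region[OF F]
  have ncs: "noncrossing ?G \<longleftrightarrow> noncrossing F \<and> region F a = region F b"
    "noncrossing ?G' \<longleftrightarrow> noncrossing F \<and> region F a = region F b"
    unfolding noncrossing_insert[OF wfs(1)] noncrossing_insert[OF wfs(2)] crossing_def tri_ends
    using pr region_eq_iff[of F ap b] region_eq_iff[of F a bp] by auto
  show ?thesis
  proof (cases "noncrossing F \<and> region F a = region F b")
    case True
    then have nc: "noncrossing ?G" "noncrossing ?G'" using ncs by auto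
    define g where "g v = (if e1 \<in> v then insert f1 (v - {e1}) else v)" for v
    define h where "h e = (if e = e1 then f1 else e)" for e
    have n: "e1 \<notin> F" "f1 \<notin> F" "e2 \<notin> F" "e3 \<notin> F" "f2 \<notin> F" "f3 \<notin>
        F" using F tri_notin by auto
    have gp: "region ?G' p = g (region ?G p)" if "p \<in> endpoints E" for p
      using tri_point(1)[OF that] n by (auto simp: region_insert g_def region_def)
    have hF: "bij_betw h ?G ?G'"
      by (rule bij_betw_byWitness[where f' = "\<lambda>e. if e = f1 then e1 else e"]) (use n in
          \<open>auto simp: h_def\<close>)
    have ef: "e1 \<noteq> f1" using tri_dist by (simp add: ed fd)
    have gi: "inj_on g (regions ?G)"
    proof (rule inj_onI)
      fix v w assume vw: "v \<in> regions ?G" "w \<in> regions ?G" "g v = g w"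
      then have "f1 \<notin> v" "f1 \<notin> w" using n ef regions_subset by blast+
      then show "v = w" using vw(3) unfolding g_def by (auto split: if_splits)
    qed
    have pA: "region ?G ap = region F a" "region ?G a = region F a" "region ?G bp = region F b" "region
        ?G c = region F c" "region ?G cp = region F c"
      using pr by (simp_all add: region_insert tri_sides)
    have pA': "region ?G' a = region F a"
      by (simp add: region_insert tri_sides)
    have cp: "constraint ?G' (h e) = map_prod g g (constraint ?G e)" if e: "e \<in> ?G" for e
    proof (cases "e = e1")
      case t: True
      have "g (rgt ?G e1) = rgt ?G' f1" "g (lft ?G e1) = lft ?G' f1"
        using n by (auto simp: g_def rgt_def lft_def tri_ends pA pA' dest: region_subset[THEN subsetD])
      then show ?thesis by (simp add: t h_def constraint_def tri_ends)
    next
      case f: False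
      then have eF: "e \<in> F" "e \<noteq> f1" using e n by auto
      have "src e \<in> endpoints E" using eF F endpointsI(1) by blast
      then have "g (rgt ?G e) = rgt ?G' e" "g (lft ?G e) = lft ?G' e"
        using gp f by (auto simp: rgt_def lft_def g_def)
      then show ?thesis using f by (simp add: h_def constraint_def)
    qed
    have pc: "I (piece D' ?G' (g v)) = I (piece D ?G v)" if v: "v \<in> regions ?G" for v
    proof -
      let ?P = "piece E ?G v"
      have eq: "piece E ?G' (g v) = ?P"
        by (rule piece_transfer[OF gp _ region_in_regions gi v]) (use tri_notin in auto)
      have fx: "region ?G' b \<noteq> region ?G' cp" "region ?G' c \<noteq> region ?G' ap"
        unfolding region_eq_iff using tri_sides by blast+
      have "piece D' ?G' (g v) = piece (insert f2 (insert f3 E)) ?G' (g v)"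
        unfolding D' piece_def by blast
      also have "\<dots> = ?P"
        using n tri_neq fx by (simp add: piece_insert tri_ends eq) metis
      finally have 1: "piece D' ?G' (g v) = ?P" .
      have 2: "piece D ?G v = piece (insert e2 (insert e3 E)) ?G v"
        unfolding D piece_def by blast
      show ?thesis
      proof (cases "region F c = v \<and> region F a = v")
        case t: True
        have e: "piece (insert e2 (insert e3 E)) ?G v = ?P \<union> {(bp, c, l2), (cp, a, l3)}"
          using n tri_neq t True by (simp add: piece_insert tri_ends pA) (simp add: ed)
        have P: "?P \<subseteq> E" "?P \<subseteq> D - ?G" unfolding piece_def D by blast+
        have P': "?P \<union> {(bp, c, l2), (cp, a, l3)} \<subseteq> D - ?G" using e 2 piece_subset by metis
        have GD: "?G \<subseteq> D" using F D by blast
        note cc = card_piece[OF wfD cD GD _ P(2)] card_piece[OF wfD cD GD _ P']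
        have ne1: "e1 \<notin> v" using t n region_subset by blast
        have fr: "\<not> cbetween a p bp" if pP: "p \<in> endpoints ?P" for p
        proof -
          obtain d where d: "d \<in> ?P" "p = src d \<or> p = tgt d" using pP unfolding endpoints_iff by blast
          then have "region ?G p = v" unfolding piece_def by blast
          then have "\<not> side e1 p" using ne1 unfolding region_def by blast
          moreover have "p \<in> endpoints E" using pP endpoints_mono[OF P(1)] by blast
          ultimately have "\<not> side f1 p" using tri_point(1) by blast
          then show ?thesis by (simp add: side_def tri_ends)
        qed
        have sf: "\<not> cbetween a c bp" "\<not> cbetween a cp bp" using tri_sides(23,24) by (simp_all
            add: side_def tri_ends)
        have "move_b (\<lambda>_ _. True) ?P (?P \<union> {(bp, c, l2), (cp, a, l3)})"
          by (rule move_bI) (use tri_dist tri_new endpoints_mono[OF P(1)] fr sf tri_free(3) in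
              \<open>auto simp: arc_free_def\<close>)
        then have "I ?P = I (?P \<union> {(bp, c, l2), (cp, a, l3)})" using cc by (intro moveb) auto
        then show ?thesis using 1 2 e by simp
      next
        case f: False
        have "piece (insert e2 (insert e3 E)) ?G v = ?P"
          using n tri_neq f True by (auto simp: piece_insert tri_ends pA)
        then show ?thesis using 1 2 by simp
      qed
    qed
    have s: "signs ?G' = signs ?G"
      using wf_finite[OF wfs(1)] n by (simp add: signs_insert tri_ends)
    have "sterm \<kappa> I D' ?G' = \<kappa> (zvar ^ card ?G * [: linprob (regions ?G) (constraints ?G)
        * signs ?G' :])
        * (\<Prod>v\<in>regions ?G. I (piece D ?G v))"
      by (rule sterm_iso(3)[where g = g, OF wfs(1) nc(1) _ wfs(2) nc(2) hF cp gi])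
        (auto intro: pc)
    then show ?thesis using nc by (simp add: pterm_def s sterm_def state_coeff_def)
  qed (use ncs in \<open>auto simp: pterm_def\<close>)
qed

text \<open>The middle circle carries no arrow and contributes \<open>I {} = 0\<close>.\<close>

lemma triangle_cut_three:
  assumes F: "F \<subseteq> E"
  shows "pt D (insert e1 (insert e2 (insert e3 F))) = 0"
proof (cases "noncrossing (insert e1 (insert e2 (insert e3 F)))")
  case True
  let ?G = "insert e1 (insert e2 (insert e3 F))" and ?v = "rgt (insert e1 (insert e2 (insert e3 F))) e1"
  have "?G = F \<union> {e1, e2, e3}" by blast
  then have wfG: "wf_arrows ?G" using tri_wf(1)[OF F, of "{e1, e2, e3}" "{}"] by simp
  have v: "e1 \<notin> ?v" "e2 \<notin> ?v" "e3 \<notin> ?v" using tri_sides by (simp_all add: rgt_def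
      region_def tri_ends)
  have "d \<notin> piece D ?G ?v" for d
  proof
    assume d: "d \<in> piece D ?G ?v"
    then have p: "src d \<in> endpoints E" using endpointsI(1)[of d E] unfolding piece_def D by blast
    have pv: "region ?G (src d) = ?v" using d unfolding piece_def by blast
    have "e1 \<in> region ?G (src d) \<or> e2 \<in> region ?G (src d) \<or> e3 \<in> region ?G (src d)"
      using tri_point(4)[OF p] unfolding region_def by blast
    then show False using v unfolding pv by blast
  qed
  then have "piece D ?G ?v = {}" by blast
  then show ?thesis using sterm_zero_piece[OF wf_finite[OF wfG] rgt_in_regions, of D e1 I \<kappa>] I0
      by (simp add: pterm_def)
qed (simp add: pterm_def)

lemma tri_crossing:
  assumes F: "F \<subseteq> E"
  shows "\<not> noncrossing (insert f1 (insert f2 F))" "\<not> noncrossing (insert f1 (insert f3 F))"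
      "\<not> noncrossing (insert f2 (insert f3 F))"
    "\<not> noncrossing (insert f1 (insert f2 (insert f3 F)))"
proof -
  have "crossing f1 f2" "crossing f1 f3" "crossing f2 f3"
    unfolding crossing_def tri_ends using tri_sides by blast+
  then show "\<not> noncrossing (insert f1 (insert f2 F))" "\<not> noncrossing (insert f1 (insert f3
      F))" "\<not> noncrossing (insert f2 (insert f3 F))"
    "\<not> noncrossing (insert f1 (insert f2 (insert f3 F)))"
    unfolding noncrossing_def by blast+
qed

text \<open>Each statement about \<open>e1\<close>, or about \<open>e1\<close> and
  \<open>e2\<close>, is proved once and transported to the other arrows by this symmetry.\<close>

lemma rotated: "triangle \<kappa> I M E b bp c cp a ap l2 l3 l1 e2 e3 e1 f2 f3 f1 D D'"
  by unfold_locales (use tri_rotate[OF tri] ed fd D D' wfD wfD' cD in auto)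

text \<open>A piece contains one arrow of the triangle for each pair among \<open>a\<close>,
  \<open>b\<close>, \<open>c\<close> that lies in its region. With all three arrows the pieces
  differ by move (c), with exactly one by slides, and otherwise not at all.\<close>

lemma triangle_uncut:
  assumes F: "F \<subseteq> E"
  shows "pt D F = pt D' F"
proof (cases "noncrossing F \<and> F \<noteq> {}")
  case True
  interpret r: triangle \<kappa> I M E b bp c cp a ap l2 l3 l1 e2 e3 e1 f2 f3 f1 D D' by (rule rotated)
  interpret rr: triangle \<kappa> I M E c cp a ap b bp l3 l1 l2 e3 e1 e2 f3 f1 f2 D D' by (rule r.rotated)
  have DD: "D = insert e1 (insert e2 (insert e3 E))" "D' = insert f1 (insert f2 (insert f3 E))"
      unfolding D D' by blast+
  have n: "e1 \<notin> F" "f1 \<notin> F" "e2 \<notin> F" "e3 \<notin> F" "f2 \<notin> F" "f3 \<notin>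
      F" using F tri_notin by auto
  have FD: "F \<subseteq> D" "F \<subseteq> D'" using F DD by auto
  have "I (piece D F v) = I (piece D' F v)" for v
  proof -
    let ?P = "piece E F v"
    have P: "?P \<subseteq> E" "?P \<inter> F = {}" unfolding piece_def by blast+
    have pD: "piece D F v = (let X = (if region F c = v \<and> region F a = v then insert e3 ?P else ?P);
        Y = (if region F b = v \<and> region F c = v then insert e2 X else X) in
        (if region F a = v \<and> region F b = v then insert e1 Y else Y))"
      unfolding DD using n by (simp add: piece_insert tri_ends tri_region[OF F] Let_def)
    have pD': "piece D' F v = (let X = (if region F c = v \<and> region F a = v then insert f3 ?P else ?P);
        Y = (if region F b = v \<and> region F c = v then insert f2 X else X) in
        (if region F a = v \<and> region F b = v then insert f1 Y else Y))"
      unfolding DD using n by (simp add: piece_insert tri_ends tri_region[OF F] Let_def)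
    consider "region F a = v" "region F b = v" "region F c = v" | "region F a = v" "region F b = v"
        "region F c \<noteq> v"
      | "region F a = v" "region F b \<noteq> v" "region F c = v" | "region F a \<noteq> v" "region F b
          = v" "region F c = v"
      | "\<not> (region F a = v \<and> region F b = v)" "\<not> (region F a = v \<and> region F c = v)"
          "\<not> (region F c = v \<and> region F b = v)" by blast
    then show ?thesis
    proof cases
      case 1
      have e: "piece D F v = ?P \<union> {(ap, b, l1), (bp, c, l2), (cp, a, l3)}" "piece D' F v = ?P
          \<union> {(a, bp, l1), (b, cp, l2), (c, ap, l3)}"
        unfolding pD pD' Let_def using 1 by (simp_all add: ed fd)
      have "endpoints (piece D F v) \<subseteq> endpoints E \<union> {a, ap, b, bp, c, cp}"
        unfolding e using endpoints_mono[OF P(1)] by auto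
      then have af: "arc_free (piece D F v) {} a ap" "arc_free (piece D F v) {} b bp" "arc_free (piece D
          F v) {} c cp"
        using tri_free cbetween_same unfolding arc_free_def by blast+
      have nP: "{a, ap, b, bp, c, cp} \<inter> endpoints ?P = {}" using endpoints_mono[OF P(1)] tri_new
          by blast
      have s: "piece D F v \<subseteq> D - F" "piece D' F v \<subseteq> D' - F" by (rule piece_subset)+
      have "card D' \<le> M" using cD tri_card by simp
      note cc = card_piece[OF wfD cD FD(1) _ s(1)] card_piece[OF wfD' this FD(2) _ s(2)]
      have "move_c (\<lambda>_ _ _. True) (piece D F v) (piece D' F v)"
        unfolding e(2) by (rule move_cI[where Pc = "\<lambda>_ _ _. True", OF tri_dist nP TrueI e(1) af])
      then show ?thesis using cc True by (intro movec) auto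
    next
      case 2
      then show ?thesis unfolding pD pD' Let_def using tri_shift[OF P(1) F _ P(2)] True by simp
    next
      case 3
      then show ?thesis unfolding pD pD' Let_def using rr.tri_shift[OF P(1) F _ P(2)] True by simp
    next
      case 4
      then show ?thesis unfolding pD pD' Let_def using r.tri_shift[OF P(1) F _ P(2)] True by simp
    next
      case 5
      then show ?thesis unfolding pD pD' Let_def
        by (cases "region F a = v"; cases "region F b = v"; cases "region F c = v") simp_all
    qed
  qed
  then show ?thesis using sterm_cong[of F I D D'] by (simp add: pterm_def)
qed (auto simp: pterm_def)

text \<open>The arrow \<open>e3\<close> is not cut, so the middle circle \<open>A\<close> is merged
  with the circle left of \<open>e3\<close>. As the middle is empty, \<open>e3\<close> is a kink on
  the merged circle. Hence the term can be written over the vertex set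
  \<open>regions G - {A}\<close> of the finer state \<open>G\<close>, with
  \<open>insert e3 A\<close> in the role of the middle. This set is the same for all three pairs of
  arrows, which makes the three terms comparable.\<close>

lemma triangle_cut_two:
  assumes F: "F \<subseteq> E" and nc: "noncrossing F" and A: "region F a = A" "region F b = A" "region
      F c = A"
    and G: "G = insert e1 (insert e2 (insert e3 F))"
  shows "pt D (insert e1 (insert e2 F)) = \<kappa> (zvar ^ (card F + 2) *
     [: linprob (regions G - {A}) (constraint G ` F \<union>
          {if l1 then (insert e1 A, insert e3 A) else (insert e3 A, insert e1 A),
           if l2 then (insert e2 A, insert e3 A) else (insert e3 A, insert e2 A)})
        * signs (insert e1 (insert e2 F)) :]) * (\<Prod>v\<in>regions G - {A}. I (piece E G v))"
    "insert e1 A \<in> regions G - {A}" "insert e2 A \<in> regions G - {A}" "insert e3 A \<in> regions G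
        - {A}"
    "insert e1 A \<noteq> insert e2 A" "insert e1 A \<noteq> insert e3 A" "insert e2 A \<noteq> insert e3 A"
    "constraint G ` F \<subseteq> (regions G - {A}) \<times> (regions G - {A})"
proof -
  let ?H = "insert e1 (insert e2 F)"
  let ?V = "regions G - {A}"
  define g where "g v = v - {e3}" for v
  have GF: "G = F \<union> {e1, e2, e3}" "?H = F \<union> {e1, e2}" unfolding G by blast+
  have wfG: "wf_arrows G" "wf_arrows ?H"
    unfolding GF using tri_wf(1)[OF F, of "{e1, e2, e3}" "{}"] tri_wf(1)[OF F, of "{e1, e2}" "{}"] by simp_all
  have w3: "wf_arrows (insert e2 (insert e3 F))" "wf_arrows (insert e3 F)"
    by (rule wf_subset[OF wfG(1)], unfold G, blast)+
  have AF: "A \<subseteq> F" using A(1) region_subset by metis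
  have n: "e1 \<notin> F" "e2 \<notin> F" "e3 \<notin> F" using F tri_notin by auto
  then have nA: "e1 \<notin> A" "e2 \<notin> A" "e3 \<notin> A" using AF by auto
  have pA: "region F ap = A" "region F bp = A" "region F cp = A" using A tri_region[OF F] by simp_all
  have sF: "side f x = side f y" if "f \<in> F" "x \<in> {a,ap,b,bp,c,cp}" "y \<in> {a,ap,b,bp,c,cp}"
      for f x y
  proof -
    have "region F x = region F y" using that(2,3) A pA by auto
    then show ?thesis using that(1) unfolding region_eq_iff by blast
  qed
  have ncG: "noncrossing G"
    unfolding G noncrossing_insert[OF wfG(1)[unfolded G]] noncrossing_insert[OF w3(1)]
        noncrossing_insert[OF w3(2)]
    using nc sF tri_sides by (auto simp: crossing_def tri_ends)
  have ncH: "noncrossing ?H" by (rule noncrossing_subset[OF ncG]) (auto simp: G)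
  have pG: "region G ap = A" "region G bp = A" "region G cp = A" "region G a = A"
    using tri_sides pA A by (simp_all add: G region_insert)
  have pH: "region ?H ap = A" "region ?H bp = A" "region ?H cp = A" "region ?H a = A"
    using tri_sides pA A by (simp_all add: region_insert)
  have gp: "region ?H p = g (region G p)" for p
    unfolding g_def G region_def using n tri_neq by blast
  have lfts: "lft G e1 = insert e1 A" "lft G e2 = insert e2 A" "lft G e3 = insert e3 A"
    by (simp_all add: lft_def tri_ends pG)
  show XYZ: "insert e1 A \<in> ?V" "insert e2 A \<in> ?V" "insert e3 A \<in> ?V"
    using lft_in_regions[OF wfG(1)] nA G unfolding lfts[symmetric] by (auto simp: lfts)
  show ne: "insert e1 A \<noteq> insert e2 A" "insert e1 A \<noteq> insert e3 A" "insert e2 A \<noteq>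
      insert e3 A"
    using nA tri_neq by blast+
  have gA: "g A = A" "g (insert e3 A) = A" "g (insert e1 A) = insert e1 A" "g (insert e2 A) = insert e2 A"
    unfolding g_def using nA tri_neq by auto
  \<comment> \<open>Regions with the same image differ at most across \<open>e3\<close>; if they do
    differ, \<open>regions_separated\<close> makes one of them \<open>A\<close>, which has been
    removed from the vertex set.\<close>
  have gi: "inj_on g ?V"
  proof (rule inj_onI)
    fix v w assume vw: "v \<in> ?V" "w \<in> ?V" "g v = g w"
    obtain x y where xy: "v = region G x" "w = region G y" using vw unfolding regions_def by blast
    have e3G: "e3 \<in> G" by (simp add: G)
    have eq: "side f x = side f y" if "f \<in> G" "f \<noteq> e3" for f
      using vw(3) that unfolding xy g_def region_def by blast
    have rA: "rgt G e3 = A" by (simp add: rgt_def tri_ends pG)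
    have "side e3 x = side e3 y"
    proof (rule ccontr)
      assume "side e3 x \<noteq> side e3 y"
      then consider "side e3 x" "\<not> side e3 y" | "side e3 y" "\<not> side e3 x" by blast
      then show False
      proof cases
        case 1
        then have "w = A" using regions_separated(2)[OF wfG(1) ncG e3G, of x y] eq rA xy by blast
        then show False using vw by blast
      next
        case 2
        then have "v = A" using regions_separated(2)[OF wfG(1) ncG e3G, of y x] eq rA xy by blast
        then show False using vw by blast
      qed
    qed
    then show "v = w" unfolding xy region_eq_iff using eq by blast
  qed
  have vH: "regions ?H = g ` ?V"
  proof -
    have "regions ?H = g ` regions G" unfolding regions_def image_image using gp by simp
    also have "\<dots> = g ` ?V"
    proof -
      have "A \<in> regions G" using pG(1) region_in_regions by metis
      then have "g ` regions G = insert (g A) (g ` ?V)" by (metis image_insert insert_Diff)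
      moreover have "g A \<in> g ` ?V" using gA XYZ(3) by (metis image_eqI)
      ultimately show ?thesis by (simp add: insert_absorb)
    qed
    finally show ?thesis .
  qed
  have pE: "region G p \<in> ?V" if "p \<in> endpoints E" for p
  proof -
    have "e1 \<in> region G p \<or> e2 \<in> region G p \<or> e3 \<in> region G p" using tri_point(4)[OF
        that] unfolding region_def G by blast
    then show ?thesis using nA region_in_regions[of G p] by blast
  qed
  have rl: "rgt G e \<in> ?V" "lft G e \<in> ?V" if "e \<in> F" for e
  proof -
    have s: "src e \<in> endpoints E" using that F endpointsI(1) by blast
    show "rgt G e \<in> ?V" unfolding rgt_def by (rule pE[OF s])
    have "e1 \<in> region G (src e) \<or> e2 \<in> region G (src e) \<or> e3 \<in> region G (src e)"
        using tri_point(4)[OF s] unfolding region_def G by blast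
    then have "lft G e \<noteq> A" using nA unfolding lft_def by blast
    moreover have "lft G e \<in> regions G" using that by (intro lft_in_regions[OF wfG(1)]) (simp add: G)
    ultimately show "lft G e \<in> ?V" by blast
  qed
  show C0: "constraint G ` F \<subseteq> ?V \<times> ?V"
    by (rule image_subsetI) (use rl in \<open>simp add: constraint_def\<close>)
  let ?C = "constraint G ` F \<union> {if l1 then (insert e1 A, insert e3 A) else (insert e3 A, insert e1 A),
           if l2 then (insert e2 A, insert e3 A) else (insert e3 A, insert e2 A)}"
  have CV: "?C \<subseteq> ?V \<times> ?V" using C0 XYZ by auto
  have "constraint ?H e = map_prod g g (constraint G e)" if "e \<in> F" for e
  proof -
    have "g (rgt G e) = rgt ?H e" "g (lft G e) = lft ?H e"
      using n(3) that gp by (auto simp: rgt_def lft_def g_def)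
    then show ?thesis by (simp add: constraint_def)
  qed
  then have "constraint ?H ` F = map_prod g g ` constraint G ` F" by (simp add: image_image)
  moreover have "constraint ?H e1 = map_prod g g (if l1 then (insert e1 A, insert e3 A) else (insert e3
      A, insert e1 A))"
    "constraint ?H e2 = map_prod g g (if l2 then (insert e2 A, insert e3 A) else (insert e3 A, insert e2 A))"
    using gA by (simp_all add: constraint_def rgt_def lft_def tri_ends pH)
  ultimately have cH: "constraints ?H = map_prod g g ` ?C"
    unfolding constraints_def by (simp only: image_insert image_Un image_empty Un_insert_right Un_empty_right)
  have lp: "linprob (regions ?H) (constraints ?H) = linprob ?V ?C"
    unfolding vH cH by (rule linprob_map[OF gi CV])
  have pc: "I (piece D ?H (g v)) = I (piece E G v)" if v: "v \<in> ?V" for v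
  proof -
    let ?P = "piece E G v"
    have eq: "piece E ?H (g v) = ?P"
      by (rule piece_transfer[OF gp _ pE gi v]) (use tri_notin G in auto)
    have "piece D ?H (g v) = piece (insert e3 E) ?H (g v)" unfolding D piece_def by blast
    also have "\<dots> = (if g v = A then insert e3 ?P else ?P)"
      using n tri_neq by (auto simp: piece_insert tri_ends pH eq)
    finally have e: "piece D ?H (g v) = (if g v = A then insert e3 ?P else ?P)" .
    show ?thesis
    proof (cases "g v = A")
      case True
      then have vZ: "v = insert e3 A" using inj_onD[OF gi _ v XYZ(3)] gA by simp
      have P: "?P \<subseteq> E" unfolding piece_def by blast
      have e': "piece D ?H (g v) = insert e3 ?P" using e True by simp
      have sub: "insert e3 ?P \<subseteq> D - ?H" using e' piece_subset by metis
      have HD: "?H \<subseteq> D" using F unfolding D by blast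
      \<comment> \<open>All endpoints of this piece are left of \<open>e3\<close>, so the arc from
        \<open>a\<close> to \<open>cp\<close> on its right is free.\<close>
      have fr: "\<not> cbetween a p cp" if pP: "p \<in> endpoints ?P" for p
      proof -
        obtain d where d: "d \<in> ?P" "p = src d \<or> p = tgt d" using pP unfolding endpoints_iff by blast
        then have "region G p = v" unfolding piece_def by blast
        then have "side e3 p" using vZ unfolding region_def by blast
        moreover have "p \<noteq> a" "p \<noteq> cp" using endpoints_mono[OF P] pP tri_new by blast+
        ultimately show ?thesis using cbetween_total[of cp a p] tri_dist by (auto simp: side_def tri_ends)
      qed
      have "I (insert (cp, a, l3) ?P) = I ?P"
        using card_piece[OF wfD cD HD _ sub] endpoints_mono[OF P] tri_new fr
        by (intro kink) (auto simp: ed arc_free_def)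
      then show ?thesis using e' by (simp add: ed)
    next
      case False
      then show ?thesis using e by simp
    qed
  qed
  have "card ?H = card F + 2" using n tri_neq finite_subset[OF F tri_finE] by simp
  then have "sterm \<kappa> I D ?H = \<kappa> (zvar ^ (card F + 2) * [: linprob ?V ?C * signs ?H :]) *
      (\<Prod>v\<in>?V. I (piece E G v))"
    unfolding sterm_def state_coeff_def lp unfolding vH by (simp add: prod.reindex[OF gi] pc)
  then show "pt D (insert e1 (insert e2 F)) = \<kappa> (zvar ^ (card F + 2) * [: linprob ?V ?C * signs
      ?H :]) * (\<Prod>v\<in>?V. I (piece E G v))"
    using ncH by (simp add: pterm_def)
qed

lemma triangle_cut_two_zero:
  assumes F: "F \<subseteq> E" and "\<not> (noncrossing F \<and> region F a = region F b \<and> region F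
      b = region F c)"
  shows "pt D (insert e1 (insert e2 F)) = 0"
proof (cases "noncrossing (insert e1 (insert e2 F))")
  case True
  then have nc: "noncrossing F" "noncrossing (insert e1 F)" "noncrossing (insert e2 F)" using
      noncrossing_subset by blast+
  have wf: "wf_arrows (insert e1 F)" "wf_arrows (insert e2 F)" using tri_wf(1)[OF F, of "{e1}" "{}"]
      tri_wf(1)[OF F, of "{e2}" "{}"] by simp_all
  have "region F ap = region F b" "region F bp = region F c"
    unfolding region_eq_iff using nc noncrossing_insert[OF wf(1)] noncrossing_insert[OF wf(2)]
    by (auto simp: crossing_def tri_ends)
  then show ?thesis using assms nc tri_region[OF F] by simp
qed (simp add: pterm_def)

text \<open>The arrow not cut is \<open>e3\<close>, \<open>e2\<close>, \<open>e1\<close> in turn,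
  and correspondingly \<open>Z\<close>, \<open>Y\<close>, \<open>X\<close> takes the place of the
  middle. With signs +, +, - the constraints read \<open>X, Y < Z\<close>, then
  \<open>X < Y < Z\<close>, then \<open>Y < X < Z\<close>, and the last two sign products are
  opposite to the first.\<close>

lemma triangle_cut_two_sum:
  assumes F: "F \<subseteq> E" and l: "l1" "l2" "\<not> l3"
  shows "pt D (insert e1 (insert e2 F)) + pt D (insert e1 (insert e3 F)) + pt D (insert e2 (insert e3 F)) = 0"
proof -
  interpret r: triangle \<kappa> I M E b bp c cp a ap l2 l3 l1 e2 e3 e1 f2 f3 f1 D D' by (rule rotated)
  interpret rr: triangle \<kappa> I M E c cp a ap b bp l3 l1 l2 e3 e1 e2 f3 f1 f2 D D' by (rule r.rotated)
  have sw: "insert e1 (insert e3 F) = insert e3 (insert e1 F)" by blast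
  show ?thesis
  proof (cases "noncrossing F \<and> region F a = region F b \<and> region F b = region F c")
    case True
    define A where "A = region F a"
    have nc: "noncrossing F" and A: "region F a = A" "region F b = A" "region F c = A" using True by
        (auto simp: A_def)
    define G where "G = insert e1 (insert e2 (insert e3 F))"
    have G2: "G = insert e2 (insert e3 (insert e1 F))" and G3: "G = insert e3 (insert e1 (insert e2 F))"
        unfolding G_def by blast+
    define X Y Z V C Q where "X = insert e1 A" and "Y = insert e2 A" and "Z = insert e3 A" and "V =
        regions G - {A}"
      and "C = constraint G ` F" and "Q = (\<Prod>v\<in>V. I (piece E G v))"
    note t = triangle_cut_two[OF F nc A G_def]
    note t1 = t(1)[folded X_def Y_def Z_def V_def C_def Q_def]
    note t2 = r.triangle_cut_two(1)[OF F nc A(2,3,1) G2, folded X_def Y_def Z_def V_def C_def Q_def]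
    note t3 = rr.triangle_cut_two(1)[OF F nc A(3,1,2) G3, folded X_def Y_def Z_def V_def C_def Q_def]
    have V: "X \<in> V" "Y \<in> V" "Z \<in> V" "X \<noteq> Y" "X \<noteq> Z" "Y \<noteq> Z" using
        t(2-7) by (simp_all add: X_def Y_def Z_def V_def)
    have "finite G" using finite_subset[OF F tri_finE] by (simp add: G_def)
    then have finV: "finite V" using finite_regions[of G] by (simp add: V_def)
    let ?L1 = "linprob V (C \<union> {(X, Z), (Y, Z)})" and ?L2 = "linprob V (C \<union> {(Y, X), (X,
        Z)})" and ?L3 = "linprob V (C \<union> {(Y, Z), (X, Y)})"
    have L2: "linprob V (insert (Y, X) (C \<union> {(X, Z), (Y, Z)})) = ?L2"
    proof -
      have "insert (Y, X) (C \<union> {(X, Z), (Y, Z)}) = insert (Y, Z) (C \<union> {(Y, X), (X, Z)})"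
          by blast
      then show ?thesis using linprob_trans[of Y X "C \<union> {(Y, X), (X, Z)}" Z V] V by simp
    qed
    have L3: "linprob V (insert (X, Y) (C \<union> {(X, Z), (Y, Z)})) = ?L3"
    proof -
      have "insert (X, Y) (C \<union> {(X, Z), (Y, Z)}) = insert (X, Z) (C \<union> {(Y, Z), (X, Y)})"
          by blast
      then show ?thesis using linprob_trans[of X Y "C \<union> {(Y, Z), (X, Y)}" Z V] V by simp
    qed
    have L: "?L1 = ?L2 + ?L3"
      using linprob_split[OF finV V(1,2,4), of "C \<union> {(X, Z), (Y, Z)}"] L2 L3 by simp
    have n: "e1 \<notin> F" "e2 \<notin> F" "e3 \<notin> F" "finite F" using F tri_notin
        finite_subset[OF F tri_finE] by auto
    have s: "signs (insert e1 (insert e2 F)) = signs F" "signs (insert e2 (insert e3 F)) = - signs F"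
        "signs (insert e3 (insert e1 F)) = - signs F"
      using n tri_neq l by (simp_all add: signs_insert tri_ends)
    let ?z = "zvar ^ (card F + 2)"
    have "pt D (insert e1 (insert e2 F)) + pt D (insert e1 (insert e3 F)) + pt D (insert e2 (insert e3 F)) =
      \<kappa> (?z * [:?L1 * signs F:]) * Q + \<kappa> (?z * [:?L3 * - signs F:]) * Q + \<kappa> (?z *
          [:?L2 * - signs F:]) * Q"
      unfolding sw t1 t2 t3 s Q_def using l by simp
    also have "\<dots> = \<kappa> (?z * [:?L1 * signs F:] + ?z * [:?L3 * - signs F:] + ?z * [:?L2 * -
        signs F:]) * Q"
      by (simp only: ring_homoD(1)[OF \<kappa>] distrib_right)
    also have "?z * [:?L1 * signs F:] + ?z * [:?L3 * - signs F:] + ?z * [:?L2 * - signs F:] = ?z * [:?L1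
        * signs F + ?L3 * - signs F + ?L2 * - signs F:]"
      by (simp only: distrib_left[symmetric] add_pCons add_0)
    also have "?L1 * signs F + ?L3 * - signs F + ?L2 * - signs F = 0" unfolding L by (simp add: algebra_simps)
    finally show ?thesis by (simp add: ring_homoD(4)[OF \<kappa>])
  next
    case False
    have "\<not> (noncrossing F \<and> region F b = region F c \<and> region F c = region F a)" "\<not>
        (noncrossing F \<and> region F c = region F a \<and> region F a = region F b)"
      using False by auto
    then show ?thesis
      unfolding sw using triangle_cut_two_zero[OF F False] r.triangle_cut_two_zero[OF F]
          rr.triangle_cut_two_zero[OF F] by simp
  qed
qed

lemma proper_sum_triangle:
  assumes l: "l1" "l2" "\<not> l3"
  shows "ps D' = ps D"
proof -
  interpret r: triangle \<kappa> I M E b bp c cp a ap l2 l3 l1 e2 e3 e1 f2 f3 f1 D D' by (rule rotated)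
  interpret rr: triangle \<kappa> I M E c cp a ap b bp l3 l1 l2 e3 e1 e2 f3 f1 f2 D D' by (rule r.rotated)
  have DD: "D = insert e1 (insert e2 (insert e3 E))" "D' = insert f1 (insert f2 (insert f3 E))"
      unfolding D D' by blast+
  have sums: "(\<Sum>F\<in>Pow (insert x (insert y (insert z E))). \<chi> F) = (\<Sum>F\<in>Pow E.
      \<chi> F + \<chi> (insert z F) + \<chi> (insert y F) + \<chi> (insert y (insert z F))
     + \<chi> (insert x F) + \<chi> (insert x (insert z F)) + \<chi> (insert x (insert y F)) + \<chi>
         (insert x (insert y (insert z F))))"
    if "x \<notin> E" "y \<notin> E" "z \<notin> E" "x \<noteq> y" "x \<noteq> z" "y \<noteq> z" for x y
        z and \<chi> :: "bool arrows \<Rightarrow> 'a"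
    using that tri_finE by (simp add: sum_Pow_insert sum.distrib)
  have "ps D = (\<Sum>F\<in>Pow (insert e1 (insert e2 (insert e3 E))). pt D F)"
    using proper_sum_Pow[OF wf_finite[OF wfD]] DD by metis
  also have "\<dots> = (\<Sum>F\<in>Pow (insert f1 (insert f2 (insert f3 E))). pt D' F)"
    unfolding sums[OF tri_notin(1-3) tri_neq(1-3)] sums[OF tri_notin(4-6) tri_neq(4-6)]
  proof (rule sum.cong[OF refl], goal_cases)
    case (1 F)
    then have F: "F \<subseteq> E" by simp
    \<comment> \<open>The arrows after the move cross pairwise, so a state contains at most one of
      them.\<close>
    have "pt D' (insert f1 (insert f2 F)) = 0" "pt D' (insert f1 (insert f3 F)) = 0"
      "pt D' (insert f2 (insert f3 F)) = 0" "pt D' (insert f1 (insert f2 (insert f3 F))) = 0"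
      using tri_crossing[OF F] by (simp_all add: pterm_def)
    moreover note triangle_uncut[OF F] triangle_cut_one[OF F] r.triangle_cut_one[OF F]
        rr.triangle_cut_one[OF F] triangle_cut_three[OF F] triangle_cut_two_sum[OF F l]
    ultimately show ?case by (simp add: algebra_simps)
  qed
  also have "\<dots> = ps D'"
    using proper_sum_Pow[OF wf_finite[OF wfD']] DD by metis
  finally show ?thesis by simp
qed

end


section \<open>Reversal of all arrows\<close>

definition rev_arr :: "real \<times> real \<times> 'l \<Rightarrow> real \<times> real \<times> 'l" where
  "rev_arr e = (tgt e, src e, lab e)"

lemma rev_arr_simps [simp]: "src (rev_arr e) = tgt e" "tgt (rev_arr e) = src e" "lab (rev_arr e) = lab
    e" "rev_arr (rev_arr e) = e"
  "rev_arr (a, b, l) = (b, a, l)"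
  by (simp_all add: rev_arr_def)

lemma inj_rev_arr: "inj rev_arr" by (metis injI rev_arr_simps(4))

lemma rev_arr_image_image [simp]: "rev_arr ` rev_arr ` D = D" by (simp add: image_image)

lemma endpoints_rev_arr [simp]: "endpoints (rev_arr ` D) = endpoints D"
  unfolding set_eq_iff endpoints_iff by auto

lemma card_rev_arr [simp]: "card (rev_arr ` D) = card D"
  by (intro card_image inj_on_subset[OF inj_rev_arr]) simp

lemma wf_rev_arr:
  assumes "wf_arrows D" shows "wf_arrows (rev_arr ` D)"
proof -
  have "{tgt e, src e} \<inter> {tgt e', src e'} = {}" if "e \<in> D" "e' \<in> D" "e \<noteq> e'" for e e'
    using wf_distinct[OF assms that] by blast
  then show ?thesis using wf_finite[OF assms] wf_src_neq_tgt[OF assms]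
    unfolding wf_arrows_def split_beta ball_simps rev_arr_simps by (intro conjI ballI impI) (simp,
        metis, blast)
qed

lemma side_rev_arr:
  assumes "src e \<noteq> tgt e"
  shows "side (rev_arr e) x \<longleftrightarrow> x \<noteq> src e \<and> x \<noteq> tgt e \<and> \<not>
      side e x"
  using assms cbetween_total[of "src e" "tgt e" x]
  by (cases "x = src e"; cases "x = tgt e") (auto simp: side_def)

lemma region_rev_arr:
  assumes "wf_arrows F" "x \<notin> endpoints F"
  shows "region (rev_arr ` F) x = rev_arr ` (F - region F x)"
proof -
  have "side (rev_arr f) x \<longleftrightarrow> \<not> side f x" if "f \<in> F" for f
    using side_rev_arr[OF wf_src_neq_tgt[OF assms(1) that]] assms(2) endpointsI[OF that] by metis
  then show ?thesis unfolding region_def by blast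
qed

text \<open>Reversal complements regions, except that an endpoint belongs to the right of its own
  arrow both before and after. So the two sides of \<open>e\<close> are computed separately, at the
  tail of the reversed arrow.\<close>

lemma rgt_lft_rev_arr:
  assumes "wf_arrows F" "noncrossing F" "e \<in> F"
  shows "rgt (rev_arr ` F) (rev_arr e) = rev_arr ` (F - lft F e)" "lft (rev_arr ` F) (rev_arr e) =
      rev_arr ` (F - rgt F e)"
proof -
  have "side (rev_arr f) (tgt e) \<longleftrightarrow> f \<noteq> e \<and> \<not> side f (src e)" if f:
      "f \<in> F" for f
  proof -
    have "side f (src e) = side f (tgt e)" using assms f by (auto simp: noncrossing_def crossing_def)
    then show ?thesis
      using side_rev_arr[OF wf_src_neq_tgt[OF assms(1) f]] wf_distinct[OF assms(1) f assms(3)] by (cases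
          "f = e") auto
  qed
  then show r: "rgt (rev_arr ` F) (rev_arr e) = rev_arr ` (F - lft F e)"
    unfolding rgt_def lft_def region_def rev_arr_simps by blast
  have "lft (rev_arr ` F) (rev_arr e) = insert (rev_arr e) (rgt (rev_arr ` F) (rev_arr e))" by (simp
      add: lft_def rgt_def)
  also have "\<dots> = rev_arr ` (F - rgt F e)" unfolding r using assms(3) not_in_rgt[of e F] by (auto
      simp: lft_def rgt_def)
  finally show "lft (rev_arr ` F) (rev_arr e) = rev_arr ` (F - rgt F e)" .
qed

lemma noncrossing_rev_arr:
  assumes "wf_arrows F"
  shows "noncrossing (rev_arr ` F) \<longleftrightarrow> noncrossing F"
proof -
  have "crossing (rev_arr e) (rev_arr f) \<longleftrightarrow> crossing e f" if "e \<in> F" "f \<in> F"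
      for e f
    using side_rev_arr[OF wf_src_neq_tgt[OF assms that(1)]] wf_distinct[OF assms that]
    by (cases "e = f") (auto simp: crossing_def)
  then show ?thesis unfolding noncrossing_def by blast
qed

text \<open>Complementation \<open>g\<close> matches the regions and exchanges left and right, so
  all order constraints are reversed, which does not change their probability. The signs are
  kept.\<close>

lemma sterm_rev_arr:
  assumes "wf_arrows D" "F \<subseteq> D" "noncrossing F" "F \<noteq> {}"
  shows "sterm \<kappa> (\<lambda>P. I (rev_arr ` P)) (rev_arr ` D) (rev_arr ` F) = sterm \<kappa> I D F"
proof -
  define g where "g v = rev_arr ` (F - v)" for v
  have wF: "wf_arrows F" using wf_subset[OF assms(1,2)] .
  have irv: "inj_on rev_arr S" for S :: "bool arrows" using inj_rev_arr by (rule inj_on_subset) simp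
  have gi: "inj_on g (regions F)"
  proof (rule inj_onI)
    fix v w assume vw: "v \<in> regions F" "w \<in> regions F" "g v = g w"
    then have "F - v = F - w" unfolding g_def by (simp add: inj_image_eq_iff[OF inj_rev_arr])
    then show "v = w" using regions_subset[OF vw(1)] regions_subset[OF vw(2)] by blast
  qed
  have "constraint (rev_arr ` F) (rev_arr e) = map_prod g g (prod.swap (constraint F e))" if "e \<in> F" for e
    using rgt_lft_rev_arr[OF wF assms(3) that] by (simp add: constraint_def g_def)
  then have c': "constraints (rev_arr ` F) = map_prod g g ` prod.swap ` constraints F" unfolding
      constraints_def by (simp add: image_image)
  moreover have "prod.swap ` constraints F = (constraints F)\<inverse>" by (auto intro: rev_image_eqI)
  ultimately have c: "constraints (rev_arr ` F) = map_prod g g ` (constraints F)\<inverse>" by simp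
  \<comment> \<open>The complement formula holds only away from the endpoints of \<open>F\<close>,
    so the regions are compared through the constraints.\<close>
  have v: "regions (rev_arr ` F) = g ` regions F"
  proof -
    have "rev_arr ` F \<noteq> {}" "noncrossing (rev_arr ` F)" using assms noncrossing_rev_arr[OF wF] by auto
    then have "regions (rev_arr ` F) = fst ` constraints (rev_arr ` F) \<union> snd ` constraints
        (rev_arr ` F)" by (intro regions_constraints wf_rev_arr wF)
    also have "\<dots> = g ` (fst ` constraints F \<union> snd ` constraints F)"
      unfolding c' by (simp add: image_image image_Un Un_commute)
    finally show ?thesis using regions_constraints[OF wF assms(3,4)] by simp
  qed
  have "(constraints F)\<inverse> \<subseteq> regions F \<times> regions F" using constraints_subset[OF
      wF] by blast
  then have l: "linprob (regions (rev_arr ` F)) (constraints (rev_arr ` F)) = linprob (regions F)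
      (constraints F)"
    unfolding v c using linprob_map[OF gi] linprob_converse by metis
  have s: "signs (rev_arr ` F) = signs F" unfolding signs_def by (simp add: prod.reindex[OF irv])
  have pc: "piece (rev_arr ` D) (rev_arr ` F) (g v) = rev_arr ` piece D F v" if v: "v \<in> regions F" for v
  proof -
    have "region (rev_arr ` F) x = g v \<longleftrightarrow> region F x = v" if "x \<notin> endpoints F" for x
      using region_rev_arr[OF wF that] inj_onD[OF gi _ region_in_regions v] unfolding g_def by metis
    moreover have "src d \<notin> endpoints F" "tgt d \<notin> endpoints F" if "d \<in> D - F" for d
    proof -
      have "src d \<noteq> src f \<and> src d \<noteq> tgt f \<and> tgt d \<noteq> src f \<and> tgt d
          \<noteq> tgt f" if "f \<in> F" for f
        using wf_distinct[OF assms(1), of d f] \<open>d \<in> D - F\<close> that assms(2) by blast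
      then show "src d \<notin> endpoints F" "tgt d \<notin> endpoints F" unfolding endpoints_iff by blast+
    qed
    ultimately have "region (rev_arr ` F) (src d) = g v \<longleftrightarrow> region F (src d) = v"
        "region (rev_arr ` F) (tgt d) = g v \<longleftrightarrow> region F (tgt d) = v"
      if "d \<in> D - F" for d using that by blast+
    moreover have "rev_arr ` D - rev_arr ` F = rev_arr ` (D - F)" using image_set_diff[OF inj_rev_arr]
        by metis
    ultimately show ?thesis unfolding piece_def by (simp add: Compr_image_eq conj_commute cong: conj_cong)
  qed
  show ?thesis
    unfolding sterm_def state_coeff_def l s card_rev_arr unfolding v by (simp add: prod.reindex[OF gi] pc)
qed

lemma proper_sum_rev_arr:
  assumes "wf_arrows D"
  shows "proper_sum \<kappa> (\<lambda>P. I (rev_arr ` P)) (rev_arr ` D) = proper_sum \<kappa> I D"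
proof -
  have st: "pterm \<kappa> (\<lambda>P. I (rev_arr ` P)) (rev_arr ` D) (rev_arr ` F) = pterm \<kappa> I
      D F" if "F \<subseteq> D" for F
    using sterm_rev_arr[OF assms that, of \<kappa> I] noncrossing_rev_arr[OF wf_subset[OF assms that]]
        by (simp add: pterm_def)
  have "Pow (rev_arr ` D) = image rev_arr ` Pow D" by (simp add: image_Pow_surj)
  then have "proper_sum \<kappa> (\<lambda>P. I (rev_arr ` P)) (rev_arr ` D) = (\<Sum>F\<in>image
      rev_arr ` Pow D. pterm \<kappa> (\<lambda>P. I (rev_arr ` P)) (rev_arr ` D) F)"
    using proper_sum_Pow[OF wf_finite[OF wf_rev_arr[OF assms]]] by metis
  also have "\<dots> = (\<Sum>F\<in>Pow D. pterm \<kappa> (\<lambda>P. I (rev_arr ` P)) (rev_arr ` D)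
      (rev_arr ` F))"
    by (subst sum.reindex[OF inj_on_image_Pow[OF inj_on_subset[OF inj_rev_arr]]]) simp_all
  also have "\<dots> = (\<Sum>F\<in>Pow D. pterm \<kappa> I D F)" using st by (intro sum.cong) auto
  also have "\<dots> = proper_sum \<kappa> I D" using proper_sum_Pow[OF wf_finite[OF assms]] by metis
  finally show ?thesis .
qed

lemma arc_free_rev_arr [simp]: "arc_free (rev_arr ` D) Q x y \<longleftrightarrow> arc_free D Q x y"
  by (simp add: arc_free_def)

lemma homeo_rel_rev_arr:
  assumes "homeo_rel P Q" shows "homeo_rel (rev_arr ` P) (rev_arr ` Q)"
proof -
  obtain f where f: "bij_betw f (endpoints P) (endpoints Q)"
    "\<forall>x\<in>endpoints P. \<forall>y\<in>endpoints P. \<forall>w\<in>endpoints P. cbetween x y w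
        \<longleftrightarrow> cbetween (f x) (f y) (f w)"
    "Q = (\<lambda>(a, b, l). (f a, f b, l)) ` P" using assms unfolding homeo_rel_def by blast
  have "rev_arr ` Q = (\<lambda>(a, b, l). (f a, f b, l)) ` rev_arr ` P"
    unfolding f(3) image_image by (rule image_cong) (simp_all add: rev_arr_def split_beta)
  then show ?thesis unfolding homeo_rel_def endpoints_rev_arr using f(1,2) by (intro exI[of _ f] conjI)
qed

lemma move_b_rev_arr:
  assumes "move_b (\<lambda>_ _. True) P Q" shows "move_b (\<lambda>_ _. True) (rev_arr ` P) (rev_arr ` Q)"
proof -
  obtain a a' b b' l l' where m: "distinct [a, a', b, b']" "{a, a', b, b'} \<inter> endpoints P = {}"
    "arc_free P {b, b'} a a' \<or> arc_free P {b, b'} a' a" "arc_free P {a, a'} b b' \<or> arc_free P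
        {a, a'} b' b"
    "Q = P \<union> {(a, b, l), (b', a', l')}" using assms unfolding move_b_def by blast
  have "rev_arr ` Q = rev_arr ` P \<union> {(b, a, l), (a', b', l')}" unfolding m(5) image_Un by simp
  then show ?thesis using move_bI[of b b' a a' "rev_arr ` P"] m by auto
qed

text \<open>The reverse of \<open>(ap, b)\<close> is \<open>(b, ap)\<close>, which has the shape of
  an arrow after the move, so reversal runs move (c) backwards.\<close>

lemma move_c_rev_arr:
  assumes "move_c (\<lambda>_ _ _. True) P Q" shows "move_c (\<lambda>_ _ _. True) (rev_arr ` Q)
      (rev_arr ` P)"
proof -
  obtain E a ap b bp c cp l1 l2 l3 where m: "distinct [a, ap, b, bp, c, cp]" "{a, ap, b, bp, c, cp}
      \<inter> endpoints E = {}"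
     "P = E \<union> {(ap, b, l1), (bp, c, l2), (cp, a, l3)}" "Q = E \<union> {(a, bp, l1), (b, cp, l2),
         (c, ap, l3)}"
     "arc_free P {} a ap" "arc_free P {} b bp" "arc_free P {} c cp" using assms unfolding move_c_def by blast
  have e: "endpoints Q = endpoints P" unfolding m(3,4) by auto
  have "arc_free Q {} x y = arc_free P {} x y" for x y unfolding arc_free_def e ..
  then have af: "arc_free (rev_arr ` Q) {} a ap" "arc_free (rev_arr ` Q) {} b bp" "arc_free (rev_arr `
      Q) {} c cp" using m(5-7) by simp_all
  have s: "rev_arr ` Q = rev_arr ` E \<union> {(bp, a, l1), (ap, c, l3), (cp, b, l2)}" "rev_arr ` P =
      rev_arr ` E \<union> {(b, ap, l1), (a, cp, l3), (c, bp, l2)}"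
    unfolding m(3,4) image_Un by auto
  show ?thesis unfolding s(2)
    by (rule move_cI[where Pc = "\<lambda>_ _ _. True", OF _ _ TrueI s(1) af(2,1,3)]) (use m(1,2) in auto)
qed

section \<open>Move (c) in both cyclic orders\<close>

lemma tri_order_of_free:
  assumes "distinct [a, ap, b, bp, c, cp]" "cbetween a b c"
    "\<not> cbetween a b ap" "\<not> cbetween a bp ap" "\<not> cbetween a c ap" "\<not> cbetween a cp ap"
    "\<not> cbetween b a bp" "\<not> cbetween b ap bp" "\<not> cbetween b c bp" "\<not> cbetween b cp bp"
    "\<not> cbetween c a cp" "\<not> cbetween c ap cp" "\<not> cbetween c b cp" "\<not> cbetween c bp cp"
  shows "cbetween a ap b \<and> cbetween a b bp \<and> cbetween a bp c \<and> cbetween a c cp"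
  using assms unfolding cbetween_def distinct.simps list.set insert_iff empty_iff by argo

lemma triI:
  assumes "distinct [a, ap, b, bp, c, cp]" "{a, ap, b, bp, c, cp} \<inter> endpoints E = {}" "cbetween a b c"
    "\<forall>p\<in>endpoints E \<union> {a, ap, b, bp, c, cp}. \<not> cbetween a p ap \<and> \<not>
        cbetween b p bp \<and> \<not> cbetween c p cp"
  shows "tri E a ap b bp c cp"
  unfolding tri_def using assms(1,2,4) tri_order_of_free[OF assms(1,3)] by auto

context invariant_below
begin

text \<open>The assumptions are closed under reversal: it exchanges the two kinds of kink, preserves
  move (b) and inverts move (c).\<close>

lemma invariant_below_rev_arr: "invariant_below \<kappa> (\<lambda>P. I (rev_arr ` P)) M"
proof
  show "ring_homo \<kappa>" by (rule \<kappa>)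
  show "I (rev_arr ` {}) = 0" using I0 by simp
  show "I (rev_arr ` P) = I (rev_arr ` Q)" if "wf_arrows P" "wf_arrows Q" "homeo_rel P Q" "card P < M"
      "card Q < M" for P Q
    using that by (intro homeo wf_rev_arr homeo_rel_rev_arr) auto
  show "I (rev_arr ` P) = I (rev_arr ` Q)" if "wf_arrows P" "wf_arrows Q" "move_b (\<lambda>_ _. True) P
      Q" "card P < M" "card Q < M" for P Q
    using that by (intro moveb wf_rev_arr move_b_rev_arr) auto
  show "I (rev_arr ` P) = I (rev_arr ` Q)" if "wf_arrows P" "wf_arrows Q" "move_c (\<lambda>_ _ _. True)
      P Q" "card P < M" "card Q < M" for P Q
    using that by (intro movec[symmetric] wf_rev_arr move_c_rev_arr) auto
  show "I (rev_arr ` insert (a, b, l) P) = I (rev_arr ` P)" if "wf_arrows (insert (a, b, l) P)" "a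
      \<notin> endpoints P" "b \<notin> endpoints P"
      "arc_free P {} a b \<or> arc_free P {} b a" "card (insert (a, b, l) P) < M" for P a b l
  proof -
    have "card (insert (b, a, l) (rev_arr ` P)) < M" using card_rev_arr[of "insert (a, b, l) P"] that(5)
        by simp
    moreover have "wf_arrows (insert (b, a, l) (rev_arr ` P))" using wf_rev_arr[OF that(1)] by simp
    ultimately show ?thesis using that(2-4) by (simp, intro kink) auto
  qed
qed

text \<open>The two cyclic orders of \<open>a\<close>, \<open>b\<close>, \<open>c\<close> give
  triangles of different shape. The order not covered by \<open>tri\<close> is brought to it by
  reversing all arrows.\<close>

lemma proper_sum_movec:
  assumes "wf_arrows D" "wf_arrows D'" "move_c ad_c D D'" "card D \<le> M" "card D' \<le> M"
  shows "ps D' = ps D"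
proof -
  obtain E a ap b bp c cp l1 l2 l3 where d: "distinct [a, ap, b, bp, c, cp]" and new: "{a, ap, b, bp, c,
      cp} \<inter> endpoints E = {}"
    and D: "D = E \<union> {(ap, b, l1), (bp, c, l2), (cp, a, l3)}" and D': "D' = E \<union> {(a, bp,
        l1), (b, cp, l2), (c, ap, l3)}"
    and af: "arc_free D {} a ap" "arc_free D {} b bp" "arc_free D {} c cp" and l: "l1" "l2" "\<not> l3"
    using assms(3) unfolding move_c_def ad_c_def by blast
  have "endpoints D = endpoints E \<union> {a, ap, b, bp, c, cp}" unfolding D by auto
  then have fr: "\<forall>p\<in>endpoints E \<union> {a, ap, b, bp, c, cp}. \<not> cbetween a p ap
      \<and> \<not> cbetween b p bp \<and> \<not> cbetween c p cp"
    using af unfolding arc_free_def by blast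
  show ?thesis
  proof (cases "cbetween a b c")
    case True
    interpret triangle \<kappa> I M E a ap b bp c cp l1 l2 l3 "(ap, b, l1)" "(bp, c, l2)" "(cp, a, l3)"
        "(a, bp, l1)" "(b, cp, l2)" "(c, ap, l3)" D D'
      by unfold_locales (use triI[OF d new True fr] D D' assms in auto)
    show ?thesis by (rule proper_sum_triangle[OF l])
  next
    case False
    then have cba: "cbetween c b a" using cbetween_total[of c a b] d by auto
    \<comment> \<open>After reversal the names \<open>a\<close> and \<open>c\<close> change places;
      the first two signs are exchanged, the minus sign stays last, and the move leads from
      \<open>D'\<close> to \<open>D\<close>.\<close>
    have d': "distinct [c, cp, b, bp, a, ap]" using d by auto
    have new': "{c, cp, b, bp, a, ap} \<inter> endpoints (rev_arr ` E) = {}" using new by auto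
    have fr': "\<forall>p\<in>endpoints (rev_arr ` E) \<union> {c, cp, b, bp, a, ap}. \<not> cbetween c
        p cp \<and> \<not> cbetween b p bp \<and> \<not> cbetween a p ap"
      using fr by auto
    have t: "tri (rev_arr ` E) c cp b bp a ap" by (rule triI[OF d' new' cba fr'])
    have rD: "rev_arr ` D = rev_arr ` E \<union> {(c, bp, l2), (b, ap, l1), (a, cp, l3)}" "rev_arr ` D'
        = rev_arr ` E \<union> {(cp, b, l2), (bp, a, l1), (ap, c, l3)}"
      unfolding D D' image_Un by auto
    have w: "wf_arrows (rev_arr ` D')" "wf_arrows (rev_arr ` D)" "card (rev_arr ` D') \<le> M" using
        assms wf_rev_arr[of D] wf_rev_arr[of D'] by simp_all
    interpret rev_arr: invariant_below \<kappa> "\<lambda>P. I (rev_arr ` P)" M by (rule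
        invariant_below_rev_arr)
    interpret triangle \<kappa> "\<lambda>P. I (rev_arr ` P)" M "rev_arr ` E" c cp b bp a ap l2 l1 l3
        "(cp, b, l2)" "(bp, a, l1)" "(ap, c, l3)"
        "(c, bp, l2)" "(b, ap, l1)" "(a, cp, l3)" "rev_arr ` D'" "rev_arr ` D"
      by unfold_locales (rule t refl rD w)+
    show ?thesis using proper_sum_triangle[OF l(2,1,3)] proper_sum_rev_arr[OF assms(1), of \<kappa> I]
        proper_sum_rev_arr[OF assms(2), of \<kappa> I] by simp
  qed
qed

end

subsection \<open>The skein relation\<close>

lemma far_side:
  assumes "c \<noteq> a" "c \<noteq> b" "d \<noteq> a" "d \<noteq> b"
  shows "\<not> cbetween a c b \<Longrightarrow> \<not> cbetween a d b \<Longrightarrow> cbetween a x b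
      \<Longrightarrow> cbetween c x d \<longleftrightarrow> cbetween c a d"
    "cbetween a c b \<Longrightarrow> cbetween a d b \<Longrightarrow> \<not> cbetween a x b
        \<Longrightarrow> cbetween c x d \<longleftrightarrow> cbetween c a d"
  using assms unfolding cbetween_def by argo+

text \<open>\<open>D1\<close> and \<open>D2\<close> are the diagrams \<open>D'_e\<close> and
  \<open>D''_e\<close> of the skein relation; the arrows crossing \<open>e\<close> are in
  neither.\<close>

locale skein_cut =
  fixes D :: "bool arrows" and e :: "real \<times> real \<times> bool" and D1 D2 :: "bool arrows" and E
  assumes wfD: "wf_arrows D" and eD: "e \<in> D"
    and E_def: "E = D - {e}"
    and D1_def: "D1 = remove_arc (tgt e) (src e) D"
    and D2_def: "D2 = remove_arc (src e) (tgt e) D"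
begin

lemma ne: "src e \<noteq> tgt e" using wf_src_neq_tgt[OF wfD eD] .

lemma E_ends: "d \<in> E \<Longrightarrow> src d \<noteq> src e" "d \<in> E \<Longrightarrow> src d
    \<noteq> tgt e" "d \<in> E \<Longrightarrow> tgt d \<noteq> src e" "d \<in> E \<Longrightarrow> tgt
    d \<noteq> tgt e"
  using wf_distinct[OF wfD _ eD, of d] by (simp_all add: E_def)

lemma D1: "D1 = {d \<in> E. side e (src d) \<and> side e (tgt d)}"
proof -
  have "d \<in> D1 \<longleftrightarrow> d \<in> {d \<in> E. side e (src d) \<and> side e (tgt d)}" for d
  proof (cases "d = e")
    case True
    then show ?thesis by (simp add: D1_def remove_arc_def on_arc_def E_def)
  next
    case False
    then show ?thesis using E_ends[of d] ne cbetween_total[of "src e" "tgt e" "src d"] cbetween_total[of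
        "src e" "tgt e" "tgt d"]
      by (auto simp: D1_def remove_arc_def on_arc_def E_def side_def)
  qed
  then show ?thesis by blast
qed

lemma D2: "D2 = {d \<in> E. \<not> side e (src d) \<and> \<not> side e (tgt d)}"
proof -
  have "d \<in> D2 \<longleftrightarrow> d \<in> {d \<in> E. \<not> side e (src d) \<and> \<not> side e
      (tgt d)}" for d
  proof (cases "d = e")
    case True
    then show ?thesis by (simp add: D2_def remove_arc_def on_arc_def E_def)
  next
    case False
    then show ?thesis using E_ends[of d]
      by (auto simp: D2_def remove_arc_def on_arc_def E_def side_def)
  qed
  then show ?thesis by blast
qed

lemma D12: "D1 \<inter> D2 = {}" "D1 \<subseteq> E" "D2 \<subseteq> E" "e \<notin> D1" "e \<notin> D2"
    "e \<notin> E"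
  unfolding D1 D2 E_def by blast+

lemma wfE: "wf_arrows E" using wf_subset[OF wfD] E_def by blast
lemma wf12: "wf_arrows D1" "wf_arrows D2" using wf_subset[OF wfE] D12 by blast+

lemma far1: "f \<in> D1 \<Longrightarrow> \<not> side e x \<Longrightarrow> side f x
    \<longleftrightarrow> side f (src e)"
  using far_side(2)[of "src f" "src e" "tgt e" "tgt f" x] E_ends[of f] unfolding D1 by (simp add: side_def)

lemma far2: "f \<in> D2 \<Longrightarrow> side e x \<Longrightarrow> side f x \<longleftrightarrow> side
    f (src e)"
  using far_side(1)[of "src f" "src e" "tgt e" "tgt f" x] E_ends[of f] unfolding D2 by (simp add: side_def)

text \<open>A chord not crossing \<open>e\<close> lies on one side of it, and chords on different
  sides of \<open>e\<close> never cross each other.\<close>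

lemma noncrossing_cut:
  assumes "F \<subseteq> E"
  shows "noncrossing (insert e F) \<longleftrightarrow> F \<subseteq> D1 \<union> D2 \<and> noncrossing
      (F \<inter> D1) \<and> noncrossing (F \<inter> D2)"
proof -
  have "insert e F \<subseteq> D" using assms eD E_def by blast
  then have w: "wf_arrows (insert e F)" by (rule wf_subset[OF wfD])
  have 1: "noncrossing (insert e F) \<longleftrightarrow> noncrossing F \<and> (\<forall>f\<in>F. \<not>
      crossing e f)"
    using noncrossing_insert[OF w] crossing_sym[OF w] by blast
  have "f \<in> D1 \<union> D2 \<longleftrightarrow> \<not> crossing e f" if "f \<in> F" for f
    using that assms unfolding D1 D2 crossing_def by blast
  then have 2: "(\<forall>f\<in>F. \<not> crossing e f) \<longleftrightarrow> F \<subseteq> D1 \<union>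
      D2" by blast
  have "\<not> crossing f g" "\<not> crossing g f" if "f \<in> D1" "g \<in> D2" for f g
    unfolding crossing_def using that far1[OF that(1)] far2[OF that(2)] unfolding D1 D2 by blast+
  then have 3: "noncrossing F \<longleftrightarrow> noncrossing (F \<inter> D1) \<and> noncrossing (F
      \<inter> D2)" if "F \<subseteq> D1 \<union> D2"
    using that unfolding noncrossing_def by blast
  show ?thesis using 1 2 3 by blast
qed

text \<open>Without the constraint at \<open>e\<close> the tree falls into the trees of
  \<open>F1\<close> and \<open>F2\<close>, whose constraints involve disjoint sets of circles.
  Probabilities, signs and pieces then factor, and \<open>card G\<close> exceeds
  \<open>card F1 + card F2\<close> by one, which leaves the factor \<open>zvar\<close>.\<close>

lemma cut_state:
  assumes F1: "F1 \<in> states D1" and F2: "F2 \<in> states D2" and G: "G = insert e (F1 \<union> F2)"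
      and \<kappa>: "ring_homo \<kappa>"
  shows "\<kappa> (zvar ^ card G * [: linprob (regions G) (constraint G ` (F1 \<union> F2)) * signs (F1
      \<union> F2) :]) * (\<Prod>v\<in>regions G. I (piece E G v))
    = \<kappa> zvar * sterm \<kappa> I D1 F1 * sterm \<kappa> I D2 F2"
proof -
  have s1: "F1 \<subseteq> D1" "noncrossing F1" and s2: "F2 \<subseteq> D2" "noncrossing F2" using F1 F2
      by (auto simp: states_def)
  have w: "wf_arrows F1" "wf_arrows F2" using wf_subset[OF wf12(1) s1(1)] wf_subset[OF wf12(2) s2(1)] by auto
  have fin: "finite F1" "finite F2" using w wf_finite by auto
  have GD: "G \<subseteq> D" using s1 s2 D12 eD E_def G by blast
  have wG: "wf_arrows G" using wf_subset[OF wfD GD] .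
  have n: "e \<notin> F1" "e \<notin> F2" "F1 \<inter> F2 = {}" using s1 s2 D12 by blast+
  \<comment> \<open>\<open>K1\<close> is the circle of \<open>F1\<close> that contains the whole
    right of \<open>e\<close>, and \<open>K2\<close> the circle of \<open>F2\<close> that contains
    its left. So in \<open>G\<close> a circle left of \<open>e\<close> has the
    \<open>F2\<close>-part \<open>K2\<close>, and one right of \<open>e\<close> has the
    \<open>F1\<close>-part \<open>K1\<close>.\<close>
  define K1 K2 where "K1 = region F1 (src e)" and "K2 = region F2 (src e)"
  have K: "K1 \<subseteq> F1" "K2 \<subseteq> F2" using region_subset K1_def K2_def by blast+
  define \<alpha> \<beta> where "\<alpha> w = insert e (w \<union> K2)" and "\<beta> w = w \<union> K1" for w
  have p1: "region G x = \<alpha> (region F1 x)" if "side e x" for x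
  proof -
    have "region F2 x = K2" unfolding K2_def region_eq_iff using far2 s2(1) that by blast
    then show ?thesis using that by (simp add: G region_insert region_Un \<alpha>_def)
  qed
  have k1: "region F1 x = K1" if "\<not> side e x" for x unfolding K1_def region_eq_iff using far1 s1(1)
      that by blast
  have k2: "region F2 x = K2" if "side e x" for x unfolding K2_def region_eq_iff using far2 s2(1) that
      by blast
  have p2: "region G x = \<beta> (region F2 x)" if "\<not> side e x" for x
    using that k1[OF that] by (simp add: G region_insert region_Un \<beta>_def Un_commute)
  have pe: "region G (src e) = K1 \<union> K2" by (simp add: G region_insert region_Un K1_def K2_def)
  have ra: "\<alpha> v \<inter> F1 = v" if "v \<subseteq> F1" for v
    using that n K unfolding \<alpha>_def by blast
  have rb: "\<beta> v \<inter> F2 = v" if "v \<subseteq> F2" for v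
    using that n K unfolding \<beta>_def by blast
  have ia: "\<alpha> v = \<alpha> w \<longleftrightarrow> v = w" if "v \<subseteq> F1" "w \<subseteq>
      F1" for v w
    using ra[OF that(1)] ra[OF that(2)] by metis
  have ib: "\<beta> v = \<beta> w \<longleftrightarrow> v = w" if "v \<subseteq> F2" "w \<subseteq> F2"
      for v w
    using rb[OF that(1)] rb[OF that(2)] by metis
  have inj: "inj_on \<alpha> (regions F1)" "inj_on \<beta> (regions F2)"
    by (rule inj_onI, use ia ib regions_subset in metis)+
  have nb: "e \<notin> \<beta> w" if "w \<subseteq> F2" for w using that n K unfolding \<beta>_def by blast
  have disj: "\<alpha> ` regions F1 \<inter> \<beta> ` regions F2 = {}"
    using nb regions_subset unfolding \<alpha>_def by blast
  have vG: "regions G = \<alpha> ` regions F1 \<union> \<beta> ` regions F2"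
  proof (intro equalityI subsetI)
    fix v assume "v \<in> regions G"
    then obtain x where "v = region G x" unfolding regions_def by blast
    then show "v \<in> \<alpha> ` regions F1 \<union> \<beta> ` regions F2" using p1 p2 by (cases "side
        e x") auto
  next
    fix v assume "v \<in> \<alpha> ` regions F1 \<union> \<beta> ` regions F2"
    then consider x where "v = \<alpha> (region F1 x)" | x where "v = \<beta> (region F2 x)" unfolding
        regions_def by blast
    then show "v \<in> regions G"
    proof cases
      case 1
      show ?thesis
      proof (cases "side e x")
        case True
        then show ?thesis using 1 p1 region_in_regions by metis
      next
        case False
        \<comment> \<open>A point right of \<open>e\<close> lies in the circle \<open>K1\<close> of
          \<open>F1\<close>, whose counterpart in \<open>G\<close> is the circle immediately left of
          \<open>e\<close>.\<close>
        then have "v = lft G e" using 1 k1 pe by (simp add: \<alpha>_def lft_def)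
        then show ?thesis using lft_in_regions[OF wG, of e] G by blast
      qed
    next
      case 2
      show ?thesis
      proof (cases "side e x")
        case True
        then have "v = rgt G e" using 2 k2 pe by (simp add: \<beta>_def rgt_def Un_commute)
        then show ?thesis by simp
      next
        case False
        then show ?thesis using 2 p2 region_in_regions by metis
      qed
    qed
  qed
  have c1: "constraint G f = map_prod \<alpha> \<alpha> (constraint F1 f)" if "f \<in> F1" for f
  proof -
    have "side e (src f)" using that s1(1) unfolding D1 by blast
    then have "rgt G f = \<alpha> (rgt F1 f)" "lft G f = \<alpha> (lft F1 f)"
      using p1 by (auto simp: rgt_def lft_def \<alpha>_def)
    then show ?thesis by (simp add: constraint_def)
  qed
  have c2: "constraint G f = map_prod \<beta> \<beta> (constraint F2 f)" if "f \<in> F2" for f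
  proof -
    have "\<not> side e (src f)" using that s2(1) unfolding D2 by blast
    then have "rgt G f = \<beta> (rgt F2 f)" "lft G f = \<beta> (lft F2 f)"
      using p2 by (auto simp: rgt_def lft_def \<beta>_def)
    then show ?thesis by (simp add: constraint_def)
  qed
  have cG: "constraint G ` (F1 \<union> F2) = map_prod \<alpha> \<alpha> ` constraints F1 \<union>
      map_prod \<beta> \<beta> ` constraints F2"
    unfolding image_Un constraints_def using c1 c2 by (simp add: image_image)
  have sub: "map_prod \<alpha> \<alpha> ` constraints F1 \<subseteq> \<alpha> ` regions F1 \<times>
      \<alpha> ` regions F1" "map_prod \<beta> \<beta> ` constraints F2 \<subseteq> \<beta> ` regions F2
      \<times> \<beta> ` regions F2"
    using image_mono[OF constraints_subset[OF w(1)], of "map_prod \<alpha> \<alpha>"] image_mono[OF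
        constraints_subset[OF w(2)], of "map_prod \<beta> \<beta>"]
    by (simp_all add: map_prod_surj_on)
  have lp: "linprob (regions G) (constraint G ` (F1 \<union> F2)) = linprob (regions F1) (constraints
      F1) * linprob (regions F2) (constraints F2)"
    unfolding vG cG
    using linprob_Un[OF _ _ disj sub] finite_regions[OF fin(1)] finite_regions[OF fin(2)]
      linprob_map[OF inj(1) constraints_subset[OF w(1)]] linprob_map[OF inj(2) constraints_subset[OF
          w(2)]] by simp
  have q1: "piece E G (\<alpha> v) = piece D1 F1 v" if v: "v \<in> regions F1" for v
  proof -
    have iff: "region G x = \<alpha> v \<longleftrightarrow> side e x \<and> region F1 x = v" for x
    proof (cases "side e x")
      case True
      then show ?thesis using p1 ia[OF region_subset regions_subset[OF v]] by simp
    next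
      case False
      have "e \<in> \<alpha> v" by (simp add: \<alpha>_def)
      then have "\<beta> (region F2 x) \<noteq> \<alpha> v" using nb[OF region_subset] by metis
      then show ?thesis using p2[OF False] False by simp
    qed
    show ?thesis unfolding piece_def iff using G D12 s1(1) s2(1) unfolding D1 D2 by blast
  qed
  have q2: "piece E G (\<beta> v) = piece D2 F2 v" if v: "v \<in> regions F2" for v
  proof -
    have iff: "region G x = \<beta> v \<longleftrightarrow> \<not> side e x \<and> region F2 x = v" for x
    proof (cases "side e x")
      case True
      have "e \<in> \<alpha> (region F1 x)" by (simp add: \<alpha>_def)
      then have "\<alpha> (region F1 x) \<noteq> \<beta> v" using nb[OF regions_subset[OF v]] by metis
      then show ?thesis using p1[OF True] True by simp
    next
      case False
      then show ?thesis using p2 ib[OF region_subset regions_subset[OF v]] by simp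
    qed
    show ?thesis unfolding piece_def iff using G D12 s1(1) s2(1) unfolding D1 D2 by blast
  qed
  have pr: "(\<Prod>v\<in>regions G. I (piece E G v)) = (\<Prod>v\<in>regions F1. I (piece D1 F1 v)) *
      (\<Prod>v\<in>regions F2. I (piece D2 F2 v))"
    unfolding vG using disj finite_regions[OF fin(1)] finite_regions[OF fin(2)]
    by (simp add: prod.union_disjoint prod.reindex[OF inj(1)] prod.reindex[OF inj(2)] q1 q2)
  have cd: "card G = Suc (card F1 + card F2)" using n fin by (simp add: G card_Un_disjoint)
  have sg: "signs (F1 \<union> F2) = signs F1 * signs F2" using n fin by (simp add: signs_def
      prod.union_disjoint)
  have "zvar ^ card G * [: linprob (regions G) (constraint G ` (F1 \<union> F2)) * signs (F1 \<union>
      F2) :] = zvar * (state_coeff F1 * state_coeff F2)"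
    by (simp add: lp cd sg state_coeff_def power_add mult_ac)
  then show ?thesis unfolding pr sterm_def by (simp add: ring_homoD(2)[OF \<kappa>] mult_ac)
qed

text \<open>Changing the sign of \<open>e\<close> reverses both its constraint and the sign product.
  The difference of the two terms therefore adds the probabilities of the two constraints, and
  \<open>linprob_split\<close> removes the constraint at \<open>e\<close>.\<close>

lemma flip_state:
  assumes F: "F \<subseteq> E" and nc: "noncrossing (insert e F)" and e: "lab e" and \<kappa>:
      "ring_homo \<kappa>"
    and e': "e' = (src e, tgt e, False)"
    and G: "G = insert e F"
  shows "sterm \<kappa> I D G - sterm \<kappa> I (insert e' E) (insert e' F) =
    \<kappa> (zvar ^ card G * [: linprob (regions G) (constraint G ` F) * signs F :]) *
        (\<Prod>v\<in>regions G. I (piece E G v))"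
proof -
  let ?G' = "insert e' F"
  have GD: "G \<subseteq> D" using F eD E_def G by blast
  have wG: "wf_arrows G" using wf_subset[OF wfD GD] .
  have fin: "finite F" using wf_finite[OF wG] G by simp
  have "src e \<notin> endpoints E" unfolding endpoints_iff using E_ends by metis
  then have e'E: "e' \<notin> E" using endpointsI(1)[of e' E] e' by auto
  have ee: "e \<noteq> e'" using e e' by (metis snd_conv)
  have n: "e \<notin> F" "e' \<notin> F" using F D12 e'E by auto
  have es: "src e' = src e" "tgt e' = tgt e" "lab e' = False" "side e' x = side e x" for x by (simp_all
      add: e' side_def)
  define g where "g v = (if e \<in> v then insert e' (v - {e}) else v)" for v
  have gp: "region ?G' x = g (region G x)" for x
  proof -
    have "e \<notin> region F x" using n region_subset by blast
    then show ?thesis by (simp add: G region_insert g_def es)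
  qed
  have gi: "inj_on g (regions G)"
  proof (rule inj_onI)
    fix v w assume vw: "v \<in> regions G" "w \<in> regions G" "g v = g w"
    then have "e' \<notin> v" "e' \<notin> w" using n ee regions_subset G by blast+
    then show "v = w" using vw(3) unfolding g_def by (auto split: if_splits)
  qed
  have vG: "regions ?G' = g ` regions G" unfolding regions_def image_image using gp by simp
  have "constraint ?G' f = map_prod g g (constraint G f)" if "f \<in> F" for f
  proof -
    have "f \<noteq> e" "f \<noteq> e'" using that n by auto
    then have "g (rgt G f) = rgt ?G' f" "g (lft G f) = lft ?G' f"
      using gp by (auto simp: rgt_def lft_def g_def)
    then show ?thesis by (simp add: constraint_def)
  qed
  then have cF: "constraint ?G' ` F = map_prod g g ` constraint G ` F" by (simp add: image_image)
  have "e \<notin> region G (src e)" by (simp add: region_def)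
  then have "g (rgt G e) = rgt ?G' e'" "g (lft G e) = lft ?G' e'"
    using gp by (auto simp: rgt_def lft_def g_def es)
  then have "constraint ?G' e' = map_prod g g (rgt G e, lft G e)" by (simp add: constraint_def es)
  then have cG': "constraints ?G' = map_prod g g ` (insert (rgt G e, lft G e) (constraint G ` F))"
    unfolding constraints_def image_insert cF by simp
  have cG: "constraints G = insert (lft G e, rgt G e) (constraint G ` F)"
    unfolding constraints_def using e by (simp add: G constraint_def)
  have lv: "lft G e \<in> regions G" using lft_in_regions[OF wG] G by blast
  have sub: "insert (rgt G e, lft G e) (constraint G ` F) \<subseteq> regions G \<times> regions G"
    using constraints_subset[OF wG] lv unfolding cG by auto
  have L: "linprob (regions ?G') (constraints ?G') = linprob (regions G) (insert (rgt G e, lft G e)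
      (constraint G ` F))"
    unfolding vG cG' by (rule linprob_map[OF gi sub])
  have LL: "linprob (regions G) (constraints G) + linprob (regions ?G') (constraints ?G') = linprob
      (regions G) (constraint G ` F)"
    unfolding L cG using lv wf_finite[OF wG] by (intro linprob_split finite_regions) simp_all
  have pc: "piece (insert e' E) ?G' (g v) = piece E G v" if v: "v \<in> regions G" for v
  proof -
    have "piece (insert e' E) ?G' (g v) = piece E ?G' (g v)" unfolding piece_def by blast
    also have "\<dots> = piece E G v"
      by (rule piece_transfer[OF gp _ region_in_regions gi v]) (use D12 e'E G in auto)
    finally show ?thesis .
  qed
  have pc': "piece D G v = piece E G v" for v
    unfolding piece_def E_def G by blast
  have cd: "card ?G' = card G" using n fin by (simp add: G)
  have sg: "signs G = signs F" "signs ?G' = - signs F" using n fin e by (simp_all add: G signs_insert es)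
  let ?Q = "(\<Prod>v\<in>regions G. I (piece E G v))" and ?z = "zvar ^ card G"
  have 1: "sterm \<kappa> I D G = \<kappa> (?z * [: linprob (regions G) (constraints G) * signs F :]) * ?Q"
    by (simp add: sterm_def state_coeff_def sg pc')
  have 2: "sterm \<kappa> I (insert e' E) ?G' = \<kappa> (?z * [: linprob (regions ?G') (constraints
      ?G') * - signs F :]) * ?Q"
    unfolding sterm_def state_coeff_def sg cd unfolding vG by (simp add: prod.reindex[OF gi] pc)
  have "?z * [: linprob (regions G) (constraints G) * signs F :] - ?z * [: linprob (regions ?G')
      (constraints ?G') * - signs F :] =
     ?z * [: linprob (regions G) (constraints G) * signs F - linprob (regions ?G') (constraints ?G') * -
         signs F :]"
    by (simp only: right_diff_distrib[symmetric] diff_pCons diff_0_right)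
  also have "linprob (regions G) (constraints G) * signs F - linprob (regions ?G') (constraints ?G') * -
      signs F = linprob (regions G) (constraint G ` F) * signs F"
    unfolding LL[symmetric] by (simp add: algebra_simps)
  finally show ?thesis unfolding 1 2 left_diff_distrib[symmetric] ring_homoD(6)[OF \<kappa>, symmetric]
      by simp
qed

text \<open>States without \<open>e\<close> agree, and those with \<open>e\<close> are paired by
  \<open>flip_state\<close>. The surplus runs over all pairs of states of \<open>D1\<close> and
  \<open>D2\<close>, empty ones included, hence the full state sums. Sign independence
  \<open>flip\<close> is assumed only for proper subsets of \<open>E\<close>, so that
  \<open>psi_flip\<close> can supply it by induction.\<close>

lemma proper_sum_skein:
  assumes e: "lab e" and \<kappa>: "ring_homo \<kappa>" and e': "e' = (src e, tgt e, False)"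
    and flip: "\<And>P. P \<subset> E \<Longrightarrow> I (insert e P) = I (insert e' P)"
  shows "proper_sum \<kappa> I D = proper_sum \<kappa> I (insert e' E) + \<kappa> zvar * state_sum
      \<kappa> I D1 * state_sum \<kappa> I D2"
proof -
  have DE: "D = insert e E" using eD E_def by blast
  have fin: "finite E" "finite D1" "finite D2" using wf_finite wfE wf12 by auto
  have "src e \<notin> endpoints E" unfolding endpoints_iff using E_ends by metis
  then have e'E: "e' \<notin> E" using endpointsI(1)[of e' E] e' by auto
  have es: "src e' = src e" "tgt e' = tgt e" "lab e' = False" by (simp_all add: e')
  have 0: "pterm \<kappa> I D F = pterm \<kappa> I (insert e' E) F" if F: "F \<subseteq> E" for F
  proof (cases "F = {}")
    case False
    have n: "e \<notin> F" "e' \<notin> F" using F D12 e'E by auto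
    have "piece E F v \<subset> E" for v using False F unfolding piece_def by blast
    then have "I (piece D F v) = I (piece (insert e' E) F v)" for v
      unfolding DE piece_insert[OF n(1)] piece_insert[OF n(2)] es using flip by simp
    then show ?thesis using sterm_cong[of F I D "insert e' E"] by (simp add: pterm_def)
  qed (simp add: pterm_def)
  define T where "T F = \<kappa> (zvar ^ card (insert e F) * [: linprob (regions (insert e F))
      (constraint (insert e F) ` F) * signs F :])
      * (\<Prod>v\<in>regions (insert e F). I (piece E (insert e F) v))" for F
  have ncs: "noncrossing (insert e' F) \<longleftrightarrow> noncrossing (insert e F)" if "F \<subseteq>
      E" for F
  proof -
    have "crossing e' f = crossing e f" "crossing f e' = crossing f e" for f by (simp_all add:
        crossing_def side_def e')
    then show ?thesis by (auto simp: noncrossing_def)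
  qed
  have 1: "pterm \<kappa> I D (insert e F) = pterm \<kappa> I (insert e' E) (insert e' F) + (if
      noncrossing (insert e F) then T F else 0)"
    if F: "F \<subseteq> E" for F
    using flip_state[OF F _ e \<kappa> e' refl, of I] ncs[OF F] by (auto simp: pterm_def T_def algebra_simps)
  have "proper_sum \<kappa> I D = (\<Sum>F\<in>Pow E. pterm \<kappa> I D F + pterm \<kappa> I D (insert e F))"
    unfolding proper_sum_Pow[OF wf_finite[OF wfD]] using sum_Pow_insert[OF fin(1) D12(6)] DE by metis
  also have "\<dots> = (\<Sum>F\<in>Pow E. (pterm \<kappa> I (insert e' E) F + pterm \<kappa> I (insert
      e' E) (insert e' F)) + (if noncrossing (insert e F) then T F else 0))"
    using 0 1 by (intro sum.cong) (auto simp: algebra_simps)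
  also have "\<dots> = proper_sum \<kappa> I (insert e' E) + (\<Sum>F\<in>Pow E. if noncrossing (insert
      e F) then T F else 0)"
    using fin(1) by (simp add: proper_sum_Pow sum_Pow_insert[OF fin(1) e'E] sum.distrib)
  also have "(\<Sum>F\<in>Pow E. if noncrossing (insert e F) then T F else 0) = (\<Sum>F\<in>{F \<in>
      Pow E. noncrossing (insert e F)}. T F)"
    by (rule sum.inter_filter[symmetric]) (simp add: fin)
  also have "{F \<in> Pow E. noncrossing (insert e F)} = (\<lambda>(F1, F2). F1 \<union> F2) ` (states
      D1 \<times> states D2)"
  proof (intro equalityI subsetI)
    fix F assume "F \<in> {F \<in> Pow E. noncrossing (insert e F)}"
    then have "F \<subseteq> D1 \<union> D2" "F \<inter> D1 \<in> states D1" "F \<inter> D2 \<in> states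
        D2" using noncrossing_cut[of F] by (auto simp: states_def)
    moreover from this have "F = F \<inter> D1 \<union> F \<inter> D2" by blast
    ultimately show "F \<in> (\<lambda>(F1, F2). F1 \<union> F2) ` (states D1 \<times> states D2)"
      by (intro image_eqI[of _ _ "(F \<inter> D1, F \<inter> D2)"]) simp_all
  next
    fix F assume "F \<in> (\<lambda>(F1, F2). F1 \<union> F2) ` (states D1 \<times> states D2)"
    then obtain F1 F2 where F: "F = F1 \<union> F2" "F1 \<subseteq> D1" "F2 \<subseteq> D2" "noncrossing
        F1" "noncrossing F2" by (auto simp: states_def)
    then have "F \<inter> D1 = F1" "F \<inter> D2 = F2" "F \<subseteq> E" using D12 by blast+
    then show "F \<in> {F \<in> Pow E. noncrossing (insert e F)}" using noncrossing_cut[of F] F by blast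
  qed
  also have "(\<Sum>F\<in>(\<lambda>(F1, F2). F1 \<union> F2) ` (states D1 \<times> states D2). T F) =
      (\<Sum>(F1, F2)\<in>states D1 \<times> states D2. T (F1 \<union> F2))"
  proof (subst sum.reindex)
    show "inj_on (\<lambda>(F1, F2). F1 \<union> F2) (states D1 \<times> states D2)"
    proof (rule inj_onI)
      fix p q assume "p \<in> states D1 \<times> states D2" "q \<in> states D1 \<times> states D2"
          "(case p of (F1, F2) \<Rightarrow> F1 \<union> F2) = (case q of (F1, F2) \<Rightarrow> F1
          \<union> F2)"
      then have "fst p \<subseteq> D1" "snd p \<subseteq> D2" "fst q \<subseteq> D1" "snd q \<subseteq>
          D2" "fst p \<union> snd p = fst q \<union> snd q"
        by (simp_all add: states_def split_beta mem_Times_iff)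
      then have "fst p = fst q" "snd p = snd q" using D12(1) by blast+
      then show "p = q" by (simp add: prod_eq_iff)
    qed
  qed (simp add: comp_def split_beta)
  also have "\<dots> = (\<Sum>(F1, F2)\<in>states D1 \<times> states D2. \<kappa> zvar * sterm \<kappa>
      I D1 F1 * sterm \<kappa> I D2 F2)"
    using cut_state[OF _ _ refl \<kappa>, of _ _ I] by (intro sum.cong) (auto simp: T_def)
  also have "\<dots> = (\<Sum>F1\<in>states D1. \<Sum>F2\<in>states D2. \<kappa> zvar * sterm \<kappa> I
      D1 F1 * sterm \<kappa> I D2 F2)"
    by (simp add: sum.cartesian_product)
  also have "\<dots> = \<kappa> zvar * state_sum \<kappa> I D1 * state_sum \<kappa> I D2"
    by (simp add: state_sum_def sum_distrib_left[symmetric] sum_distrib_right[symmetric] mult.assoc)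
  finally show ?thesis .
qed

end

subsection \<open>The isomorphism\<close>

lemma arrows_equivI: "move_step Pb Pc D D' \<Longrightarrow> arrows_equiv Pb Pc D D'"
  by (simp add: arrows_equiv_def move_step_def r_into_equivclp)

lemma arrows_equiv_sym: "arrows_equiv Pb Pc D D' \<Longrightarrow> arrows_equiv Pb Pc D' D"
  by (auto simp: arrows_equiv_def intro: equivclp_sym)

lemma arrows_equiv_trans: "arrows_equiv Pb Pc D D' \<Longrightarrow> arrows_equiv Pb Pc D' D''
    \<Longrightarrow> arrows_equiv Pb Pc D D''"
  by (auto simp: arrows_equiv_def intro: equivclp_trans)

lemma arrows_equiv_invariant:
  assumes "arrows_equiv Pb Pc D D'" "\<And>D D'. move_step Pb Pc D D' \<Longrightarrow> f D = f D'"
  shows "f D = f D'"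
proof -
  have "equivclp (move_step Pb Pc) D D'" using assms(1) by (simp add: arrows_equiv_def)
  then show ?thesis
    by (induction rule: equivclp_induct) (use assms(2) in metis)+
qed

lemma split_arc:
  assumes "b \<noteq> a"
  obtains p q where "distinct [a, b, p, q]" "cbetween b p a" "cbetween b q a" "\<not> cbetween b q p"
      "\<not> cbetween q p a"
    "\<And>x. cbetween b x p \<Longrightarrow> cbetween b x a" "\<And>x. cbetween q x a
        \<Longrightarrow> cbetween b x a" "\<And>x. cbetween p x q \<Longrightarrow> cbetween b x a"
    "\<not> cbetween b a p" "\<not> cbetween q b a"
proof (cases "b < a")
  case True
  show ?thesis
    by (rule that[of "(2 * b + a) / 3" "(b + 2 * a) / 3"]) (use True in \<open>auto simp:
        cbetween_def\<close>)
next
  case False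
  \<comment> \<open>Here the arc from \<open>b\<close> to \<open>a\<close> passes through infinity
    and contains all reals above \<open>b\<close>.\<close>
  show ?thesis
    by (rule that[of "b + 1" "b + 2"]) (use False assms in \<open>auto simp: cbetween_def\<close>)
qed

text \<open>Move (a) only creates arrows whose left arc is free. For the other kind of kink, create it
  together with a kink of the first kind nested inside by move (b), then delete the latter.\<close>

lemma kink_equiv:
  assumes wf: "wf_arrows (insert (a, b, l) D)" and new: "a \<notin> endpoints D" "b \<notin> endpoints D"
    and free: "arc_free D {} a b \<or> arc_free D {} b a" and l: "Pb l' l"
  shows "arrows_equiv Pb Pc D (insert (a, b, l) D)"
proof -
  have wfD: "wf_arrows D" using wf_subset[OF wf] by blast
  have ab: "a \<noteq> b" using wf_src_neq_tgt[OF wf, of "(a, b, l)"] by simp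
  from free show ?thesis
  proof
    assume "arc_free D {} a b"
    then have "move_a D (insert (a, b, l) D)" unfolding move_a_def using new ab by blast
    then show ?thesis using wf wfD by (intro arrows_equivI) (simp add: move_step_def)
  next
    assume af: "arc_free D {} b a"
    obtain p q where pq: "distinct [a, b, p, q]" "cbetween b p a" "cbetween b q a" "\<not> cbetween b q
        p" "\<not> cbetween q p a"
      "\<And>x. cbetween b x p \<Longrightarrow> cbetween b x a" "\<And>x. cbetween q x a
          \<Longrightarrow> cbetween b x a" "\<And>x. cbetween p x q \<Longrightarrow> cbetween b x a"
      "\<not> cbetween b a p" "\<not> cbetween q b a"
      using split_arc ab by metis
    have fr: "\<not> cbetween b x a" if "x \<in> endpoints D" for x using af that by (auto simp: arc_free_def)
    have npq: "p \<notin> endpoints D" "q \<notin> endpoints D" using fr pq(2,3) by auto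
    let ?D1 = "insert (a, b, l) D" and ?D2 = "insert (p, q, l') (insert (a, b, l) D)"
    have wf2: "wf_arrows ?D2" using pq(1) npq by (intro wf_insert[OF wf]) auto
    have knot_nabla: "\<not> cbetween p a q" "\<not> cbetween p b q" using pq(8) by fastforce+
    have a2: "move_a ?D1 ?D2" unfolding move_a_def
      by (rule exI[of _ p], rule exI[of _ q], rule exI[of _ l']) (use pq npq fr knot_nabla in
          \<open>auto simp: arc_free_def\<close>)
    \<comment> \<open>Move (b) is read with the auxiliary arrow first; its adjacent pairs are
      \<open>p\<close>, \<open>b\<close> and \<open>q\<close>, \<open>a\<close>.\<close>
    have "move_b Pb D (D \<union> {(p, q, l'), (a, b, l)})"
      by (rule move_bI) (use pq npq new fr l in \<open>auto simp: arc_free_def\<close>)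
    then have b2: "move_b Pb D ?D2" by simp
    have "arrows_equiv Pb Pc D ?D2" "arrows_equiv Pb Pc ?D1 ?D2"
      using a2 b2 wf wf2 wfD by (auto intro!: arrows_equivI simp: move_step_def)
    then show ?thesis using arrows_equiv_sym arrows_equiv_trans by metis
  qed
qed

text \<open>Used with constant maps: the one to \<open>()\<close> gives the underlying string of a
  diagram, those to a truth value turn a string into a diagram.\<close>

definition relabel :: "('l \<Rightarrow> 'k) \<Rightarrow> 'l arrows \<Rightarrow> 'k arrows" where
  "relabel h D = (\<lambda>e. (src e, tgt e, h (lab e))) ` D"

lemma relabel_simps [simp]: "relabel h {} = {}" "relabel h (insert (a, b, l) D) = insert (a, b, h l)
    (relabel h D)"
  "relabel h (D \<union> D') = relabel h D \<union> relabel h D'" "relabel g (relabel h D) = relabel (g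
      \<circ> h) D"
  by (simp_all add: relabel_def image_Un image_image)

lemma relabel_unit: "relabel (\<lambda>_. ()) D = D"
proof -
  have "(src e, tgt e, ()) = e" for e :: "real \<times> real \<times> unit" by (simp add: prod_eq_iff)
  then show ?thesis by (simp add: relabel_def)
qed

lemma endpoints_relabel [simp]: "endpoints (relabel h D) = endpoints D"
  unfolding set_eq_iff endpoints_iff relabel_def by auto

lemma arc_free_relabel [simp]: "arc_free (relabel h D) Q x y \<longleftrightarrow> arc_free D Q x y"
  by (simp add: arc_free_def)

lemma wf_relabel:
  assumes "wf_arrows D" shows "wf_arrows (relabel h D)"
proof -
  have d: "{src e, tgt e} \<inter> {src e', tgt e'} = {}" if "e \<in> D" "e' \<in> D" "e \<noteq> e'" for e e'
    using wf_distinct[OF assms that] by blast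
  show ?thesis
    unfolding wf_arrows_def relabel_def split_beta ball_simps fst_conv snd_conv
  proof (intro conjI ballI impI)
    fix e e' assume e: "e \<in> D" "e' \<in> D" "(src e, tgt e, h (lab e)) \<noteq> (src e', tgt e', h
        (lab e'))"
    then have "e \<noteq> e'" by blast
    then show "{src e, tgt e} \<inter> {src e', tgt e'} = {}" using d e by blast
  qed (use wf_finite[OF assms] wf_src_neq_tgt[OF assms] in blast)+
qed

lemma homeo_rel_relabel:
  assumes "homeo_rel D D'" shows "homeo_rel (relabel h D) (relabel h D')"
proof -
  obtain f where f: "bij_betw f (endpoints D) (endpoints D')"
    "\<forall>x\<in>endpoints D. \<forall>y\<in>endpoints D. \<forall>w\<in>endpoints D. cbetween x y w
        \<longleftrightarrow> cbetween (f x) (f y) (f w)"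
    "D' = (\<lambda>(a, b, l). (f a, f b, l)) ` D" using assms unfolding homeo_rel_def by blast
  have "relabel h D' = (\<lambda>(a, b, l). (f a, f b, l)) ` relabel h D"
    unfolding f(3) relabel_def image_image by (rule image_cong) (simp_all add: split_beta)
  then show ?thesis unfolding homeo_rel_def endpoints_relabel using f(1,2) by (intro exI[of _ f] conjI)
qed

lemma move_a_relabel:
  assumes "move_a D D'" shows "move_a (relabel h D) (relabel h D')"
  using assms unfolding move_a_def by fastforce

lemma move_b_relabel:
  assumes "move_b Pb D D'" "\<And>l l'. Pb l l' \<Longrightarrow> Qb (h l) (h l')"
  shows "move_b Qb (relabel h D) (relabel h D')"
proof -
  obtain a a' b b' l l' where m: "distinct [a, a', b, b']" "{a, a', b, b'} \<inter> endpoints D = {}"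
    "arc_free D {b, b'} a a' \<or> arc_free D {b, b'} a' a" "arc_free D {a, a'} b b' \<or> arc_free D
        {a, a'} b' b"
    "Pb l l'" "D' = D \<union> {(a, b, l), (b', a', l')}" using assms(1) unfolding move_b_def by blast
  show ?thesis using move_bI[of a a' b b' "relabel h D" Qb "h l" "h l'"] m assms(2) by simp
qed

lemma move_c_relabel:
  assumes "move_c Pc D D'" "\<And>l l' l''. Pc l l' l'' \<Longrightarrow> Qc (h l) (h l') (h l'')"
  shows "move_c Qc (relabel h D) (relabel h D')"
proof -
  obtain E a ap b bp c cp l1 l2 l3 where m: "distinct [a, ap, b, bp, c, cp]" "{a, ap, b, bp, c, cp}
      \<inter> endpoints E = {}"
     "D = E \<union> {(ap, b, l1), (bp, c, l2), (cp, a, l3)}" "D' = E \<union> {(a, bp, l1), (b, cp,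
         l2), (c, ap, l3)}"
     "arc_free D {} a ap" "arc_free D {} b bp" "arc_free D {} c cp" "Pc l1 l2 l3" using assms(1)
         unfolding move_c_def by blast
  have r: "relabel h D = relabel h E \<union> {(ap, b, h l1), (bp, c, h l2), (cp, a, h l3)}"
    "relabel h D' = relabel h E \<union> {(a, bp, h l1), (b, cp, h l2), (c, ap, h l3)}" unfolding m(3,4)
        by simp_all
  have af: "arc_free (relabel h D) {} a ap" "arc_free (relabel h D) {} b bp" "arc_free (relabel h D) {}
      c cp" using m(5-7) by simp_all
  have n: "{a, ap, b, bp, c, cp} \<inter> endpoints (relabel h E) = {}" using m(2) by simp
  show ?thesis unfolding r(2) by (rule move_cI[where Pc = Qc, OF m(1) n assms(2)[OF m(8)] r(1) af])
qed

lemma move_step_relabel: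
  assumes "move_step Pb Pc D D'" "\<And>l l'. Pb l l' \<Longrightarrow> Qb (h l) (h l')" "\<And>l l'
      l''. Pc l l' l'' \<Longrightarrow> Qc (h l) (h l') (h l'')"
  shows "move_step Qb Qc (relabel h D) (relabel h D')"
proof -
  have "move_b Pb D D' \<Longrightarrow> move_b Qb (relabel h D) (relabel h D')" by (rule
      move_b_relabel[where Pb = Pb]) (auto intro: assms(2))
  moreover have "move_c Pc D D' \<Longrightarrow> move_c Qc (relabel h D) (relabel h D')" by (rule
      move_c_relabel[where Pc = Pc]) (auto intro: assms(3))
  ultimately show ?thesis
    using assms(1) wf_relabel homeo_rel_relabel move_a_relabel unfolding move_step_def by metis
qed

section \<open>Classes of strings and knots, and invariance under single moves\<close>

lemma abs_vstring_eq: "arrows_equiv str_b str_c D D' \<Longrightarrow> abs_vstring D = abs_vstring D'"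
  using Quotient3_rel_abs[OF Quotient3_vstring] .

lemma abs_vknot_eq: "arrows_equiv ad_b ad_c D D' \<Longrightarrow> abs_vknot D = abs_vknot D'"
  using Quotient3_rel_abs[OF Quotient3_vknot] .

lemma arrows_equiv_refl: "wf_arrows D \<Longrightarrow> arrows_equiv Pb Pc D D"
  by (simp add: arrows_equiv_def)

lemma rep_abs_vstring: "wf_arrows D \<Longrightarrow> arrows_equiv str_b str_c (rep_vstring (abs_vstring
    D)) D"
  using Quotient3_vstring arrows_equiv_refl rep_abs_rsp_left by metis

lemma rep_abs_vknot: "wf_arrows D \<Longrightarrow> arrows_equiv ad_b ad_c (rep_vknot (abs_vknot D)) D"
  using Quotient3_vknot arrows_equiv_refl rep_abs_rsp_left by metis

lemma wf_rep_vstring: "wf_arrows (rep_vstring s)"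
  using Quotient3_rep_reflp[OF Quotient3_vstring] by (simp add: arrows_equiv_def)

lemma wf_rep_vknot: "wf_arrows (rep_vknot s)"
  using Quotient3_rep_reflp[OF Quotient3_vknot] by (simp add: arrows_equiv_def)

lemma abs_rep_vstring: "abs_vstring (rep_vstring s) = s" using Quotient3_abs_rep[OF Quotient3_vstring] .
lemma abs_rep_vknot: "abs_vknot (rep_vknot s) = s" using Quotient3_abs_rep[OF Quotient3_vknot] .

lemma move_b_mono: "move_b Pb D D' \<Longrightarrow> move_b (\<lambda>_ _. True) D D'"
  unfolding move_b_def by fast

lemma move_c_mono: "move_c Pc D D' \<Longrightarrow> move_c (\<lambda>_ _ _. True) D D'"
  unfolding move_c_def by (elim ex_forward conj_forward) simp_all

text \<open>Any \<open>M\<close> above both sizes will do, so \<open>invariant_below\<close> for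
  every \<open>M\<close> amounts to full invariance.\<close>

lemma invariant_step:
  assumes "\<And>M. invariant_below \<kappa> I M" and "move_step Pb Pc D D'"
  shows "I D = I D'"
proof -
  interpret invariant_below \<kappa> I "Suc (max (card D) (card D'))" by (rule assms(1))
  have wf: "wf_arrows D" "wf_arrows D'" using assms(2) by (auto simp: move_step_def)
  have c: "card D < Suc (max (card D) (card D'))" "card D' < Suc (max (card D) (card D'))" by simp_all
  from assms(2) consider "homeo_rel D D'" | "move_a D D'" | "move_b Pb D D'" | "move_c Pc D D'"
      unfolding move_step_def by blast
  then show ?thesis
  proof cases
    case 1 then show ?thesis using homeo wf c by blast
  next
    case 2
    then obtain a b l where "a \<notin> endpoints D" "b \<notin> endpoints D" "arc_free D {} a b" "D' =
        insert (a, b, l) D" unfolding move_a_def by blast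
    then show ?thesis using kink[of a b l D] wf c by simp
  next
    case 3 then show ?thesis using moveb[OF wf move_b_mono] c by blast
  next
    case 4 then show ?thesis using movec[OF wf move_c_mono] c by blast
  qed
qed

lemma proper_sum_step:
  assumes "invariant_below \<kappa> I M" and "move_step ad_b ad_c D D'" "card D \<le> M" "card D' \<le> M"
  shows "proper_sum \<kappa> I D = proper_sum \<kappa> I D'"
proof -
  interpret invariant_below \<kappa> I M by (rule assms(1))
  have wf: "wf_arrows D" "wf_arrows D'" using assms(2) by (auto simp: move_step_def)
  from assms(2) consider "homeo_rel D D'" | "move_a D D'" | "move_b ad_b D D'" | "move_c ad_c D D'"
      unfolding move_step_def by blast
  then show ?thesis
  proof cases
    case 1 then show ?thesis using proper_sum_homeo[OF wf] assms by simp
  next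
    case 2
    then obtain a b l where "a \<notin> endpoints D" "b \<notin> endpoints D" "arc_free D {} a b" "D' =
        insert (a, b, l) D" unfolding move_a_def by blast
    then show ?thesis using proper_sum_kink[of a b l D] wf assms by simp
  next
    case 3 then show ?thesis using proper_sum_moveb[OF wf] assms by simp
  next
    case 4 then show ?thesis using proper_sum_movec[OF wf] assms by simp
  qed
qed

lemma state_sum_equiv:
  assumes "\<And>M. invariant_below \<kappa> I M" "arrows_equiv ad_b ad_c D D'"
  shows "state_sum \<kappa> I D = state_sum \<kappa> I D'"
proof (rule arrows_equiv_invariant[OF assms(2)])
  fix D D' assume s: "move_step ad_b ad_c D D'"
  then have wf: "wf_arrows D" "wf_arrows D'" by (auto simp: move_step_def)
  have "ring_homo \<kappa>" using assms(1) invariant_below.\<kappa> by blast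
  then show "state_sum \<kappa> I D = state_sum \<kappa> I D'"
    using state_sum_eq[OF _ wf_finite[OF wf(1)], of \<kappa> I] state_sum_eq[OF _ wf_finite[OF wf(2)],
        of \<kappa> I]
      invariant_step[OF assms(1) s] proper_sum_step[OF assms(1) s, of "max (card D) (card D')"] by simp
qed

definition str_class :: "bool arrows \<Rightarrow> vstring" where
  "str_class P = abs_vstring (relabel (\<lambda>_. ()) P)"

text \<open>The trivial class is sent to 0, in accordance with the trivial knot being a generator of
  the skein ideal.\<close>

definition str_var :: "bool arrows \<Rightarrow> vstring RX" where
  "str_var P = (if str_class P \<in> S0 then pvar (str_class P) else 0)"

lemma str_var_cong: "str_class P = str_class Q \<Longrightarrow> str_var P = str_var Q"
  by (simp add: str_var_def)

lemma invariant_str_var: "invariant_below pconst str_var M"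
proof
  show "ring_homo pconst" by (rule pconst_ring_homo)
  show "str_var {} = 0" by (simp add: str_var_def str_class_def S0_def)
  have st: "str_var P = str_var Q" if "move_step (\<lambda>_ _. True) (\<lambda>_ _ _. True) P Q" for P Q
    unfolding str_class_def
    by (rule str_var_cong, unfold str_class_def, rule abs_vstring_eq, rule arrows_equivI, rule
        move_step_relabel[OF that])
      (simp_all add: str_b_def str_c_def)
  show "str_var P = str_var Q" if "wf_arrows P" "wf_arrows Q" "homeo_rel P Q" for P Q
    using that by (intro st) (simp add: move_step_def)
  show "str_var P = str_var Q" if "wf_arrows P" "wf_arrows Q" "move_b (\<lambda>_ _. True) P Q" for P Q
    using that by (intro st) (simp add: move_step_def)
  show "str_var P = str_var Q" if "wf_arrows P" "wf_arrows Q" "move_c (\<lambda>_ _ _. True) P Q" for P Q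
    using that by (intro st) (simp add: move_step_def)
  show "str_var (insert (a, b, l) P) = str_var P" if k: "wf_arrows (insert (a, b, l) P)" "a \<notin>
      endpoints P" "b \<notin> endpoints P"
      "arc_free P {} a b \<or> arc_free P {} b a" for a b l P
  proof (rule str_var_cong)
    have "arrows_equiv str_b str_c (relabel (\<lambda>_. ()) P) (insert (a, b, ()) (relabel (\<lambda>_.
        ()) P))"
      using k wf_relabel[OF k(1), of "\<lambda>_. ()"] by (intro kink_equiv[where l' = "()"]) (auto
          simp: str_b_def)
    then show "str_class (insert (a, b, l) P) = str_class P"
      using abs_vstring_eq by (simp add: str_class_def)
  qed
qed

section \<open>The homomorphism from knots to strings\<close>

definition knot_nabla :: "vknot \<Rightarrow> vstring RX" where
  "knot_nabla K = state_sum pconst str_var (rep_vknot K)"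

lemma knot_nabla_abs: "wf_arrows D \<Longrightarrow> knot_nabla (abs_vknot D) = state_sum pconst str_var D"
  unfolding knot_nabla_def by (rule state_sum_equiv[OF invariant_str_var rep_abs_vknot])

definition nabla_hom :: "vknot RX \<Rightarrow> vstring RX" where
  "nabla_hom = rx_eval pconst knot_nabla"

lemma nabla_hom_homo: "ring_homo nabla_hom" unfolding nabla_hom_def by (rule rx_eval_ring_homo[OF
    pconst_ring_homo])

lemma nabla_hom_pconst: "nabla_hom (pconst c) = pconst c" unfolding nabla_hom_def by (rule
    rx_eval_pconst[OF pconst_ring_homo])

lemma nabla_hom_pvar: "wf_arrows D \<Longrightarrow> nabla_hom (pvar (abs_vknot D)) = state_sum pconst
    str_var D"
  unfolding nabla_hom_def using rx_eval_pvar[OF pconst_ring_homo] knot_nabla_abs by metis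

lemma state_sum_empty: "ring_homo \<kappa> \<Longrightarrow> state_sum \<kappa> I {} = I {}"
  by (simp add: state_sum_eq proper_sum_Pow pterm_def)

lemma wf_empty [simp]: "wf_arrows {}" by (simp add: wf_arrows_def)

lemma neg_arrow_eq: "neg_arrow e D = insert (src e, tgt e, False) (D - {e})"
  by (simp add: neg_arrow_def)

lemma wf_neg_arrow:
  assumes "wf_arrows D" "e \<in> D" shows "wf_arrows (neg_arrow e D)"
proof -
  have "src e \<noteq> x \<and> tgt e \<noteq> x" if "x \<in> endpoints (D - {e})" for x
    using that wf_distinct[OF assms(1) assms(2)] unfolding endpoints_iff by blast
  then show ?thesis unfolding neg_arrow_eq
    using assms wf_src_neq_tgt[OF assms] by (intro wf_insert wf_subset[OF assms(1)]) auto
qed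

lemma wf_remove_arc: "wf_arrows D \<Longrightarrow> wf_arrows (remove_arc x y D)"
  by (rule wf_subset) (auto simp: remove_arc_def)

text \<open>\<open>str_var\<close> ignores signs, so the terms of the empty state agree and
  \<open>proper_sum_skein\<close> becomes the skein relation for the whole state sum.\<close>

lemma nabla_hom_skein_gens: "g \<in> skein_gens \<Longrightarrow> nabla_hom g = 0"
proof -
  assume "g \<in> skein_gens"
  then consider "g = pvar (abs_vknot {})" | D e where "wf_arrows D" "e \<in> D" "snd (snd e) = True"
    "g = pvar (abs_vknot D) - pvar (abs_vknot (neg_arrow e D)) - pconst zvar * pvar (abs_vknot
        (remove_arc (tgt e) (src e) D))
                      * pvar (abs_vknot (remove_arc (src e) (tgt e) D))"
    unfolding skein_gens_def by blast
  then show ?thesis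
  proof cases
    case 1
    then show ?thesis using nabla_hom_pvar[of "{}"] state_sum_empty[OF pconst_ring_homo, of str_var]
        invariant_below.I0[OF invariant_str_var] by simp
  next
    case 2
    let ?E = "D - {e}" and ?e' = "(src e, tgt e, False)"
    interpret skein_cut D e "remove_arc (tgt e) (src e) D" "remove_arc (src e) (tgt e) D" ?E
      by unfold_locales (use 2 in auto)
    have cl: "str_var (insert e P) = str_var (insert ?e' P)" for P
      by (rule str_var_cong) (simp add: str_class_def relabel_def)
    have "proper_sum pconst str_var D = proper_sum pconst str_var (neg_arrow e D) + pconst zvar *
        state_sum pconst str_var (remove_arc (tgt e) (src e) D)
       * state_sum pconst str_var (remove_arc (src e) (tgt e) D)"
      unfolding neg_arrow_eq by (rule proper_sum_skein[OF _ pconst_ring_homo refl cl]) (use 2 in simp)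
    moreover have "str_var D = str_var (neg_arrow e D)" using cl[of ?E] 2(2) unfolding neg_arrow_eq by
        (simp add: insert_absorb)
    ultimately have "state_sum pconst str_var D = state_sum pconst str_var (neg_arrow e D) + pconst zvar
        * state_sum pconst str_var (remove_arc (tgt e) (src e) D)
       * state_sum pconst str_var (remove_arc (src e) (tgt e) D)"
      using state_sum_eq[OF pconst_ring_homo wf_finite[OF 2(1)], of str_var] state_sum_eq[OF
          pconst_ring_homo wf_finite[OF wf_neg_arrow[OF 2(1,2)]], of str_var] by simp
    then show ?thesis unfolding 2(4)
      by (simp add: ring_homoD(2)[OF nabla_hom_homo] ring_homoD(6)[OF nabla_hom_homo] nabla_hom_pconst
          nabla_hom_pvar[OF 2(1)] nabla_hom_pvar[OF wf_neg_arrow[OF 2(1,2)]] nabla_hom_pvar[OF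
          wf_remove_arc[OF 2(1)]])
  qed
qed

lemma nabla_hom_skein_ideal: "p \<in> skein_ideal \<Longrightarrow> nabla_hom p = 0"
  unfolding skein_ideal_def
  by (induction rule: ideal_gen.induct)
    (simp_all add: nabla_hom_skein_gens ring_homoD(1)[OF nabla_hom_homo] ring_homoD(2)[OF
        nabla_hom_homo] ring_homoD(4)[OF nabla_hom_homo])

section \<open>The image of the homomorphism\<close>

lemma RS0_intros:
  "pconst c \<in> RS0" "s \<in> S0 \<Longrightarrow> pvar s \<in> RS0" "p \<in> RS0 \<Longrightarrow> q
      \<in> RS0 \<Longrightarrow> p + q \<in> RS0" "p \<in> RS0 \<Longrightarrow> q \<in> RS0
      \<Longrightarrow> p * q \<in> RS0"
proof -
  show "pconst c \<in> RS0" "s \<in> S0 \<Longrightarrow> pvar s \<in> RS0"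
    by (auto simp: RS0_def pconst_def pvar_def split: if_splits)
  show "p + q \<in> RS0" if "p \<in> RS0" "q \<in> RS0"
    using that Poly_Mapping.keys_add[of p q] unfolding RS0_def by blast
  show "p * q \<in> RS0" if "p \<in> RS0" "q \<in> RS0"
  proof -
    have "Poly_Mapping.keys m \<subseteq> S0" if m: "m \<in> Poly_Mapping.keys (p * q)" for m
    proof -
      obtain m1 m2 where "m = m1 + m2" "m1 \<in> Poly_Mapping.keys p" "m2 \<in> Poly_Mapping.keys q"
          using keys_mult[of p q] m by blast
      then show ?thesis using Poly_Mapping.keys_add[of m1 m2] \<open>p \<in> RS0\<close> \<open>q \<in>
          RS0\<close> unfolding RS0_def by blast
    qed
    then show ?thesis by (simp add: RS0_def)
  qed
qed

text \<open>Applied to \<open>RS0\<close>, to bound the image from above, and to the image itself,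
  to show that it is large enough.\<close>

locale rx_subalgebra =
  fixes A :: "'x RX set"
  assumes pconst_in: "pconst c \<in> A" and add_in: "p \<in> A \<Longrightarrow> q \<in> A
      \<Longrightarrow> p + q \<in> A"
    and mult_in: "p \<in> A \<Longrightarrow> q \<in> A \<Longrightarrow> p * q \<in> A"
begin

lemma zero_in: "0 \<in> A" and one_in: "1 \<in> A"
  using pconst_in[of 0] pconst_in[of 1] by (simp_all add: pconst_def)

lemma uminus_in: "p \<in> A \<Longrightarrow> - p \<in> A"
proof -
  assume "p \<in> A"
  then have "pconst (- 1) * p \<in> A" using pconst_in mult_in by blast
  moreover have "pconst (- 1) = (- 1 :: 'x RX)" using ring_homoD(5)[OF pconst_ring_homo, of 1]
      ring_homoD(3)[OF pconst_ring_homo] by metis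
  ultimately show ?thesis by simp
qed

lemma sum_in: "(\<And>x. x \<in> S \<Longrightarrow> f x \<in> A) \<Longrightarrow> sum f S \<in> A"
  by (induction S rule: infinite_finite_induct) (auto simp: zero_in intro: add_in)

lemma prod_in: "(\<And>x. x \<in> S \<Longrightarrow> f x \<in> A) \<Longrightarrow> prod f S \<in> A"
  by (induction S rule: infinite_finite_induct) (auto simp: one_in intro: mult_in)

lemma power_in: "p \<in> A \<Longrightarrow> p ^ n \<in> A"
  by (induction n) (auto simp: one_in intro: mult_in)

lemma mono_eval_in: "(\<And>x. x \<in> Poly_Mapping.keys m \<Longrightarrow> \<phi> x \<in> A)
    \<Longrightarrow> mono_eval \<phi> m \<in> A"
  unfolding mono_eval_def by (intro prod_in power_in) blast

lemma sterm_in: "(\<And>v. v \<in> regions F \<Longrightarrow> I (piece D F v) \<in> A)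
    \<Longrightarrow> sterm pconst I D F \<in> A"
  unfolding sterm_def by (intro mult_in pconst_in prod_in) blast

end

lemma rx_subalgebra_RS0: "rx_subalgebra RS0"
  by unfold_locales (auto intro: RS0_intros)

lemma rx_subalgebra_range: "rx_subalgebra (range nabla_hom)"
proof
  show "pconst c \<in> range nabla_hom" for c using nabla_hom_pconst by (metis rangeI)
  show "p + q \<in> range nabla_hom" if "p \<in> range nabla_hom" "q \<in> range nabla_hom" for p q
    using that ring_homoD(1)[OF nabla_hom_homo] by (metis (no_types, lifting) imageE rangeI)
  show "p * q \<in> range nabla_hom" if "p \<in> range nabla_hom" "q \<in> range nabla_hom" for p q
    using that ring_homoD(2)[OF nabla_hom_homo] by (metis (no_types, lifting) imageE rangeI)
qed

lemma range_nabla_hom_subset: "range nabla_hom \<subseteq> RS0"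
proof
  interpret rx_subalgebra RS0 by (rule rx_subalgebra_RS0)
  have sv: "str_var P \<in> RS0" for P by (simp add: str_var_def RS0_intros zero_in)
  have "knot_nabla K \<in> RS0" for K unfolding knot_nabla_def state_sum_def by (intro sum_in sterm_in sv)
  then show "p \<in> RS0" if "p \<in> range nabla_hom" for p
    using that unfolding nabla_hom_def rx_eval_def by (auto intro!: sum_in mult_in pconst_in mono_eval_in)
qed

text \<open>Triangularity: \<open>str_var P\<close> is a state sum, which is the image of a knot,
  minus terms built from the strings of smaller pieces.\<close>

lemma str_var_in_range: "wf_arrows P \<Longrightarrow> str_var P \<in> range nabla_hom"
proof (induction "card P" arbitrary: P rule: less_induct)
  case less
  interpret rx_subalgebra "range nabla_hom" by (rule rx_subalgebra_range)
  have fin: "finite P" using wf_finite[OF less.prems] .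
  have "sterm pconst str_var P F \<in> range nabla_hom" if F: "F \<in> states P - {{}}" for F
  proof (rule sterm_in)
    fix v
    have "piece P F v \<subset> P" using F unfolding piece_def states_def by blast
    then show "str_var (piece P F v) \<in> range nabla_hom"
      using less.hyps[of "piece P F v"] psubset_card_mono[OF fin] wf_subset[OF less.prems] by blast
  qed
  then have "proper_sum pconst str_var P \<in> range nabla_hom" unfolding proper_sum_def by (rule sum_in)
  moreover have "state_sum pconst str_var P \<in> range nabla_hom" using nabla_hom_pvar[OF less.prems]
      by (metis rangeI)
  moreover have "str_var P = state_sum pconst str_var P + - proper_sum pconst str_var P"
    using state_sum_eq[OF pconst_ring_homo fin, of str_var] by simp
  ultimately show ?case using add_in uminus_in by metis
qed

lemma range_nabla_hom: "range nabla_hom = RS0"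
proof
  show "RS0 \<subseteq> range nabla_hom"
  proof
    interpret rx_subalgebra "range nabla_hom" by (rule rx_subalgebra_range)
    fix p assume p: "p \<in> RS0"
    have "pvar s \<in> range nabla_hom" if "s \<in> S0" for s
    proof -
      \<comment> \<open>Any signs may be put on a representative, since \<open>str_class\<close>
        forgets them.\<close>
      let ?P = "relabel (\<lambda>_. True) (rep_vstring s)"
      have "str_class ?P = s" unfolding str_class_def by (simp add: comp_def relabel_unit abs_rep_vstring)
      then have "pvar s = str_var ?P" using that by (simp add: str_var_def)
      then show ?thesis using str_var_in_range[OF wf_relabel[OF wf_rep_vstring]] by metis
    qed
    then have "(\<Sum>m\<in>Poly_Mapping.keys p. pconst (Poly_Mapping.lookup p m) * mono_eval pvar m)
        \<in> range nabla_hom"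
      using p unfolding RS0_def by (intro sum_in mult_in pconst_in mono_eval_in) blast
    then show "p \<in> range nabla_hom" using rx_as_sum[of p] by simp
  qed
qed (rule range_nabla_hom_subset)


section \<open>The skein algebra as a ring\<close>

lemma skein_ideal_intros: "0 \<in> skein_ideal" "p \<in> skein_ideal \<Longrightarrow> q \<in>
    skein_ideal \<Longrightarrow> p + q \<in> skein_ideal"
  "p \<in> skein_ideal \<Longrightarrow> r * p \<in> skein_ideal" "p \<in> skein_gens \<Longrightarrow>
      p \<in> skein_ideal"
  unfolding skein_ideal_def by (auto intro: ideal_gen.intros)

lemma skein_ideal_uminus: "p \<in> skein_ideal \<Longrightarrow> - p \<in> skein_ideal"
  using skein_ideal_intros(3)[of p "- 1"] by simp

lemma skein_ideal_diff: "p \<in> skein_ideal \<Longrightarrow> q \<in> skein_ideal \<Longrightarrow> p -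
    q \<in> skein_ideal"
  using skein_ideal_intros(2)[of p "- q"] skein_ideal_uminus by simp

\<comment> \<open>The quotient is made a type so that it can be an instance of
  \<open>comm_ring_1\<close> and state sums can take values in it.\<close>
quotient_type skein = "vknot RX" / "\<lambda>p q. p - q \<in> skein_ideal"
proof (rule equivpI)
  show "reflp (\<lambda>p q. p - q \<in> skein_ideal)" by (rule reflpI) (simp add: skein_ideal_intros)
  show "symp (\<lambda>p q. p - q \<in> skein_ideal)" by (rule sympI) (metis skein_ideal_uminus minus_diff_eq)
  show "transp (\<lambda>p q. p - q \<in> skein_ideal)"
  proof (rule transpI)
    fix p q r :: "vknot RX" assume "p - q \<in> skein_ideal" "q - r \<in> skein_ideal"
    then have "(p - q) + (q - r) \<in> skein_ideal" by (rule skein_ideal_intros(2))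
    then show "p - r \<in> skein_ideal" by simp
  qed
qed

instantiation skein :: comm_ring_1
begin

lift_definition zero_skein :: skein is 0 .
lift_definition one_skein :: skein is 1 .
lift_definition plus_skein :: "skein \<Rightarrow> skein \<Rightarrow> skein" is "(+)"
  by (simp add: add_diff_add skein_ideal_intros(2))
lift_definition minus_skein :: "skein \<Rightarrow> skein \<Rightarrow> skein" is "(-)"
proof -
  fix p q r s :: "vknot RX" assume "p - q \<in> skein_ideal" "r - s \<in> skein_ideal"
  then have "(p - q) - (r - s) \<in> skein_ideal" by (rule skein_ideal_diff)
  then show "p - r - (q - s) \<in> skein_ideal" by (simp add: algebra_simps)
qed
lift_definition uminus_skein :: "skein \<Rightarrow> skein" is uminus
  by (metis minus_diff_minus skein_ideal_uminus)
lift_definition times_skein :: "skein \<Rightarrow> skein \<Rightarrow> skein" is "(*)"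
proof -
  fix p q r s :: "vknot RX" assume "p - q \<in> skein_ideal" "r - s \<in> skein_ideal"
  then have "r * (p - q) + q * (r - s) \<in> skein_ideal" by (intro skein_ideal_intros(2,3))
  then show "p * r - q * s \<in> skein_ideal" by (simp add: algebra_simps)
qed

instance
proof
  \<comment> \<open>The class \<open>comm_ring_1\<close> demands that 0 and 1 differ; the ideal is
    proper because \<open>nabla_hom\<close> kills it and maps 1 to 1.\<close>
  have "(1 :: vknot RX) \<notin> skein_ideal" using nabla_hom_skein_ideal[of 1] ring_homoD(3)[OF
      nabla_hom_homo] by auto
  then show "(0::skein) \<noteq> 1"
    unfolding zero_skein_def one_skein_def skein.abs_eq_iff using skein_ideal_uminus[of "0 - 1"] by auto
qed (transfer, simp add: algebra_simps skein_ideal_intros(1))+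

end

lemma abs_skein_homo: "ring_homo abs_skein"
  by (simp add: ring_homo_def plus_skein.abs_eq times_skein.abs_eq one_skein_def)

lemma abs_skein_eq_0: "abs_skein p = 0 \<longleftrightarrow> p \<in> skein_ideal"
  by (simp add: zero_skein_def skein.abs_eq_iff)

definition skein_const :: "R \<Rightarrow> skein" where "skein_const c = abs_skein (pconst c)"

lemma ring_homo_comp: "ring_homo g \<Longrightarrow> ring_homo h \<Longrightarrow> ring_homo
    (\<lambda>x. g (h x))"
  by (simp add: ring_homo_def)

lemma skein_const_homo: "ring_homo skein_const"
  unfolding skein_const_def[abs_def] by (rule ring_homo_comp[OF abs_skein_homo pconst_ring_homo])

definition skein_knot :: "bool arrows \<Rightarrow> skein" where "skein_knot D = abs_skein (pvar
    (abs_vknot D))"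

lemma skein_knot_equiv: "arrows_equiv ad_b ad_c D D' \<Longrightarrow> skein_knot D = skein_knot D'"
  unfolding skein_knot_def using abs_vknot_eq by metis

lemma skein_knot_empty: "skein_knot {} = 0"
  unfolding skein_knot_def abs_skein_eq_0 by (rule skein_ideal_intros(4)) (simp add: skein_gens_def)

lemma skein_knot_skein:
  assumes "wf_arrows D" "e \<in> D" "lab e"
  shows "skein_knot D = skein_knot (neg_arrow e D) + skein_const zvar * skein_knot (remove_arc (tgt e)
      (src e) D) * skein_knot (remove_arc (src e) (tgt e) D)"
proof -
  have "abs_skein (pvar (abs_vknot D) - pvar (abs_vknot (neg_arrow e D)) - pconst zvar * pvar (abs_vknot
      (remove_arc (tgt e) (src e) D))
                      * pvar (abs_vknot (remove_arc (src e) (tgt e) D))) = 0"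
    unfolding abs_skein_eq_0 skein_gens_def
    by (rule skein_ideal_intros(4), unfold skein_gens_def, rule insertI2, rule CollectI, rule exI[of _
        D], rule exI[of _ e])
      (use assms in simp)
  then have "skein_knot D - skein_knot (neg_arrow e D) - skein_const zvar * skein_knot (remove_arc (tgt
      e) (src e) D) * skein_knot (remove_arc (src e) (tgt e) D) = 0"
    by (simp only: ring_homoD(2)[OF abs_skein_homo] ring_homoD(6)[OF abs_skein_homo] skein_knot_def
        skein_const_def)
  then show ?thesis by (simp add: algebra_simps)
qed

text \<open>The inverse of the invariant is forced to satisfy \<open>state_sum skein_const psi D =
    skein_knot D\<close>, which is a recursion
  because the pieces of a nonempty state are smaller than the diagram.\<close>

function psi :: "bool arrows \<Rightarrow> skein" where
  "psi D = (if finite D then skein_knot D - (\<Sum>F\<in>states D - {{}}. skein_const (state_coeff F) *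
      (\<Prod>v\<in>regions F. psi (piece D F v))) else 0)"
  by auto
termination
proof (relation "measure card")
  fix D F v :: "bool arrows" and V :: "bool arrows set"
  assume "finite D" "F \<in> states D - {{}}"
  then have "piece D F v \<subset> D" unfolding piece_def states_def by blast
  then show "(piece D F v, D) \<in> measure card" using psubset_card_mono[OF \<open>finite D\<close>] by simp
qed simp

declare psi.simps [simp del]

lemma psi_eq: "finite D \<Longrightarrow> psi D = skein_knot D - proper_sum skein_const psi D"
  by (subst psi.simps) (simp add: proper_sum_def sterm_def)

lemma state_sum_psi: "finite D \<Longrightarrow> state_sum skein_const psi D = skein_knot D"
  by (simp add: state_sum_eq[OF skein_const_homo] psi_eq)

lemma psi_empty: "psi {} = 0"
  using state_sum_psi[of "{}"] state_sum_empty[OF skein_const_homo, of psi] skein_knot_empty by simp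

text \<open>\<open>skein_knot\<close> and \<open>proper_sum\<close> change by the same product,
  because the state sums of the two smaller diagrams are their classes by
  \<open>state_sum_psi\<close>. The induction provides the sign independence on pieces that
  \<open>proper_sum_skein\<close> asks for.\<close>

lemma psi_flip: "wf_arrows D \<Longrightarrow> e \<in> D \<Longrightarrow> lab e \<Longrightarrow> psi D
    = psi (neg_arrow e D)"
proof (induction "card D" arbitrary: D rule: less_induct)
  case less
  let ?E = "D - {e}" and ?e' = "(src e, tgt e, False)"
  interpret skein_cut D e "remove_arc (tgt e) (src e) D" "remove_arc (src e) (tgt e) D" ?E
    by unfold_locales (use less in auto)
  have fin: "finite D" "finite (neg_arrow e D)" using less wf_finite wf_neg_arrow by blast+
  have "psi (insert e P) = psi (insert ?e' P)" if P: "P \<subset> ?E" for P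
  proof -
    have "insert e P \<subset> D" "e \<notin> P" using P less.prems(2) by blast+
    then have "psi (insert e P) = psi (neg_arrow e (insert e P))"
      using less.hyps[of "insert e P"] less.prems psubset_card_mono[OF fin(1)] wf_subset[OF
          less.prems(1)] by blast
    also have "neg_arrow e (insert e P) = insert ?e' P" using \<open>e \<notin> P\<close> by (simp add:
        neg_arrow_eq)
    finally show ?thesis .
  qed
  then have "proper_sum skein_const psi D = proper_sum skein_const psi (neg_arrow e D) + skein_const
      zvar * state_sum skein_const psi (remove_arc (tgt e) (src e) D)
       * state_sum skein_const psi (remove_arc (src e) (tgt e) D)"
    unfolding neg_arrow_eq using less.prems(3) by (intro proper_sum_skein skein_const_homo) auto
  then show ?case
    unfolding psi_eq[OF fin(1)] psi_eq[OF fin(2)] skein_knot_skein[OF less.prems]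
    using state_sum_psi wf_finite[OF wf_remove_arc[OF less.prems(1)]] by simp
qed

text \<open>Positive arrows are made negative one at a time by \<open>psi_flip\<close>.\<close>

lemma psi_relabel: "wf_arrows D \<Longrightarrow> psi (relabel (\<lambda>_. False) D) = psi D"
proof (induction "card {e \<in> D. lab e}" arbitrary: D rule: less_induct)
  case less
  show ?case
  proof (cases "{e \<in> D. lab e} = {}")
    case True
    then have "\<not> lab e" if "e \<in> D" for e using that by blast
    then have "(src e, tgt e, False) = e" if "e \<in> D" for e using that by (simp add: prod_eq_iff)
    then have "relabel (\<lambda>_. False) D = D" by (simp add: relabel_def cong: image_cong)
    then show ?thesis by simp
  next
    case False
    then obtain e where e: "e \<in> D" "lab e" by blast
    have "{d \<in> neg_arrow e D. lab d} \<subset> {d \<in> D. lab d}"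
    proof -
      have "{d \<in> neg_arrow e D. lab d} \<subseteq> {d \<in> D. lab d} - {e}" unfolding neg_arrow_eq
          by auto
      then show ?thesis using e by blast
    qed
    then have "card {d \<in> neg_arrow e D. lab d} < card {d \<in> D. lab d}"
      using wf_finite[OF less.prems] by (intro psubset_card_mono) auto
    then have "psi (relabel (\<lambda>_. False) (neg_arrow e D)) = psi (neg_arrow e D)"
      using less.hyps wf_neg_arrow[OF less.prems e(1)] by blast
    moreover have "relabel (\<lambda>_. False) (neg_arrow e D) = relabel (\<lambda>_. False) D"
    proof -
      have "relabel (\<lambda>_. False) D = relabel (\<lambda>_. False) (insert e (D - {e}))" using e(1)
          by (simp add: insert_absorb)
      also have "\<dots> = relabel (\<lambda>_. False) (neg_arrow e D)"
        unfolding relabel_def neg_arrow_eq image_insert fst_conv snd_conv ..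
      finally show ?thesis by simp
    qed
    ultimately show ?thesis using psi_flip[OF less.prems e] by simp
  qed
qed

lemma psi_cong:
  assumes "wf_arrows D" "wf_arrows D'" "relabel (\<lambda>_. False) D = relabel (\<lambda>_. False) D'"
  shows "psi D = psi D'"
  using psi_relabel[OF assms(1)] psi_relabel[OF assms(2)] assms(3) by simp

text \<open>Equivalent diagrams have the same class, so \<open>psi\<close> agrees on them as soon as
  the proper sums do, and these are invariant up to \<open>M\<close> arrows by the previous stage.
  This gives the signed moves below \<open>Suc M\<close> arrows, and changing signs gives the
  unsigned ones.\<close>

lemma psi_invariant: "invariant_below skein_const psi M"
proof (induction M)
  case 0
  \<comment> \<open>No diagram has fewer than 0 arrows, so the assumptions on moves are
    void.\<close>
  show ?case by unfold_locales (simp_all add: skein_const_homo psi_empty)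
next
  case (Suc M)
  have eqI: "psi P = psi Q" if "arrows_equiv ad_b ad_c P Q" "proper_sum skein_const psi P = proper_sum
      skein_const psi Q" for P Q
  proof -
    have "finite P" "finite Q" using that(1) wf_finite by (auto simp: arrows_equiv_def)
    then show ?thesis using psi_eq skein_knot_equiv[OF that(1)] that(2) by simp
  qed
  have step: "psi P = psi Q" if "move_step ad_b ad_c P Q" "card P < Suc M" "card Q < Suc M" for P Q
    using that by (intro eqI arrows_equivI proper_sum_step[OF Suc]) auto
  show ?case
  proof
    show "ring_homo skein_const" by (rule skein_const_homo)
    show "psi {} = 0" by (rule psi_empty)
    show "psi P = psi Q" if "wf_arrows P" "wf_arrows Q" "homeo_rel P Q" "card P < Suc M" "card Q < Suc
        M" for P Q
      using that by (intro step) (auto simp: move_step_def)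
    show "psi (insert (a, b, l) P) = psi P" if k: "wf_arrows (insert (a, b, l) P)" "a \<notin> endpoints
        P" "b \<notin> endpoints P"
      "arc_free P {} a b \<or> arc_free P {} b a" "card (insert (a, b, l) P) < Suc M" for a b l P
    proof (rule eqI)
      show "arrows_equiv ad_b ad_c (insert (a, b, l) P) P"
        by (rule arrows_equiv_sym, rule kink_equiv[OF k(1-4), of _ "\<not> l"]) (simp add: ad_b_def)
      show "proper_sum skein_const psi (insert (a, b, l) P) = proper_sum skein_const psi P"
        using invariant_below.proper_sum_kink[OF Suc k(1-4)] k(5) by simp
    qed
    show "psi P = psi Q" if w: "wf_arrows P" "wf_arrows Q" and m: "move_b (\<lambda>_ _. True) P Q" and
        c: "card P < Suc M" "card Q < Suc M" for P Q
    proof -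
      obtain a a' b b' l l' where m: "distinct [a, a', b, b']" "{a, a', b, b'} \<inter> endpoints P = {}"
        "arc_free P {b, b'} a a' \<or> arc_free P {b, b'} a' a" "arc_free P {a, a'} b b' \<or> arc_free
            P {a, a'} b' b"
        "Q = P \<union> {(a, b, l), (b', a', l')}" using m unfolding move_b_def by blast
      \<comment> \<open>The second sign is replaced by the opposite of the first to make the move
        admissible for diagrams; \<open>psi_cong\<close> returns to the given sign.\<close>
      let ?Q = "P \<union> {(a, b, l), (b', a', \<not> l)}"
      have n: "(x, y, k) \<notin> P" if "x \<in> {a, a', b, b'}" for x y k
        using m(2) endpointsI(1)[of "(x, y, k)" P] that by auto
      have Q: "?Q = insert (a, b, l) (insert (b', a', \<not> l) P)" "Q = insert (a, b, l) (insert (b',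
          a', l') P)" using m(5) by auto
      have wQ: "wf_arrows ?Q" unfolding Q(1) using m(1,2) w(1) by (intro wf_insert) auto
      have cQ: "card ?Q = card Q" unfolding Q using n m(1) wf_finite[OF w(1)] by simp
      have "move_b ad_b P ?Q" by (rule move_bI) (use m in \<open>simp_all add: ad_b_def\<close>)
      then have "psi P = psi ?Q" using w wQ c cQ by (intro step) (auto simp: move_step_def)
      also have "\<dots> = psi Q" by (rule psi_cong[OF wQ w(2)]) (simp add: m(5))
      finally show ?thesis .
    qed
    show "psi P = psi Q" if w: "wf_arrows P" "wf_arrows Q" and m: "move_c (\<lambda>_ _ _. True) P Q"
        and c: "card P < Suc M" "card Q < Suc M" for P Q
    proof -
      obtain E a ap b bp c cp l1 l2 l3 where m: "distinct [a, ap, b, bp, c, cp]" "{a, ap, b, bp, c, cp}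
          \<inter> endpoints E = {}"
       "P = E \<union> {(ap, b, l1), (bp, c, l2), (cp, a, l3)}" "Q = E \<union> {(a, bp, l1), (b, cp,
           l2), (c, ap, l3)}"
       "arc_free P {} a ap" "arc_free P {} b bp" "arc_free P {} c cp" using m unfolding move_c_def by blast
      \<comment> \<open>The signs under which move (c) is admissible for diagrams;
        \<open>psi_cong\<close> returns to the given ones.\<close>
      let ?P = "E \<union> {(ap, b, True), (bp, c, True), (cp, a, False)}" and ?Q = "E \<union> {(a, bp,
          True), (b, cp, True), (c, ap, False)}"
      have wE: "wf_arrows E" using wf_subset[OF w(1)] m(3) by blast
      have P: "?P = insert (ap, b, True) (insert (bp, c, True) (insert (cp, a, False) E))" "P = insert
          (ap, b, l1) (insert (bp, c, l2) (insert (cp, a, l3) E))"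
       and Q: "?Q = insert (a, bp, True) (insert (b, cp, True) (insert (c, ap, False) E))" "Q = insert
           (a, bp, l1) (insert (b, cp, l2) (insert (c, ap, l3) E))"
        unfolding m(3,4) by blast+
      have ws: "wf_arrows ?P" "wf_arrows ?Q" unfolding P(1) Q(1) using m(1,2) wE by (auto intro!: wf_insert)
      have n: "(x, y, k) \<notin> E" if "x \<in> {a, ap, b, bp, c, cp}" for x y k
        using m(2) endpointsI(1)[of "(x, y, k)" E] that by auto
      have cs: "card ?P = card P" "card ?Q = card Q" unfolding P Q using n m(1) wf_finite[OF wE] by simp_all
      have ep: "endpoints ?P = endpoints P" unfolding P by simp
      have af: "arc_free ?P {} a ap" "arc_free ?P {} b bp" "arc_free ?P {} c cp" using m(5-7) unfolding
          arc_free_def ep by simp_all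
      have "move_c ad_c ?P ?Q" by (rule move_cI[OF m(1,2) _ refl af]) (simp add: ad_c_def)
      then have "psi ?P = psi ?Q" using ws cs \<open>card P < Suc M\<close> \<open>card Q < Suc
          M\<close> by (intro step) (simp_all add: move_step_def)
      moreover have "psi P = psi ?P" by (rule psi_cong[OF w(1) ws(1)]) (simp add: m(3))
      moreover have "psi Q = psi ?Q" by (rule psi_cong[OF w(2) ws(2)]) (simp add: m(4))
      ultimately show ?thesis by simp
    qed
  qed
qed

section \<open>The inverse homomorphism\<close>

definition psi_str :: "vstring \<Rightarrow> skein" where
  "psi_str s = psi (relabel (\<lambda>_. False) (rep_vstring s))"

lemma psi_str_class:
  assumes "wf_arrows P" shows "psi_str (str_class P) = psi P"
proof -
  have "arrows_equiv str_b str_c (rep_vstring (str_class P)) (relabel (\<lambda>_. ()) P)"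
    unfolding str_class_def by (rule rep_abs_vstring[OF wf_relabel[OF assms]])
  then have "psi (relabel (\<lambda>_. False) (rep_vstring (str_class P))) = psi (relabel (\<lambda>_.
      False) (relabel (\<lambda>_. ()) P))"
  proof (rule arrows_equiv_invariant)
    fix D D' :: "unit arrows" assume "move_step str_b str_c D D'"
    then have "move_step (\<lambda>_ _. True) (\<lambda>_ _ _. True) (relabel (\<lambda>_. False) D)
        (relabel (\<lambda>_. False) D')"
      by (rule move_step_relabel) simp_all
    then show "psi (relabel (\<lambda>_. False) D) = psi (relabel (\<lambda>_. False) D')" by (rule
        invariant_step[OF psi_invariant])
  qed
  then show ?thesis using psi_relabel[OF assms] by (simp add: psi_str_def comp_def)
qed

definition Psi :: "vstring RX \<Rightarrow> skein" where
  "Psi = rx_eval skein_const psi_str"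

lemma Psi_homo: "ring_homo Psi" unfolding Psi_def by (rule rx_eval_ring_homo[OF skein_const_homo])

text \<open>The trivial class needs an argument: there \<open>str_var P\<close> is 0, and
  \<open>psi P\<close> vanishes because homotopy invariance reduces it to
  \<open>psi {}\<close>.\<close>

lemma Psi_str_var:
  assumes "wf_arrows P" shows "Psi (str_var P) = psi P"
proof (cases "str_class P \<in> S0")
  case True
  then show ?thesis using psi_str_class[OF assms] by (simp add: str_var_def Psi_def rx_eval_pvar[OF
      skein_const_homo])
next
  case False
  then have "str_class P = str_class {}" by (simp add: S0_def str_class_def)
  then have "psi P = 0" using psi_str_class[OF assms] psi_str_class[of "{}"] psi_empty by simp
  then show ?thesis using False by (simp add: str_var_def ring_homoD(4)[OF Psi_homo])
qed

text \<open>\<open>Psi\<close> turns the sum with values \<open>str_var\<close> term by term into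
  the one with values \<open>psi\<close>, which is the class of \<open>D\<close> by the recursion
  defining \<open>psi\<close>.\<close>

lemma Psi_state_sum:
  assumes "wf_arrows D" shows "Psi (state_sum pconst str_var D) = skein_knot D"
proof -
  have "Psi (sterm pconst str_var D F) = sterm skein_const psi D F" for F
  proof -
    have "Psi (str_var (piece D F v)) = psi (piece D F v)" for v
      by (rule Psi_str_var, rule wf_subset[OF assms]) (auto simp: piece_def)
    moreover have "Psi (pconst c) = skein_const c" for c unfolding Psi_def by (rule rx_eval_pconst[OF
        skein_const_homo])
    ultimately show ?thesis unfolding sterm_def by (simp add: ring_homoD(2)[OF Psi_homo]
        ring_homo_prod[OF Psi_homo])
  qed
  then have "Psi (state_sum pconst str_var D) = state_sum skein_const psi D" unfolding state_sum_def by
      (simp add: ring_homo_sum[OF Psi_homo])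
  then show ?thesis using state_sum_psi[OF wf_finite[OF assms]] by simp
qed

text \<open>Compared on constants and on single knots. If \<open>nabla_hom p\<close> vanishes, the
  class of \<open>p\<close> is then 0, so the kernel is no larger than the skein ideal.\<close>

lemma Psi_nabla_hom: "Psi (nabla_hom p) = abs_skein p"
proof (rule rx_homo_eqI[of "\<lambda>p. Psi (nabla_hom p)" abs_skein])
  show "ring_homo (\<lambda>p. Psi (nabla_hom p))" by (rule ring_homo_comp[OF Psi_homo nabla_hom_homo])
  show "Psi (nabla_hom (pconst c)) = abs_skein (pconst c)" for c
    unfolding nabla_hom_pconst Psi_def rx_eval_pconst[OF skein_const_homo] by (simp add: skein_const_def)
  show "Psi (nabla_hom (pvar K)) = abs_skein (pvar K)" for K
    using Psi_state_sum[OF wf_rep_vknot, of K] nabla_hom_pvar[OF wf_rep_vknot, of K] by (simp add: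
        abs_rep_vknot skein_knot_def)
qed (rule abs_skein_homo)

text \<open>An algebra homomorphism onto \<open>RS0\<close> whose kernel is the skein ideal is the
  same as an isomorphism from the quotient onto \<open>RS0\<close>.\<close>

theorem theorem10p1:
  shows "\<exists>nabla :: vknot RX \<Rightarrow> vstring RX.
    R_alg_hom nabla \<and> range nabla = RS0 \<and> (\<forall>p. nabla p = 0 \<longleftrightarrow> p \<in> skein_ideal)"
proof (intro exI conjI allI iffI)
  show "R_alg_hom nabla_hom"
    unfolding R_alg_hom_def using nabla_hom_homo nabla_hom_pconst by (auto simp: ring_homo_def)
  show "range nabla_hom = RS0" by (rule range_nabla_hom)
  show "p \<in> skein_ideal" if "nabla_hom p = 0" for p
    using Psi_nabla_hom[of p] that by (simp add: ring_homoD(4)[OF Psi_homo] abs_skein_eq_0)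
qed (rule nabla_hom_skein_ideal)

end
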